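(* Let $p_{XY}$ have full support on $\mathcal X\times\mathcal Y$ and let $p_{Z|XY}$ be in normal form, and consider any secure protocol $\Pi(p_{XY},p_{Z|XY})$. (1) Suppose there is no partition $\mathcal X=\mathcal X_1\cup\mathcal X_2$ into two disjoint nonempty sets such that the sets $\mathcal Z_k=\{z: \exists x\in\mathcal X_k, y\in\mathcal Y,\ p(z|x,y)>0\}$, $k=1,2$, are disjoint. Then \[H(M_{31})\ge \sup_{p_{X'}}\Big(\Big(\sup_{p_{Y'}} RI(Y';Z')\Big)+\Big(\sup_{p_{Y''}} H(X',Z''|Y'')\Big)\Big),\] with the terms evaluated under $p_{X'}(x')p_{Y'}(y')p_{Z|XY}(z'|x',y')p_{Y''}(y'')p_{Z|XY}(z''|x',y'')$. (2) Suppose there is no partition $\mathcal Y=\mathcal Y_1\cup\mathcal Y_2$ into two disjoint nonempty sets such that the sets $\mathcal Z_k=\{z: \exists x\in\mathcal X, y\in\mathcal Y_k,\ p(z|x,y)>0\}$, $k=1,2$, are disjoint. Then \[H(M_{23})\ge \sup_{p_{Y'}}\Big(\Big(\sup_{p_{X'}} RI(X';Z')\Big)+\Big(\sup_{p_{X''}} H(Y',Z''|X'')\Big)\Big),\] with the terms evaluated under $p_{X'}(x')p_{Y'}(y')p_{Z|XY}(z'|x',y')p_{X''}(x'')p_{Z|XY}(z''|x'',y')$. All suprema range over distributions with full support; left-hand sides are computed under the original $p_{XY}$ and the protocol.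
   Context: Setting: $\mathcal X,\mathcal Y,\mathcal Z$ are finite sets. Alice (party 1) holds input $X\in\mathcal X$, Bob (party 2) holds $Y\in\mathcal Y$, with $(X,Y)\sim p_{XY}$; Charlie (party 3) has no input and outputs $Z\in\mathcal Z$. A randomized function is a conditional distribution $p_{Z|XY}$. In a protocol the three parties, each using private randomness (no shared randomness), exchange messages over multiple rounds on three pairwise private links; each message on a link is a codeword of a prefix-free code determined by the previous messages on that link, and the protocol terminates with probability 1. The protocol may depend on $p_{XY}$. $M_{12},M_{23},M_{31}$ denote the final transcripts on the Alice–Bob, Bob–Charlie and Charlie–Alice links. A secure protocol $\Pi(p_{XY},p_{Z|XY})$ satisfies: (correctness) on inputs $x,y$ Charlie's output is distributed as $p_{Z|X=x,Y=y}$; (privacy) under the joint distribution induced by $(X,Y)\sim p_{XY}$ and the protocol, the Markov chains $(M_{12},M_{31})-X-(Y,Z)$, $(M_{12},M_{23})-Y-(X,Z)$, $(M_{23},M_{31})-Z-(X,Y)$ hold. Logarithms base 2. Normal form: $p_{Z|XY}$ is in normal form if (i) $p(z|x,y)=p(z|x',y)$ for all $y,z$ implies $x=x'$; (ii) $p(z|x,y)=p(z|x,y')$ for all $x,z$ implies $y=y'$; (iii) existence of a constant $c$ with $p(z|x,y)=c\,p(z'|x,y)$ for all $x,y$ implies $z=z'$. Residual information: $RI(U;V)=I(U;V)-H(U\sqcap V)$, where $U\sqcap V$ is a random variable of maximum entropy among those of the form $f(U)=g(V)$ for deterministic $f,g$. *)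

theory Defs
  imports "HOL-Probability.Probability" "HOL-Library.Sublist"
begin

definition fs_dists :: "('a::finite \<Rightarrow> real) set" where
  "fs_dists = {p. (\<forall>a. p a > 0) \<and> sum p UNIV = 1}"

definition cond_dist :: "('x::finite \<Rightarrow> 'y::finite \<Rightarrow> 'z::finite \<Rightarrow> real) \<Rightarrow> bool" where
  "cond_dist W \<longleftrightarrow> (\<forall>x y z. W x y z \<ge> 0) \<and> (\<forall>x y. (\<Sum>z\<in>UNIV. W x y z) = 1)"

definition mutual_info :: "('a::finite \<times> 'b::finite \<Rightarrow> real) \<Rightarrow> real" where
  "mutual_info q = (\<Sum>(a,b)\<in>UNIV. q (a,b) *
      log 2 (q (a,b) / ((\<Sum>b'\<in>UNIV. q (a,b')) * (\<Sum>a'\<in>UNIV. q (a',b)))))"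

definition cond_entropy :: "('a::finite \<times> 'b::finite \<Rightarrow> real) \<Rightarrow> real" where
  "cond_entropy q = - (\<Sum>(a,b)\<in>UNIV. q (a,b) * log 2 (q (a,b) / (\<Sum>a'\<in>UNIV. q (a',b))))"

text \<open>Entropy of f(U) when U has pmf p (f takes values in nat; any finite-valued
  function of U can be relabelled this way without changing the entropy).\<close>
definition entropy_img :: "('a::finite \<Rightarrow> real) \<Rightarrow> ('a \<Rightarrow> nat) \<Rightarrow> real" where
  "entropy_img p f = - (\<Sum>k\<in>f ` UNIV.
      (\<Sum>u\<in>{u. f u = k}. p u) * log 2 (\<Sum>u\<in>{u. f u = k}. p u))"

definition gk_common :: "('a::finite \<times> 'b::finite \<Rightarrow> real) \<Rightarrow> real" where
  "gk_common q = Sup ((\<lambda>(f,g). entropy_img (\<lambda>u. \<Sum>v\<in>UNIV. q (u,v)) f) `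
      {(f :: 'a \<Rightarrow> nat, g :: 'b \<Rightarrow> nat). \<forall>u v. q (u,v) > 0 \<longrightarrow> f u = g v})"

definition residual_info :: "('a::finite \<times> 'b::finite \<Rightarrow> real) \<Rightarrow> real" where
  "residual_info q = mutual_info q - gk_common q"

definition normal_form :: "('x::finite \<Rightarrow> 'y::finite \<Rightarrow> 'z::finite \<Rightarrow> real) \<Rightarrow> bool" where
  "normal_form W \<longleftrightarrow>
     (\<forall>x x'. (\<forall>y z. W x y z = W x' y z) \<longrightarrow> x = x') \<and>
     (\<forall>y y'. (\<forall>x z. W x y z = W x y' z) \<longrightarrow> y = y') \<and>
     (\<forall>z z'. (\<exists>c. \<forall>x y. W x y z = c * W x y z') \<longrightarrow> z = z')"

definition Zset_X :: "('x \<Rightarrow> 'y \<Rightarrow> 'z \<Rightarrow> real) \<Rightarrow> 'x set \<Rightarrow> 'z set" where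
  "Zset_X W S = {z. \<exists>x\<in>S. \<exists>y. W x y z > 0}"

definition Zset_Y :: "('x \<Rightarrow> 'y \<Rightarrow> 'z \<Rightarrow> real) \<Rightarrow> 'y set \<Rightarrow> 'z set" where
  "Zset_Y W S = {z. \<exists>x. \<exists>y\<in>S. W x y z > 0}"

definition X_splits :: "('x \<Rightarrow> 'y \<Rightarrow> 'z \<Rightarrow> real) \<Rightarrow> bool" where
  "X_splits W \<longleftrightarrow> (\<exists>X1 X2. X1 \<union> X2 = UNIV \<and> X1 \<inter> X2 = {} \<and> X1 \<noteq> {} \<and> X2 \<noteq> {} \<and>
      Zset_X W X1 \<inter> Zset_X W X2 = {})"

definition Y_splits :: "('x \<Rightarrow> 'y \<Rightarrow> 'z \<Rightarrow> real) \<Rightarrow> bool" where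
  "Y_splits W \<longleftrightarrow> (\<exists>Y1 Y2. Y1 \<union> Y2 = UNIV \<and> Y1 \<inter> Y2 = {} \<and> Y1 \<noteq> {} \<and> Y2 \<noteq> {} \<and>
      Zset_Y W Y1 \<inter> Zset_Y W Y2 = {})"

text \<open>Messages are bit strings. Synchronous rounds: in every round each party sends one
  message (possibly the empty string) to each of the two other parties, as a function
  of its input, its private randomness and the histories of its two links.
  A link history is a list, one entry per round:
    link 12: (message A->B, message B->A), link 23: (B->C, C->B), link 31: (C->A, A->C).\<close>

type_synonym msg = "bool list"
type_synonym lhist = "(msg \<times> msg) list"

datatype direction = AtoB | BtoA | BtoC | CtoB | CtoA | AtoC

definition prefix_free :: "msg set \<Rightarrow> bool" where
  "prefix_free C \<longleftrightarrow> (\<forall>u\<in>C. \<forall>v\<in>C. prefix u v \<longrightarrow> u = v)"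

record ('x, 'y, 'z, 'ra, 'rb, 'rc) protocol =
  rndA :: "'ra measure"
  rndB :: "'rb measure"
  rndC :: "'rc measure"
  sendA :: "'x \<Rightarrow> 'ra \<Rightarrow> lhist \<Rightarrow> lhist \<Rightarrow> msg \<times> msg"  \<comment> \<open>(h12,h31) to (to B, to C)\<close>
  sendB :: "'y \<Rightarrow> 'rb \<Rightarrow> lhist \<Rightarrow> lhist \<Rightarrow> msg \<times> msg"  \<comment> \<open>(h12,h23) to (to A, to C)\<close>
  sendC :: "'rc \<Rightarrow> lhist \<Rightarrow> lhist \<Rightarrow> msg \<times> msg"        \<comment> \<open>(h23,h31) to (to B, to A)\<close>
  outC :: "'rc \<Rightarrow> msg \<Rightarrow> msg \<Rightarrow> 'z"                    \<comment> \<open>output from final (M23, M31)\<close>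
  codebook :: "direction \<Rightarrow> lhist \<Rightarrow> msg set"

definition rnd :: "('x, 'y, 'z, 'ra, 'rb, 'rc) protocol \<Rightarrow> ('ra \<times> 'rb \<times> 'rc) measure" where
  "rnd P = rndA P \<Otimes>\<^sub>M (rndB P \<Otimes>\<^sub>M rndC P)"

fun hist :: "('x, 'y, 'z, 'ra, 'rb, 'rc) protocol \<Rightarrow> 'x \<Rightarrow> 'y \<Rightarrow> 'ra \<times> 'rb \<times> 'rc \<Rightarrow> nat
    \<Rightarrow> lhist \<times> lhist \<times> lhist" where
  "hist P x y r 0 = ([], [], [])"
| "hist P x y r (Suc n) =
     (case r of (ra, rb, rc) \<Rightarrow> case hist P x y r n of (h12, h23, h31) \<Rightarrow>
        (case sendA P x ra h12 h31 of (ab, ac) \<Rightarrow>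
         case sendB P y rb h12 h23 of (ba, bc) \<Rightarrow>
         case sendC P rc h23 h31 of (cb, ca) \<Rightarrow>
           (h12 @ [(ab, ba)], h23 @ [(bc, cb)], h31 @ [(ca, ac)])))"

definition flat :: "lhist \<Rightarrow> msg" where
  "flat h = concat (map (\<lambda>(u, v). u @ v) h)"

definition transcripts :: "('x, 'y, 'z, 'ra, 'rb, 'rc) protocol \<Rightarrow> 'x \<Rightarrow> 'y \<Rightarrow> 'ra \<times> 'rb \<times> 'rc
    \<Rightarrow> nat \<Rightarrow> msg \<times> msg \<times> msg" where
  "transcripts P x y r n = (case hist P x y r n of (h12, h23, h31) \<Rightarrow> (flat h12, flat h23, flat h31))"

definition terminates :: "('x, 'y, 'z, 'ra, 'rb, 'rc) protocol \<Rightarrow> 'x \<Rightarrow> 'y \<Rightarrow> 'ra \<times> 'rb \<times> 'rc \<Rightarrow> bool" where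
  "terminates P x y r \<longleftrightarrow> (\<exists>N. \<forall>n\<ge>N. transcripts P x y r n = transcripts P x y r N)"

definition final_transcripts :: "('x, 'y, 'z, 'ra, 'rb, 'rc) protocol \<Rightarrow> 'x \<Rightarrow> 'y \<Rightarrow> 'ra \<times> 'rb \<times> 'rc
    \<Rightarrow> msg \<times> msg \<times> msg" where
  "final_transcripts P x y r =
     transcripts P x y r (LEAST N. \<forall>n\<ge>N. transcripts P x y r n = transcripts P x y r N)"

definition M12 :: "('x, 'y, 'z, 'ra, 'rb, 'rc) protocol \<Rightarrow> 'x \<Rightarrow> 'y \<Rightarrow> 'ra \<times> 'rb \<times> 'rc \<Rightarrow> msg" where
  "M12 P x y r = fst (final_transcripts P x y r)"
definition M23 :: "('x, 'y, 'z, 'ra, 'rb, 'rc) protocol \<Rightarrow> 'x \<Rightarrow> 'y \<Rightarrow> 'ra \<times> 'rb \<times> 'rc \<Rightarrow> msg" where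
  "M23 P x y r = fst (snd (final_transcripts P x y r))"
definition M31 :: "('x, 'y, 'z, 'ra, 'rb, 'rc) protocol \<Rightarrow> 'x \<Rightarrow> 'y \<Rightarrow> 'ra \<times> 'rb \<times> 'rc \<Rightarrow> msg" where
  "M31 P x y r = snd (snd (final_transcripts P x y r))"

definition Zout :: "('x, 'y, 'z, 'ra, 'rb, 'rc) protocol \<Rightarrow> 'x \<Rightarrow> 'y \<Rightarrow> 'ra \<times> 'rb \<times> 'rc \<Rightarrow> 'z" where
  "Zout P x y r = outC P (snd (snd r)) (M23 P x y r) (M31 P x y r)"

definition Pr :: "('x::finite \<Rightarrow> 'y::finite \<Rightarrow> real) \<Rightarrow> ('x, 'y, 'z, 'ra, 'rb, 'rc) protocol
    \<Rightarrow> ('x \<Rightarrow> 'y \<Rightarrow> 'ra \<times> 'rb \<times> 'rc \<Rightarrow> bool) \<Rightarrow> real" where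
  "Pr pXY P E = (\<Sum>x\<in>UNIV. \<Sum>y\<in>UNIV. pXY x y * measure (rnd P) {r \<in> space (rnd P). E x y r})"

definition markov_chain ::
  "(('x \<Rightarrow> 'y \<Rightarrow> 'r \<Rightarrow> bool) \<Rightarrow> real) \<Rightarrow> ('x \<Rightarrow> 'y \<Rightarrow> 'r \<Rightarrow> 'a) \<Rightarrow> ('x \<Rightarrow> 'y \<Rightarrow> 'r \<Rightarrow> 'b)
     \<Rightarrow> ('x \<Rightarrow> 'y \<Rightarrow> 'r \<Rightarrow> 'c) \<Rightarrow> bool" where
  "markov_chain Q U V W \<longleftrightarrow> (\<forall>a b c.
     Q (\<lambda>x y r. U x y r = a \<and> V x y r = b \<and> W x y r = c) * Q (\<lambda>x y r. V x y r = b) =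
     Q (\<lambda>x y r. U x y r = a \<and> V x y r = b) * Q (\<lambda>x y r. V x y r = b \<and> W x y r = c))"

definition valid_protocol :: "('x::finite \<Rightarrow> 'y::finite \<Rightarrow> real) \<Rightarrow> ('x, 'y, 'z, 'ra, 'rb, 'rc) protocol \<Rightarrow> bool" where
  "valid_protocol pXY P \<longleftrightarrow>
     prob_space (rndA P) \<and> prob_space (rndB P) \<and> prob_space (rndC P) \<and>
     (\<forall>x h h'. (\<lambda>ra. sendA P x ra h h') \<in> rndA P \<rightarrow>\<^sub>M count_space UNIV) \<and>
     (\<forall>y h h'. (\<lambda>rb. sendB P y rb h h') \<in> rndB P \<rightarrow>\<^sub>M count_space UNIV) \<and>
     (\<forall>h h'. (\<lambda>rc. sendC P rc h h') \<in> rndC P \<rightarrow>\<^sub>M count_space UNIV) \<and>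
     (\<forall>m m'. (\<lambda>rc. outC P rc m m') \<in> rndC P \<rightarrow>\<^sub>M count_space UNIV) \<and>
     (\<forall>d h. prefix_free (codebook P d h)) \<and>
     (\<forall>x ra h12 h31. fst (sendA P x ra h12 h31) \<in> codebook P AtoB h12 \<and>
                     snd (sendA P x ra h12 h31) \<in> codebook P AtoC h31) \<and>
     (\<forall>y rb h12 h23. fst (sendB P y rb h12 h23) \<in> codebook P BtoA h12 \<and>
                     snd (sendB P y rb h12 h23) \<in> codebook P BtoC h23) \<and>
     (\<forall>rc h23 h31. fst (sendC P rc h23 h31) \<in> codebook P CtoB h23 \<and>
                   snd (sendC P rc h23 h31) \<in> codebook P CtoA h31) \<and>
     (\<forall>x y. pXY x y > 0 \<longrightarrow> (AE r in rnd P. terminates P x y r))"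

definition secure_protocol :: "('x::finite \<Rightarrow> 'y::finite \<Rightarrow> real) \<Rightarrow> ('x \<Rightarrow> 'y \<Rightarrow> 'z \<Rightarrow> real)
    \<Rightarrow> ('x, 'y, 'z, 'ra, 'rb, 'rc) protocol \<Rightarrow> bool" where
  "secure_protocol pXY W P \<longleftrightarrow>
     valid_protocol pXY P \<and>
     \<comment> \<open>correctness\<close>
     (\<forall>x y z. pXY x y > 0 \<longrightarrow> measure (rnd P) {r \<in> space (rnd P). Zout P x y r = z} = W x y z) \<and>
     \<comment> \<open>privacy\<close>
     markov_chain (Pr pXY P) (\<lambda>x y r. (M12 P x y r, M31 P x y r)) (\<lambda>x y r. x)
                             (\<lambda>x y r. (y, Zout P x y r)) \<and>
     markov_chain (Pr pXY P) (\<lambda>x y r. (M12 P x y r, M23 P x y r)) (\<lambda>x y r. y)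
                             (\<lambda>x y r. (x, Zout P x y r)) \<and>
     markov_chain (Pr pXY P) (\<lambda>x y r. (M23 P x y r, M31 P x y r)) (\<lambda>x y r. Zout P x y r)
                             (\<lambda>x y r. (x, y))"

definition disc_entropy :: "('a \<Rightarrow> real) \<Rightarrow> ennreal" where
  "disc_entropy q = (\<Sum>\<^sub>\<infinity>a. ennreal (- q a * log 2 (q a)))"

definition H_M31 :: "('x::finite \<Rightarrow> 'y::finite \<Rightarrow> real) \<Rightarrow> ('x, 'y, 'z, 'ra, 'rb, 'rc) protocol \<Rightarrow> ennreal" where
  "H_M31 pXY P = disc_entropy (\<lambda>m. Pr pXY P (\<lambda>x y r. M31 P x y r = m))"

definition H_M23 :: "('x::finite \<Rightarrow> 'y::finite \<Rightarrow> real) \<Rightarrow> ('x, 'y, 'z, 'ra, 'rb, 'rc) protocol \<Rightarrow> ennreal" where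
  "H_M23 pXY P = disc_entropy (\<lambda>m. Pr pXY P (\<lambda>x y r. M23 P x y r = m))"

end

theory Submission
  imports Defs
begin

text \<open>
  Privacy makes the law of \<open>M\<^sub>3\<^sub>1\<close> a function of \<open>x\<close> alone and of \<open>z\<close> alone, hence a constant when \<open>X\<close> does not
  split, and it makes the law of \<open>(M\<^sub>1\<^sub>2, M\<^sub>3\<^sub>1)\<close> depend on the law of \<open>X\<close> only. So the two summands of
  \<open>H(M\<^sub>3\<^sub>1) = H(M\<^sub>3\<^sub>1|M\<^sub>1\<^sub>2) + I(M\<^sub>1\<^sub>2;M\<^sub>3\<^sub>1)\<close> can be bounded under independent inputs with the same law of \<open>X\<close> but
  different laws of \<open>Y\<close>. Cuts determine \<open>X\<close>, \<open>Y\<close> and \<open>Z\<close> from the links of the respective party, so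
  \<open>H(M\<^sub>3\<^sub>1|M\<^sub>1\<^sub>2) \<ge> H(M\<^sub>3\<^sub>1|M\<^sub>1\<^sub>2 M\<^sub>2\<^sub>3) \<ge> H(X Z|M\<^sub>1\<^sub>2 M\<^sub>2\<^sub>3) = H(X Z|Y)\<close>. For independent inputs
  \<open>I(M\<^sub>1\<^sub>2;M\<^sub>3\<^sub>1) - I(M\<^sub>1\<^sub>2;M\<^sub>3\<^sub>1|M\<^sub>2\<^sub>3)\<close> starts at 0 and never decreases when a message is sent, whence
  \<open>I(M\<^sub>1\<^sub>2;M\<^sub>3\<^sub>1) \<ge> I(M\<^sub>1\<^sub>2;M\<^sub>3\<^sub>1|M\<^sub>2\<^sub>3) \<ge> I(Y;Z|Q) = I(Y;Z) - H(Q)\<close>, where \<open>Q\<close>, the conditional law of \<open>M\<^sub>2\<^sub>3\<close>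
  given \<open>Y\<close> or equivalently given \<open>Z\<close>, is a common part of \<open>Y\<close> and \<open>Z\<close>.
\<close>

section \<open>Conditional entropy of discrete random variables\<close>

text \<open>Transcripts range over an infinite alphabet and the number of rounds is unbounded, so
  H(M12) and H(M23) may be infinite and mutual informations cannot be freely split into entropies.
  If H(M31) is infinite the bound is trivial; otherwise everything is phrased through conditional
  entropies of M31 or of finitely valued variables, which are finite. A term such as I(A';C|A) that
  cannot be split is treated as the expectation of the logarithm of a mass ratio. The monotone
  quantity is followed for finitely many rounds, recovered from the final transcripts by
  prefix-freeness, and then a limit is taken. Inputs with another law become accessible because full
  support of \<open>pXY\<close> turns each Markov chain into an identity at every single input pair;
  the resulting kernel can be fed any product law. Independence of the inputs is what keeps the law
  of a partial run a product of one factor per party. Private randomness lives in arbitrary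
  probability spaces, so outcomes are transported to mass functions on a countable type.\<close>

definition mass :: "'w pmf \<Rightarrow> ('w \<Rightarrow> 'a) \<Rightarrow> 'w \<Rightarrow> real" where
  "mass p U w = measure_pmf.prob p {w'. U w' = U w}"

text \<open>Functional dependence, required on the support only. Together with \<open>mass\<close>
  it makes every entropy an expectation over sample points, whatever the type in which a variable
  takes its values.\<close>

definition det_by :: "'w pmf \<Rightarrow> ('w \<Rightarrow> 'a) \<Rightarrow> ('w \<Rightarrow> 'b) \<Rightarrow> bool" where
  "det_by p U V \<longleftrightarrow> (\<forall>w\<in>set_pmf p. \<forall>w'\<in>set_pmf p. V w = V w' \<longrightarrow> U w = U w')"

text \<open>The conditional entropy \<open>H(U|V)\<close> in bits, meaningful under \<open>fin_ent p U\<close>: without integrability the Bochner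
  integral returns the junk value 0.\<close>

definition cond_ent :: "'w pmf \<Rightarrow> ('w \<Rightarrow> 'a) \<Rightarrow> ('w \<Rightarrow> 'b) \<Rightarrow> real" where
  "cond_ent p U V = (\<integral>w. log 2 (mass p V w / mass p (\<lambda>w. (U w, V w)) w) \<partial>measure_pmf p)"

definition fin_ent :: "'w pmf \<Rightarrow> ('w \<Rightarrow> 'a) \<Rightarrow> bool" where
  "fin_ent p U \<longleftrightarrow> integrable (measure_pmf p) (\<lambda>w. log 2 (mass p U w))"

text \<open>The identity P(u,v,t) P(t) = P(u,t) P(v,t) is asked for at points of the support, which
  is where logarithms of masses are evaluated.\<close>

definition cond_indep :: "'w pmf \<Rightarrow> ('w \<Rightarrow> 'a) \<Rightarrow> ('w \<Rightarrow> 'b) \<Rightarrow> ('w \<Rightarrow> 'c) \<Rightarrow> bool" where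
  "cond_indep p U V T \<longleftrightarrow> (\<forall>w\<in>set_pmf p.
     mass p (\<lambda>w. (U w, V w, T w)) w * mass p T w =
     mass p (\<lambda>w. (U w, T w)) w * mass p (\<lambda>w. (V w, T w)) w)"

lemma det_byI:
  "(\<And>w w'. w \<in> set_pmf p \<Longrightarrow> w' \<in> set_pmf p \<Longrightarrow> V w = V w' \<Longrightarrow> U w = U w') \<Longrightarrow> det_by p U V"
  unfolding det_by_def by blast

lemma det_byD: "det_by p U V \<Longrightarrow> V w = V w' \<Longrightarrow> w \<in> set_pmf p \<Longrightarrow> w' \<in> set_pmf p \<Longrightarrow> U w = U w'"
  unfolding det_by_def by blast

lemma det_refl: "det_by p U U"
  by (rule det_byI)

lemma det_trans:
  assumes "det_by p U V" "det_by p V T"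
  shows "det_by p U T"
  by (rule det_byI) (rule det_byD[OF assms(1)], rule det_byD[OF assms(2)])

lemma det_pair:
  assumes "det_by p U V" "det_by p T V"
  shows "det_by p (\<lambda>w. (U w, T w)) V"
  by (rule det_byI, rule arg_cong2[where f = Pair]) (rule det_byD[OF assms(1)] det_byD[OF assms(2)], assumption+)+

lemma det_by_fst:
  assumes "det_by p U V"
  shows "det_by p U (\<lambda>w. (V w, T w))"
  by (rule det_byI, rule det_byD[OF assms]) simp_all

lemma det_by_snd:
  assumes "det_by p U T"
  shows "det_by p U (\<lambda>w. (V w, T w))"
  by (rule det_byI, rule det_byD[OF assms]) simp_all

lemmas det_intros = det_refl det_pair det_by_fst det_by_snd

lemma borel_measurable_pmf: "(f :: 'w \<Rightarrow> real) \<in> borel_measurable (measure_pmf p)"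
  by simp

lemma mass_nonneg [simp]: "0 \<le> mass p U w"
  by (simp add: mass_def)

lemma mass_le_1: "mass p U w \<le> 1"
  by (simp add: mass_def)

lemma mass_pos: "w \<in> set_pmf p \<Longrightarrow> 0 < mass p U w"
  unfolding mass_def by (rule measure_pmf_posI) auto

lemma mass_neq_0: "w \<in> set_pmf p \<Longrightarrow> mass p U w \<noteq> 0"
  using mass_pos[of w p U] by simp

lemma mass_mono:
  assumes "det_by p U V" "w \<in> set_pmf p"
  shows "mass p V w \<le> mass p U w"
proof -
  have "mass p V w = measure_pmf.prob p ({w'. V w' = V w} \<inter> set_pmf p)"
    by (simp add: mass_def measure_Int_set_pmf)
  also have "\<dots> \<le> mass p U w"
    unfolding mass_def using assms by (intro measure_pmf.finite_measure_mono) (auto dest: det_byD[OF assms(1)])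
  finally show ?thesis .
qed

lemma mass_cong:
  assumes "det_by p U V" "det_by p V U" "w \<in> set_pmf p"
  shows "mass p U w = mass p V w"
  by (rule antisym; rule mass_mono; rule assms)

lemma integrable_sandwich:
  fixes f :: "'w \<Rightarrow> real"
  assumes "integrable (measure_pmf p) g"
    and "\<And>w. w \<in> set_pmf p \<Longrightarrow> 0 \<le> f w \<and> f w \<le> g w"
  shows "integrable (measure_pmf p) f"
proof (rule Bochner_Integration.integrable_bound[OF assms(1)])
  show "AE w in measure_pmf p. norm (f w) \<le> norm (g w)"
  proof (rule AE_pmfI)
    fix w assume "w \<in> set_pmf p"
    from assms(2)[OF this] show "norm (f w) \<le> norm (g w)" by simp
  qed
qed simp

lemma fin_ent_det:
  assumes "fin_ent p V" "det_by p U V"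
  shows "fin_ent p U"
proof -
  have "integrable (measure_pmf p) (\<lambda>w. - log 2 (mass p U w))"
  proof (rule integrable_sandwich)
    show "integrable (measure_pmf p) (\<lambda>w. - log 2 (mass p V w))"
      using assms(1) by (simp add: fin_ent_def)
  qed (use assms(2) in \<open>auto simp: mass_pos mass_le_1 mass_mono\<close>)
  thus ?thesis by (simp add: fin_ent_def)
qed

section \<open>Mass ratios and Gibbs' inequality\<close>

lemma nn_integral_pmf_swap:
  "(\<integral>\<^sup>+x. (\<integral>\<^sup>+y. f x y \<partial>measure_pmf q) \<partial>measure_pmf p) =
   (\<integral>\<^sup>+y. (\<integral>\<^sup>+x. f x y \<partial>measure_pmf p) \<partial>measure_pmf q)"
  using nn_integral_pair_pmf'[where f = "\<lambda>z. f (fst z) (snd z)" and A = p and B = q]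
    nn_integral_pair_pmf'[where f = "\<lambda>z. f (snd z) (fst z)" and A = q and B = p]
  by (subst (asm) pair_commute_pmf[of p q]) (simp only: nn_integral_map_pmf case_prod_unfold fst_conv snd_conv)

text \<open>Each mass is the expectation of an indicator over an independent copy, so after
  Fubini only the trivial bound for the mass of a single cell is needed.\<close>

lemma nn_integral_mass_ratio_le_1:
  "(\<integral>\<^sup>+w. ennreal (mass p (\<lambda>w. (U w, T w)) w * mass p (\<lambda>w. (V w, T w)) w /
        (mass p (\<lambda>w. (U w, V w, T w)) w * mass p T w)) \<partial>measure_pmf p) \<le> 1"
proof -
  \<comment> \<open>Where a mass vanishes, which happens only off the support, \<open>c\<close>
    takes the value 1 / 0 = 0.\<close>
  define c where "c w = 1 / (mass p (\<lambda>w. (U w, V w, T w)) w * mass p T w)" for w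
  define I1 :: "'a \<Rightarrow> 'a \<Rightarrow> ennreal" where "I1 w w' = indicator {w'. U w' = U w \<and> T w' = T w} w'" for w w'
  define I2 :: "'a \<Rightarrow> 'a \<Rightarrow> ennreal" where "I2 w w' = indicator {w'. V w' = V w \<and> T w' = T w} w'" for w w'
  have c0: "0 \<le> c w" for w by (simp add: c_def)
  have m1: "ennreal (mass p (\<lambda>w. (U w, T w)) w) = (\<integral>\<^sup>+w'. I1 w w' \<partial>measure_pmf p)" for w
    by (simp add: I1_def mass_def measure_pmf.emeasure_eq_measure)
  have m2: "ennreal (mass p (\<lambda>w. (V w, T w)) w) = (\<integral>\<^sup>+w'. I2 w w' \<partial>measure_pmf p)" for w
    by (simp add: I2_def mass_def measure_pmf.emeasure_eq_measure)
  have inner: "(\<integral>\<^sup>+w. ennreal (c w) * I1 w w1 * I2 w w2 \<partial>measure_pmf p)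
      \<le> ennreal (1 / mass p T w1) * indicator {w2. T w2 = T w1} w2" (is "?L \<le> ?R") for w1 w2
  proof (cases "T w2 = T w1")
    case False
    hence "I1 w w1 * I2 w w2 = 0" for w by (auto simp: I1_def I2_def indicator_def)
    hence "?L = 0" by (simp only: mult.assoc mult_zero_right nn_integral_0_iff) simp
    thus ?thesis by simp
  next
    case True
    \<comment> \<open>With \<open>w1\<close> and \<open>w2\<close> fixed, the points taking
      \<open>U\<close> from \<open>w1\<close> and \<open>V\<close> from \<open>w2\<close> form a
      single cell \<open>S\<close>. There \<open>c\<close> is the reciprocal of P(\<open>S\<close>)
      times the mass of \<open>T\<close>, so integrating it over \<open>S\<close> leaves at most 1 /
      \<open>mass p T w1\<close>.\<close>
    define S where "S = {w. U w = U w1 \<and> V w = V w2 \<and> T w = T w1}"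
    have "ennreal (c w) * I1 w w1 * I2 w w2
        \<le> ennreal (1 / (measure_pmf.prob p S * mass p T w1)) * indicator S w" for w
    proof (cases "w \<in> S")
      case wS: True
      hence "{w'. U w' = U w \<and> V w' = V w \<and> T w' = T w} = S" by (auto simp: S_def)
      moreover have "mass p T w = mass p T w1" using wS by (simp add: mass_def S_def)
      ultimately have "c w = 1 / (measure_pmf.prob p S * mass p T w1)"
        by (simp add: c_def mass_def)
      thus ?thesis using wS by (auto simp: I1_def I2_def indicator_def)
    next
      case wS: False
      thus ?thesis using True by (auto simp: I1_def I2_def S_def indicator_def)
    qed
    hence "?L \<le> (\<integral>\<^sup>+w. ennreal (1 / (measure_pmf.prob p S * mass p T w1)) * indicator S w \<partial>measure_pmf p)"
      by (intro nn_integral_mono) auto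
    also have "\<dots> = ennreal (1 / (measure_pmf.prob p S * mass p T w1) * measure_pmf.prob p S)"
      by (simp add: nn_integral_cmult measure_pmf.emeasure_eq_measure ennreal_mult' del: times_divide_eq_left)
    also have "\<dots> \<le> ennreal (1 / mass p T w1)"
      by (intro ennreal_leI) (simp add: divide_simps not_less)
    finally show ?thesis using True by simp
  qed
  have "(\<integral>\<^sup>+w. ennreal (mass p (\<lambda>w. (U w, T w)) w * mass p (\<lambda>w. (V w, T w)) w /
        (mass p (\<lambda>w. (U w, V w, T w)) w * mass p T w)) \<partial>measure_pmf p)
      = (\<integral>\<^sup>+w. (\<integral>\<^sup>+w1. (\<integral>\<^sup>+w2. ennreal (c w) * I1 w w1 * I2 w w2 \<partial>measure_pmf p) \<partial>measure_pmf p) \<partial>measure_pmf p)"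
  proof (intro nn_integral_cong)
    fix w
    have "ennreal (mass p (\<lambda>w. (U w, T w)) w * mass p (\<lambda>w. (V w, T w)) w /
        (mass p (\<lambda>w. (U w, V w, T w)) w * mass p T w))
        = ennreal (c w) * ennreal (mass p (\<lambda>w. (U w, T w)) w) * ennreal (mass p (\<lambda>w. (V w, T w)) w)"
      by (simp add: c_def ennreal_mult'[symmetric])
    thus "ennreal (mass p (\<lambda>w. (U w, T w)) w * mass p (\<lambda>w. (V w, T w)) w /
        (mass p (\<lambda>w. (U w, V w, T w)) w * mass p T w)) =
        (\<integral>\<^sup>+w1. (\<integral>\<^sup>+w2. ennreal (c w) * I1 w w1 * I2 w w2 \<partial>measure_pmf p) \<partial>measure_pmf p)"
      by (simp add: m1 m2 nn_integral_cmult nn_integral_multc mult.assoc)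
  qed
  also have "\<dots> = (\<integral>\<^sup>+w1. (\<integral>\<^sup>+w2. (\<integral>\<^sup>+w. ennreal (c w) * I1 w w1 * I2 w w2 \<partial>measure_pmf p) \<partial>measure_pmf p) \<partial>measure_pmf p)"
    using nn_integral_pmf_swap[where f = "\<lambda>w w1. \<integral>\<^sup>+w2. ennreal (c w) * I1 w w1 * I2 w w2 \<partial>measure_pmf p"
        and p = p and q = p]
    by (simp only: nn_integral_pmf_swap[where f = "\<lambda>w w2. ennreal (c w) * I1 w w1 * I2 w w2" and p = p and q = p for w1])
  also have "\<dots> \<le> (\<integral>\<^sup>+w1. (\<integral>\<^sup>+w2. ennreal (1 / mass p T w1) * indicator {w2. T w2 = T w1} w2 \<partial>measure_pmf p) \<partial>measure_pmf p)"
    by (intro nn_integral_mono inner)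
  also have "\<dots> = (\<integral>\<^sup>+w1. ennreal (1 / mass p T w1 * mass p T w1) \<partial>measure_pmf p)"
    by (intro nn_integral_cong) (simp add: nn_integral_cmult measure_pmf.emeasure_eq_measure ennreal_mult'[symmetric] mass_def
        del: times_divide_eq_left)
  also have "\<dots> \<le> (\<integral>\<^sup>+w1. 1 \<partial>measure_pmf p)"
    by (intro nn_integral_mono) (auto simp: divide_simps)
  finally show ?thesis by simp
qed

text \<open>The ratio is P(u|t) P(v|t) / P(u,v|t), the density of the conditionally independent
  coupling with respect to the true joint law. Its integral falls below 1 when the coupling charges
  triples that the joint law misses.\<close>

lemma mass_ratio:
  fixes U :: "'w \<Rightarrow> 'a" and V :: "'w \<Rightarrow> 'b" and T :: "'w \<Rightarrow> 'c"
  defines "f \<equiv> \<lambda>p w. mass p (\<lambda>w. (U w, T w)) w * mass p (\<lambda>w. (V w, T w)) w /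
        (mass p (\<lambda>w. (U w, V w, T w)) w * mass p T w)"
  shows integrable_mass_ratio: "integrable (measure_pmf p) (f p)"
    and integral_mass_ratio_le_1: "(\<integral>w. f p w \<partial>measure_pmf p) \<le> 1"
proof -
  have nn: "(\<integral>\<^sup>+w. ennreal (f p w) \<partial>measure_pmf p) \<le> 1"
    unfolding f_def by (rule nn_integral_mass_ratio_le_1)
  have f0: "0 \<le> f p w" for w by (simp add: f_def)
  show int: "integrable (measure_pmf p) (f p)"
    using nn f0 by (intro integrableI_nonneg) (auto simp: le_less_trans ennreal_one_less_top)
  show "(\<integral>w. f p w \<partial>measure_pmf p) \<le> 1"
    using nn f0 int by (simp add: nn_integral_eq_integral)
qed

text \<open>From ln x \<le> x - 1. Asking for an integral of at most 1 covers likelihood ratios that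
  lose mass as well as the mixtures used for the limit.\<close>

lemma gibbs_inequality:
  assumes f: "\<And>w. w \<in> set_pmf p \<Longrightarrow> 0 < f w"
    and intf: "integrable (measure_pmf p) f" and le1: "(\<integral>w. f w \<partial>measure_pmf p) \<le> 1"
    and int: "integrable (measure_pmf p) (\<lambda>w. log 2 (1 / f w))"
  shows "0 \<le> (\<integral>w. log 2 (1 / f w) \<partial>measure_pmf p)"
proof -
  have "0 \<le> (\<integral>w. (1 - f w) / ln 2 \<partial>measure_pmf p)"
    using intf le1 by simp
  also have "\<dots> \<le> (\<integral>w. log 2 (1 / f w) \<partial>measure_pmf p)"
  proof (rule integral_mono_AE)
    show "AE w in measure_pmf p. (1 - f w) / ln 2 \<le> log 2 (1 / f w)"
    proof (rule AE_pmfI)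
      fix w assume "w \<in> set_pmf p"
      with f ln_le_minus_one[of "f w"] have "1 - f w \<le> ln (1 / f w)" by (auto simp: ln_div)
      thus "(1 - f w) / ln 2 \<le> log 2 (1 / f w)" by (simp add: log_def divide_right_mono)
    qed
  qed (use intf int in auto)
  finally show ?thesis .
qed

text \<open>H(\<open>U\<close>|\<open>V\<close>) is finite as soon as H(\<open>U\<close>) is,
  whatever the entropy of \<open>V\<close>: its logarithm is -log P(U) plus the logarithm of the
  likelihood ratio \<open>f\<close>, and log f \<le> f / ln 2 is integrable. The constant
  \<open>()\<close> as third variable turns the conditional ratio into the unconditional
  one.\<close>

lemma cond_ent_integrable:
  assumes "fin_ent p U"
  shows "integrable (measure_pmf p) (\<lambda>w. log 2 (mass p V w / mass p (\<lambda>w. (U w, V w)) w))"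
proof -
  define f where "f w = mass p (\<lambda>w. (U w, ())) w * mass p (\<lambda>w. (V w, ())) w /
        (mass p (\<lambda>w. (U w, V w, ())) w * mass p (\<lambda>w. ()) w)" for w
  have f: "f w = mass p U w * mass p V w / mass p (\<lambda>w. (U w, V w)) w" for w
    by (simp add: f_def mass_def)
  have "integrable (measure_pmf p) (\<lambda>w. - log 2 (mass p U w) + f w / ln 2)"
  proof (intro Bochner_Integration.integrable_add integrable_divide integrable_minus)
    show "integrable (measure_pmf p) f" unfolding f_def by (rule integrable_mass_ratio)
  qed (use assms in \<open>auto simp: fin_ent_def\<close>)
  thus ?thesis
  proof (rule integrable_sandwich)
    fix w assume w: "w \<in> set_pmf p"
    note pos = mass_pos[OF w, of U] mass_pos[OF w, of V] mass_pos[OF w, of "\<lambda>w. (U w, V w)"]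
    have "mass p (\<lambda>w. (U w, V w)) w \<le> mass p V w"
      using w by (intro mass_mono) (iprover intro: det_intros)+
    moreover have "log 2 (mass p V w / mass p (\<lambda>w. (U w, V w)) w) \<le> - log 2 (mass p U w) + f w / ln 2"
    proof -
      have "log 2 (mass p V w / mass p (\<lambda>w. (U w, V w)) w) = - log 2 (mass p U w) + log 2 (f w)"
        using pos by (simp add: f log_divide log_mult)
      moreover have "ln (f w) \<le> f w" using pos ln_le_minus_one[of "f w"] by (simp add: f)
      hence "log 2 (f w) \<le> f w / ln 2" by (simp add: log_def divide_right_mono)
      ultimately show ?thesis by simp
    qed
    ultimately show "0 \<le> log 2 (mass p V w / mass p (\<lambda>w. (U w, V w)) w) \<and>
      log 2 (mass p V w / mass p (\<lambda>w. (U w, V w)) w) \<le> - log 2 (mass p U w) + f w / ln 2"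
      using pos by simp
  qed
qed

section \<open>Rules for conditional entropy\<close>

lemma cond_ent_cong:
  assumes "det_by p V V'" "det_by p V' V"
    "det_by p (\<lambda>w. (U w, V w)) (\<lambda>w. (U' w, V' w))" "det_by p (\<lambda>w. (U' w, V' w)) (\<lambda>w. (U w, V w))"
  shows "cond_ent p U V = cond_ent p U' V'"
  unfolding cond_ent_def
proof (rule integral_cong_AE)
  show "AE w in measure_pmf p. log 2 (mass p V w / mass p (\<lambda>w. (U w, V w)) w) =
      log 2 (mass p V' w / mass p (\<lambda>w. (U' w, V' w)) w)"
    by (rule AE_pmfI) (simp only: mass_cong[OF assms(1,2)] mass_cong[OF assms(3,4)])
qed (rule borel_measurable_pmf)+

text \<open>The difference of the two sides is
  I(\<open>U\<close>;\<open>V\<close>|\<open>T\<close>), and Gibbs' inequality applies to the mass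
  ratio of \<open>U\<close> and \<open>V\<close> given \<open>T\<close>.\<close>

lemma cond_ent_mono:
  assumes fin: "fin_ent p U" and det: "det_by p T V"
  shows "cond_ent p U V \<le> cond_ent p U T"
proof -
  define f where "f w = mass p (\<lambda>w. (U w, T w)) w * mass p (\<lambda>w. (V w, T w)) w /
        (mass p (\<lambda>w. (U w, V w, T w)) w * mass p T w)" for w
  have eq: "log 2 (1 / f w) = log 2 (mass p T w / mass p (\<lambda>w. (U w, T w)) w)
      - log 2 (mass p V w / mass p (\<lambda>w. (U w, V w)) w)" if w: "w \<in> set_pmf p" for w
  proof -
    have "mass p (\<lambda>w. (V w, T w)) w = mass p V w"
      using det w by (intro mass_cong) (iprover intro: det_intros)+
    moreover have "mass p (\<lambda>w. (U w, V w, T w)) w = mass p (\<lambda>w. (U w, V w)) w"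
      using det w by (intro mass_cong) (iprover intro: det_intros)+
    ultimately show ?thesis
      by (simp add: f_def log_divide log_mult mass_neq_0[OF w])
  qed
  have int: "integrable (measure_pmf p) (\<lambda>w. log 2 (mass p T w / mass p (\<lambda>w. (U w, T w)) w)
      - log 2 (mass p V w / mass p (\<lambda>w. (U w, V w)) w))"
    by (intro Bochner_Integration.integrable_diff cond_ent_integrable fin)
  have "0 \<le> (\<integral>w. log 2 (1 / f w) \<partial>measure_pmf p)"
  proof (rule gibbs_inequality)
    show "0 < f w" if "w \<in> set_pmf p" for w using that by (simp add: f_def mass_pos)
    show "integrable (measure_pmf p) f" "(\<integral>w. f w \<partial>measure_pmf p) \<le> 1"
      unfolding f_def by (rule integrable_mass_ratio integral_mass_ratio_le_1)+
    show "integrable (measure_pmf p) (\<lambda>w. log 2 (1 / f w))"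
      using int by (rule integrable_cong_AE_imp[OF _ borel_measurable_pmf]) (rule AE_pmfI, simp only: eq)
  qed
  also have "\<dots> = (\<integral>w. log 2 (mass p T w / mass p (\<lambda>w. (U w, T w)) w)
      - log 2 (mass p V w / mass p (\<lambda>w. (U w, V w)) w) \<partial>measure_pmf p)"
    by (rule integral_cong_AE[OF borel_measurable_pmf borel_measurable_pmf], rule AE_pmfI, rule eq)
  also have "\<dots> = cond_ent p U T - cond_ent p U V"
    unfolding cond_ent_def using cond_ent_integrable[OF fin] by (rule Bochner_Integration.integral_diff) (rule cond_ent_integrable[OF fin])
  finally show ?thesis by simp
qed

lemma cond_ent_nonneg: "0 \<le> cond_ent p U V"
  unfolding cond_ent_def
proof (rule integral_nonneg_AE, rule AE_pmfI)
  fix w assume w: "w \<in> set_pmf p"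
  have "mass p (\<lambda>w. (U w, V w)) w \<le> mass p V w"
    using w by (intro mass_mono) (iprover intro: det_intros)+
  thus "0 \<le> log 2 (mass p V w / mass p (\<lambda>w. (U w, V w)) w)"
    by (simp add: mass_pos[OF w])
qed

text \<open>\<open>U'\<close> may have infinite entropy, since \<open>V\<close> contributes to it;
  integrability therefore comes from a pointwise comparison with
  H(\<open>U\<close>|\<open>V\<close>) and not from \<open>fin_ent\<close>.\<close>

lemma
  assumes fin: "fin_ent p U" and det: "det_by p U' (\<lambda>w. (U w, V w))"
  shows cond_ent_integrable_det: "integrable (measure_pmf p) (\<lambda>w. log 2 (mass p V w / mass p (\<lambda>w. (U' w, V w)) w))"
    and cond_ent_le: "cond_ent p U' V \<le> cond_ent p U V"
proof -
  have bounds: "0 \<le> log 2 (mass p V w / mass p (\<lambda>w. (U' w, V w)) w) \<and>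
      log 2 (mass p V w / mass p (\<lambda>w. (U' w, V w)) w) \<le> log 2 (mass p V w / mass p (\<lambda>w. (U w, V w)) w)"
    if w: "w \<in> set_pmf p" for w
  proof -
    have "mass p (\<lambda>w. (U' w, V w)) w \<le> mass p V w"
      using w by (intro mass_mono) (iprover intro: det_intros)+
    moreover have "mass p (\<lambda>w. (U w, V w)) w \<le> mass p (\<lambda>w. (U' w, V w)) w"
      using w det by (intro mass_mono) (iprover intro: det_intros)+
    ultimately show ?thesis
      by (simp add: log_divide mass_pos[OF w] mass_neq_0[OF w])
  qed
  show int: "integrable (measure_pmf p) (\<lambda>w. log 2 (mass p V w / mass p (\<lambda>w. (U' w, V w)) w))"
    by (rule integrable_sandwich[OF cond_ent_integrable[OF fin] bounds])
  show "cond_ent p U' V \<le> cond_ent p U V"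
    unfolding cond_ent_def
    by (rule integral_mono_AE[OF int cond_ent_integrable[OF fin]]) (auto intro!: AE_pmfI dest: bounds)
qed

text \<open>As \<open>U'\<close> is a function of \<open>(U, V)\<close>, adjoining it to
  \<open>(U, V)\<close> changes no mass, so the chain rule already holds pointwise for the
  logarithms.\<close>

lemma cond_ent_chain:
  assumes fin: "fin_ent p U" and det: "det_by p U' (\<lambda>w. (U w, V w))"
  shows "cond_ent p U V = cond_ent p U' V + cond_ent p U (\<lambda>w. (U' w, V w))"
proof -
  have "cond_ent p U V = (\<integral>w. log 2 (mass p V w / mass p (\<lambda>w. (U' w, V w)) w) +
      log 2 (mass p (\<lambda>w. (U' w, V w)) w / mass p (\<lambda>w. (U w, U' w, V w)) w) \<partial>measure_pmf p)"
    unfolding cond_ent_def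
  proof (rule integral_cong_AE)
    show "AE w in measure_pmf p. log 2 (mass p V w / mass p (\<lambda>w. (U w, V w)) w) =
      log 2 (mass p V w / mass p (\<lambda>w. (U' w, V w)) w) +
      log 2 (mass p (\<lambda>w. (U' w, V w)) w / mass p (\<lambda>w. (U w, U' w, V w)) w)"
    proof (rule AE_pmfI)
      fix w assume w: "w \<in> set_pmf p"
      have "mass p (\<lambda>w. (U w, U' w, V w)) w = mass p (\<lambda>w. (U w, V w)) w"
        using det w by (intro mass_cong) (iprover intro: det_intros)+
      thus "log 2 (mass p V w / mass p (\<lambda>w. (U w, V w)) w) =
      log 2 (mass p V w / mass p (\<lambda>w. (U' w, V w)) w) +
      log 2 (mass p (\<lambda>w. (U' w, V w)) w / mass p (\<lambda>w. (U w, U' w, V w)) w)"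
        by (simp add: log_divide mass_neq_0[OF w])
    qed
  qed (rule borel_measurable_pmf)+
  also have "\<dots> = cond_ent p U' V + cond_ent p U (\<lambda>w. (U' w, V w))"
    unfolding cond_ent_def
    by (rule Bochner_Integration.integral_add) (rule cond_ent_integrable_det[OF fin det] cond_ent_integrable[OF fin])+
  finally show ?thesis .
qed

lemma cond_ent_det: "det_by p U V \<Longrightarrow> cond_ent p U V = 0"
proof -
  assume det: "det_by p U V"
  have "cond_ent p U V = (\<integral>w. 0 \<partial>measure_pmf p)"
    unfolding cond_ent_def
  proof (rule integral_cong_AE[OF borel_measurable_pmf borel_measurable_pmf], rule AE_pmfI)
    fix w assume w: "w \<in> set_pmf p"
    have "mass p (\<lambda>w. (U w, V w)) w = mass p V w"
      using det w by (intro mass_cong) (iprover intro: det_intros)+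
    thus "log 2 (mass p V w / mass p (\<lambda>w. (U w, V w)) w) = 0"
      by (simp add: mass_neq_0[OF w])
  qed
  thus ?thesis by simp
qed

text \<open>\<open>T'\<close> stands for the pair \<open>(V, T)\<close> and enters only through its
  masses, so any relabelling of that pair can be used.\<close>

lemma cond_indep_cent:
  assumes "cond_indep p U V T" "\<And>w. w \<in> set_pmf p \<Longrightarrow> mass p T' w = mass p (\<lambda>w. (V w, T w)) w"
    "\<And>w. w \<in> set_pmf p \<Longrightarrow> mass p (\<lambda>w. (U w, T' w)) w = mass p (\<lambda>w. (U w, V w, T w)) w"
  shows "cond_ent p U T' = cond_ent p U T"
  unfolding cond_ent_def
proof (rule integral_cong_AE[OF borel_measurable_pmf borel_measurable_pmf], rule AE_pmfI)
  fix w assume w: "w \<in> set_pmf p"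
  have "mass p (\<lambda>w. (U w, V w, T w)) w * mass p T w =
     mass p (\<lambda>w. (U w, T w)) w * mass p (\<lambda>w. (V w, T w)) w"
    using assms(1) w by (simp add: cond_indep_def)
  thus "log 2 (mass p T' w / mass p (\<lambda>w. (U w, T' w)) w) = log 2 (mass p T w / mass p (\<lambda>w. (U w, T w)) w)"
    unfolding assms(2,3)[OF w]
    by (intro arg_cong[where f = "log 2"]) (simp add: frac_eq_eq mult.commute mass_neq_0[OF w])
qed

section \<open>The interaction of three links and its growth along a conversation\<close>

text \<open>The difference \<open>I(A;B) - I(A;B|C)\<close>, written so that only conditional entropies of \<open>B\<close> occur:
  the entropies of \<open>A\<close> and \<open>C\<close> may be infinite.\<close>

definition interaction :: "'w pmf \<Rightarrow> ('w \<Rightarrow> 'a) \<Rightarrow> ('w \<Rightarrow> 'b) \<Rightarrow> ('w \<Rightarrow> 'c) \<Rightarrow> real" where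
  "interaction p A B C = cond_ent p B (\<lambda>_. ()) - cond_ent p B A - cond_ent p B C + cond_ent p B (\<lambda>w. (A w, C w))"

lemma interaction_commute: "interaction p A B C = interaction p C B A"
proof -
  have "cond_ent p B (\<lambda>w. (A w, C w)) = cond_ent p B (\<lambda>w. (C w, A w))"
    by (rule cond_ent_cong) (iprover intro: det_intros)+
  thus ?thesis by (simp add: interaction_def)
qed

text \<open>One message is appended to the link \<open>A\<close>. Its sender sees one of the other two links, so it is
  conditionally independent of the remaining one.\<close>

definition refined :: "'w pmf \<Rightarrow> ('w \<Rightarrow> 'a) \<Rightarrow> ('w \<Rightarrow> 'a) \<Rightarrow> ('w \<Rightarrow> 'b) \<Rightarrow> ('w \<Rightarrow> 'c) \<Rightarrow> bool" where
  "refined p A A' B C \<longleftrightarrow> det_by p A A' \<and>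
     (cond_indep p A' C (\<lambda>w. (A w, B w)) \<or> cond_indep p A' B (\<lambda>w. (A w, C w)))"

lemma refined_commute: "refined p A A' B C \<longleftrightarrow> refined p A A' C B"
  by (auto simp: refined_def)

text \<open>The increase is I(B;A'|A) - I(B;A'|A,C). If \<open>A'\<close> is independent of
  \<open>B\<close> given \<open>(A, C)\<close>, the second term vanishes. If it is independent of
  \<open>C\<close> given \<open>(A, B)\<close>, the difference equals I(A';C|A); since
  \<open>A'\<close> and \<open>C\<close> may have infinite entropy, this is obtained pointwise and
  not by splitting into entropies.\<close>

lemma interaction_refine_left:
  assumes fin: "fin_ent p B" and "refined p A A' B C"
  shows "interaction p A B C \<le> interaction p A' B C"
proof -
  have det: "det_by p A A'" using assms(2) by (simp add: refined_def)
  consider "cond_indep p A' C (\<lambda>w. (A w, B w))" | "cond_indep p A' B (\<lambda>w. (A w, C w))"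
    using assms(2) by (auto simp: refined_def)
  thus ?thesis
  proof cases
    case 1
    \<comment> \<open>The mass ratio behind I(\<open>A'\<close>;\<open>C\<close>|\<open>A\<close>).
      Conditional independence makes log(1 / \<open>f\<close>) agree with \<open>g\<close>, whose
      terms are integrable because only \<open>B\<close> stands before the bar.\<close>
    define f where "f w = mass p (\<lambda>w. (A' w, A w)) w * mass p (\<lambda>w. (C w, A w)) w /
        (mass p (\<lambda>w. (A' w, C w, A w)) w * mass p A w)" for w
    define g where "g w = log 2 (mass p A w / mass p (\<lambda>w. (B w, A w)) w)
      - log 2 (mass p A' w / mass p (\<lambda>w. (B w, A' w)) w)
      - log 2 (mass p (\<lambda>w. (A w, C w)) w / mass p (\<lambda>w. (B w, A w, C w)) w)
      + log 2 (mass p (\<lambda>w. (A' w, C w)) w / mass p (\<lambda>w. (B w, A' w, C w)) w)" for w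
    have int_g: "integrable (measure_pmf p) g"
      unfolding g_def by (intro Bochner_Integration.integrable_diff Bochner_Integration.integrable_add cond_ent_integrable fin)
    have g: "g w = log 2 (1 / f w)" if w: "w \<in> set_pmf p" for w
    proof -
      note nz = mass_neq_0[OF w]
      have ci: "mass p (\<lambda>w. (A' w, C w, A w, B w)) w * mass p (\<lambda>w. (A w, B w)) w =
          mass p (\<lambda>w. (A' w, A w, B w)) w * mass p (\<lambda>w. (C w, A w, B w)) w"
        using 1 w by (simp add: cond_indep_def)
      have e: "mass p (\<lambda>w. (A' w, C w, A w, B w)) w = mass p (\<lambda>w. (B w, A' w, C w)) w"
        "mass p (\<lambda>w. (A w, B w)) w = mass p (\<lambda>w. (B w, A w)) w"
        "mass p (\<lambda>w. (A' w, A w, B w)) w = mass p (\<lambda>w. (B w, A' w)) w"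
        "mass p (\<lambda>w. (C w, A w, B w)) w = mass p (\<lambda>w. (B w, A w, C w)) w"
        "mass p (\<lambda>w. (A' w, A w)) w = mass p A' w"
        "mass p (\<lambda>w. (C w, A w)) w = mass p (\<lambda>w. (A w, C w)) w"
        "mass p (\<lambda>w. (A' w, C w, A w)) w = mass p (\<lambda>w. (A' w, C w)) w"
        using det w by (intro mass_cong; iprover intro: det_intros)+
      from ci have "log 2 (mass p (\<lambda>w. (B w, A' w, C w)) w * mass p (\<lambda>w. (B w, A w)) w) =
          log 2 (mass p (\<lambda>w. (B w, A' w)) w * mass p (\<lambda>w. (B w, A w, C w)) w)"
        unfolding e by (rule arg_cong)
      hence "log 2 (mass p (\<lambda>w. (B w, A' w, C w)) w) + log 2 (mass p (\<lambda>w. (B w, A w)) w) =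
          log 2 (mass p (\<lambda>w. (B w, A' w)) w) + log 2 (mass p (\<lambda>w. (B w, A w, C w)) w)"
        by (simp add: log_mult nz)
      thus ?thesis by (simp add: f_def g_def e log_divide log_mult nz)
    qed
    have "0 \<le> (\<integral>w. log 2 (1 / f w) \<partial>measure_pmf p)"
    proof (rule gibbs_inequality)
      show "0 < f w" if "w \<in> set_pmf p" for w using that by (simp add: f_def mass_pos)
      show "integrable (measure_pmf p) f" "(\<integral>w. f w \<partial>measure_pmf p) \<le> 1"
        unfolding f_def by (rule integrable_mass_ratio integral_mass_ratio_le_1)+
      show "integrable (measure_pmf p) (\<lambda>w. log 2 (1 / f w))"
        using int_g by (rule integrable_cong_AE_imp[OF _ borel_measurable_pmf]) (rule AE_pmfI, simp only: g)
    qed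
    also have "\<dots> = (\<integral>w. g w \<partial>measure_pmf p)"
      by (rule integral_cong_AE[OF borel_measurable_pmf borel_measurable_pmf], rule AE_pmfI, simp only: g)
    also have "\<dots> = cond_ent p B A - cond_ent p B A' - cond_ent p B (\<lambda>w. (A w, C w)) + cond_ent p B (\<lambda>w. (A' w, C w))"
      unfolding g_def cond_ent_def
      by (simp add: Bochner_Integration.integral_diff Bochner_Integration.integral_add
          Bochner_Integration.integrable_diff cond_ent_integrable[OF fin])
    finally show ?thesis by (simp add: interaction_def)
  next
    case 2
    have "cond_ent p B (\<lambda>w. (A' w, C w)) = cond_ent p B (\<lambda>w. (A w, C w))"
    proof (rule cond_indep_cent)
      show "cond_indep p B A' (\<lambda>w. (A w, C w))"
        unfolding cond_indep_def
      proof
        fix w assume w: "w \<in> set_pmf p"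
        have "mass p (\<lambda>w. (B w, A' w, A w, C w)) w = mass p (\<lambda>w. (A' w, B w, A w, C w)) w"
          using w by (intro mass_cong) (iprover intro: det_intros)+
        thus "mass p (\<lambda>w. (B w, A' w, A w, C w)) w * mass p (\<lambda>w. (A w, C w)) w =
            mass p (\<lambda>w. (B w, A w, C w)) w * mass p (\<lambda>w. (A' w, A w, C w)) w"
          using 2 w by (simp add: cond_indep_def mult.commute)
      qed
    qed (use det in \<open>(intro mass_cong; iprover intro: det_intros)+\<close>)
    moreover have "cond_ent p B A' \<le> cond_ent p B A"
      by (rule cond_ent_mono[OF fin det])
    ultimately show ?thesis by (simp add: interaction_def)
  qed
qed

text \<open>The increase is I(B';A|B) - I(B';A|B,C). If \<open>B'\<close> is independent of
  \<open>C\<close> given \<open>(B, A)\<close>, the chain rule reduces it to I(B';C|B); the other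
  case is its mirror image under exchanging \<open>A\<close> and \<open>C\<close>.\<close>

lemma interaction_refine_mid:
  assumes fin: "fin_ent p B'" and "refined p B B' A C"
  shows "interaction p A B C \<le> interaction p A B' C"
proof -
  have det: "det_by p B B'" using assms(2) by (simp add: refined_def)
  have main: "interaction p A B C \<le> interaction p A B' C"
    if ci: "cond_indep p B' C (\<lambda>w. (B w, A w))" for A :: "'a \<Rightarrow> 'e" and C :: "'a \<Rightarrow> 'f"
  proof -
    have "cond_ent p B' (\<lambda>w. (B w, A w, C w)) = cond_ent p B' (\<lambda>w. (B w, A w))"
      by (rule cond_indep_cent[OF ci]) (intro mass_cong; iprover intro: det_intros)+
    moreover have "cond_ent p B' (\<lambda>w. (B w, C w)) \<le> cond_ent p B' (\<lambda>w. (B w, ()))"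
      by (rule cond_ent_mono[OF fin]) (rule det_pair, iprover intro: det_intros, simp add: det_by_def)
    ultimately show ?thesis
      using cond_ent_chain[OF fin det_by_fst[OF det], of "\<lambda>_. ()"] cond_ent_chain[OF fin det_by_fst[OF det], of A] cond_ent_chain[OF fin det_by_fst[OF det], of C]
        cond_ent_chain[OF fin det_by_fst[OF det], of "\<lambda>w. (A w, C w)"]
      unfolding interaction_def by linarith
  qed
  show ?thesis
    using assms(2) main[of C A] main[of A C]
    by (auto simp: refined_def interaction_commute[of p A B C] interaction_commute[of p A B' C])
qed

inductive evolves :: "'w pmf \<Rightarrow> ('w \<Rightarrow> 'a) \<Rightarrow> ('w \<Rightarrow> 'a) \<Rightarrow> ('w \<Rightarrow> 'a) \<Rightarrow> ('w \<Rightarrow> 'a) \<Rightarrow> ('w \<Rightarrow> 'a) \<Rightarrow> ('w \<Rightarrow> 'a) \<Rightarrow> bool"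
  for p A0 B0 C0 where
  evolves_refl: "evolves p A0 B0 C0 A0 B0 C0"
| evolves_left: "evolves p A0 B0 C0 A B C \<Longrightarrow> refined p A A' B C \<Longrightarrow> evolves p A0 B0 C0 A' B C"
| evolves_mid: "evolves p A0 B0 C0 A B C \<Longrightarrow> refined p B B' A C \<Longrightarrow> evolves p A0 B0 C0 A B' C"
| evolves_right: "evolves p A0 B0 C0 A B C \<Longrightarrow> refined p C C' A B \<Longrightarrow> evolves p A0 B0 C0 A B C'"

lemma evolves_commute:
  "evolves p A0 B0 C0 A B C \<Longrightarrow> evolves p A0 C0 B0 A C B"
proof (induction rule: evolves.induct)
  case evolves_refl
  show ?case by (rule evolves.evolves_refl)
next
  case (evolves_left A B C A')
  show ?case
    by (rule evolves.evolves_left) (fact, rule refined_commute[THEN iffD1], fact)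
next
  case (evolves_mid A B C B')
  show ?case by (rule evolves.evolves_right) fact+
next
  case (evolves_right A B C C')
  show ?case by (rule evolves.evolves_mid) fact+
qed

lemma interaction_evolves:
  "evolves p A0 B0 C0 A B C \<Longrightarrow> fin_ent p B \<Longrightarrow> interaction p A0 B0 C0 \<le> interaction p A B C"
proof (induction rule: evolves.induct)
  case evolves_refl
  show ?case by simp
next
  case (evolves_left A B C A')
  thus ?case using interaction_refine_left by fastforce
next
  case (evolves_mid A B C B')
  moreover have "fin_ent p B" using evolves_mid by (auto intro: fin_ent_det simp: refined_def)
  ultimately show ?case using interaction_refine_mid by fastforce
next
  case (evolves_right A B C C')
  moreover have "interaction p A B C \<le> interaction p A B C'"
    using interaction_refine_left[of p B C C' A] evolves_right refined_commute[of p C C' A B]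
    by (simp add: interaction_commute[of p A B])
  ultimately show ?case by fastforce
qed

section \<open>Passing to the limit of infinitely many rounds\<close>

text \<open>A growing sequence of functions of \<open>V\<close> that together separate its values on
  the support: a filtration generating \<open>V\<close>.\<close>

definition exhausts :: "'w pmf \<Rightarrow> (nat \<Rightarrow> 'w \<Rightarrow> 'a) \<Rightarrow> ('w \<Rightarrow> 'b) \<Rightarrow> bool" where
  "exhausts p Vs V \<longleftrightarrow> (\<forall>n. det_by p (Vs n) (Vs (Suc n))) \<and> (\<forall>n. det_by p (Vs n) V) \<and>
     (\<forall>w\<in>set_pmf p. \<forall>w'\<in>set_pmf p. (\<forall>n. Vs n w = Vs n w') \<longrightarrow> V w = V w')"

lemma exhausts_det: "exhausts p Vs V \<Longrightarrow> det_by p (Vs n) V"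
  by (simp add: exhausts_def)

lemma exhausts_pair:
  assumes "exhausts p Us U" "exhausts p Vs V"
  shows "exhausts p (\<lambda>n w. (Us n w, Vs n w)) (\<lambda>w. (U w, V w))"
  unfolding exhausts_def
proof (intro conjI allI ballI impI)
  fix n
  show "det_by p (\<lambda>w. (Us n w, Vs n w)) (\<lambda>w. (Us (Suc n) w, Vs (Suc n) w))"
    using assms unfolding exhausts_def by (blast intro: det_pair det_by_fst det_by_snd)
  show "det_by p (\<lambda>w. (Us n w, Vs n w)) (\<lambda>w. (U w, V w))"
    using assms unfolding exhausts_def by (blast intro: det_pair det_by_fst det_by_snd)
next
  fix w w' assume w: "w \<in> set_pmf p" "w' \<in> set_pmf p" and "\<forall>n. (Us n w, Vs n w) = (Us n w', Vs n w')"
  hence "\<forall>n. Us n w = Us n w'" "\<forall>n. Vs n w = Vs n w'" by auto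
  thus "(U w, V w) = (U w', V w')" using assms w unfolding exhausts_def by blast
qed

lemma exhausts_const: "exhausts p (\<lambda>_. U) U"
  unfolding exhausts_def by (auto intro: det_refl)

text \<open>The fibres through \<open>w\<close> shrink to the fibre of \<open>V\<close>, so this is
  continuity from above.\<close>

lemma mass_tendsto:
  assumes "exhausts p Vs V" "w \<in> set_pmf p"
  shows "(\<lambda>n. mass p (Vs n) w) \<longlonglongrightarrow> mass p V w"
proof -
  define S where "S n = {w'\<in>set_pmf p. Vs n w' = Vs n w}" for n
  have Sm: "measure_pmf.prob p (S n) = mass p (Vs n) w" for n
    unfolding S_def mass_def by (subst (2) measure_Int_set_pmf[symmetric]) (simp add: Int_def conj_commute)
  have "S (Suc n) \<subseteq> S n" for n
    using assms unfolding S_def exhausts_def det_by_def by blast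
  hence "decseq S" by (rule decseq_SucI)
  hence "(\<lambda>n. measure_pmf.prob p (S n)) \<longlonglongrightarrow> measure_pmf.prob p (\<Inter>n. S n)"
    by (intro measure_pmf.finite_Lim_measure_decseq) auto
  moreover have "(\<Inter>n. S n) = {w'\<in>set_pmf p. V w' = V w}"
    using assms unfolding S_def exhausts_def det_by_def by blast
  moreover have "measure_pmf.prob p {w'\<in>set_pmf p. V w' = V w} = mass p V w"
    unfolding mass_def by (subst (2) measure_Int_set_pmf[symmetric]) (simp add: Int_def conj_commute)
  ultimately show ?thesis by (simp add: Sm)
qed

text \<open>The lower half is monotonicity. For the upper half, -log P(U|V_n) has no evident
  integrable bound uniform in n; it is replaced by a cross-entropy that has one and whose limit
  exceeds H(U|V) by at most \<open>d\<close>.\<close>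

lemma cond_ent_tendsto:
  fixes Vs :: "nat \<Rightarrow> 'w \<Rightarrow> 'b" and V :: "'w \<Rightarrow> 'c"
  assumes fin: "fin_ent p U" and ex: "exhausts p Vs V"
  shows "(\<lambda>n. cond_ent p U (Vs n)) \<longlonglongrightarrow> cond_ent p U V"
proof (rule order_tendstoI)
  fix a assume "a < cond_ent p U V"
  moreover have "cond_ent p U V \<le> cond_ent p U (Vs n)" for n
    by (rule cond_ent_mono[OF fin exhausts_det[OF ex]])
  ultimately show "\<forall>\<^sub>F n in sequentially. a < cond_ent p U (Vs n)"
    by (intro always_eventually allI) (rule less_le_trans)
next
  fix a assume a: "cond_ent p U V < a"
  define d where "d = (a - cond_ent p U V) / 2"
  \<comment> \<open>The weight 1 - \<open>e\<close> = 2 powr (- \<open>d\<close>) costs exactly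
    \<open>d\<close> bits, half of the gap between \<open>a\<close> and the limit.\<close>
  define e where "e = 1 - 2 powr (- d)"
  have d: "d > 0" using a by (simp add: d_def)
  have e: "0 < e" "e < 1" and log_e: "log 2 (1 - e) = - d"
    using gr_one_powr[of 2 d] d by (simp_all add: e_def powr_minus log_inverse inverse_less_1_iff)
  \<comment> \<open>Mixing the conditional law with the marginal of \<open>U\<close> bounds the logarithm uniformly in \<open>n\<close>.\<close>
  define q where "q U' w = (1 - e) * (mass p (\<lambda>w. (U w, U' w)) w / mass p U' w) + e * mass p U w"
    for U' :: "'w \<Rightarrow> 'b" and w
  define q' where "q' w = (1 - e) * (mass p (\<lambda>w. (U w, V w)) w / mass p V w) + e * mass p U w" for w
  have pair_le: "mass p (\<lambda>w. (U w, U' w)) w \<le> mass p U' w" if "w \<in> set_pmf p" for w and U' :: "'w \<Rightarrow> 'x"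
    using that by (intro mass_mono) (iprover intro: det_intros)+
  have bounds: "e * mass p U w \<le> (1 - e) * (mass p (\<lambda>w. (U w, U' w)) w / mass p U' w) + e * mass p U w"
    "(1 - e) * (mass p (\<lambda>w. (U w, U' w)) w / mass p U' w) + e * mass p U w \<le> 1"
    if w: "w \<in> set_pmf p" for w and U' :: "'w \<Rightarrow> 'x"
  proof -
    show "e * mass p U w \<le> (1 - e) * (mass p (\<lambda>w. (U w, U' w)) w / mass p U' w) + e * mass p U w"
      using e by simp
    have "mass p (\<lambda>w. (U w, U' w)) w / mass p U' w \<le> 1"
      using pair_le[OF w, of U'] mass_pos[OF w, of U'] by simp
    hence "(1 - e) * (mass p (\<lambda>w. (U w, U' w)) w / mass p U' w) + e * mass p U w \<le> (1 - e) * 1 + e * 1"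
      using e mass_le_1[of p U w] by (intro add_mono mult_left_mono) auto
    thus "(1 - e) * (mass p (\<lambda>w. (U w, U' w)) w / mass p U' w) + e * mass p U w \<le> 1" by simp
  qed
  have q: "0 < q U' w" "q U' w \<le> 1" "- log 2 (q U' w) \<le> - log 2 e - log 2 (mass p U w)"
    if w: "w \<in> set_pmf p" for w and U' :: "'w \<Rightarrow> 'b"
  proof -
    have em: "0 < e * mass p U w" using e by (simp add: mass_pos[OF w])
    show q0: "0 < q U' w" using em bounds(1)[OF w, of U'] by (simp add: q_def)
    show "q U' w \<le> 1" using bounds(2)[OF w, of U'] by (simp add: q_def)
    have "log 2 (e * mass p U w) \<le> log 2 (q U' w)"
      using em q0 bounds(1)[OF w, of U'] by (simp add: q_def)
    thus "- log 2 (q U' w) \<le> - log 2 e - log 2 (mass p U w)"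
      using e by (simp add: log_mult mass_neq_0[OF w])
  qed
  have q': "0 < q' w" if w: "w \<in> set_pmf p" for w
    using e mass_pos[OF w, of U] bounds(1)[OF w, of V] by (smt (verit) mult_pos_pos q'_def)
  have dom: "integrable (measure_pmf p) (\<lambda>w. - log 2 e - log 2 (mass p U w))"
    using fin by (simp add: fin_ent_def)
  have lim: "(\<lambda>n. \<integral>w. - log 2 (q (Vs n) w) \<partial>measure_pmf p) \<longlonglongrightarrow> (\<integral>w. - log 2 (q' w) \<partial>measure_pmf p)"
  proof (rule integral_dominated_convergence[OF borel_measurable_pmf borel_measurable_pmf dom])
    show "AE w in measure_pmf p. (\<lambda>n. - log 2 (q (Vs n) w)) \<longlonglongrightarrow> - log 2 (q' w)"
    proof (rule AE_pmfI)
      fix w assume w: "w \<in> set_pmf p"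
      have "(\<lambda>n. q (Vs n) w) \<longlonglongrightarrow> q' w"
        unfolding q_def q'_def
        by (intro tendsto_intros mass_tendsto[OF ex w] mass_neq_0[OF w]
            mass_tendsto[OF exhausts_pair[OF exhausts_const ex] w])
      thus "(\<lambda>n. - log 2 (q (Vs n) w)) \<longlonglongrightarrow> - log 2 (q' w)"
        using q'[OF w] by (intro tendsto_minus tendsto_log) auto
    qed
    show "AE w in measure_pmf p. norm (- log 2 (q (Vs n) w)) \<le> - log 2 e - log 2 (mass p U w)" for n
    proof (rule AE_pmfI)
      fix w assume w: "w \<in> set_pmf p"
      have "log 2 (q (Vs n) w) \<le> 0" using q(1,2)[OF w] by simp
      thus "norm (- log 2 (q (Vs n) w)) \<le> - log 2 e - log 2 (mass p U w)"
        using q(3)[OF w, of "Vs n"] by simp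
    qed
  qed
  \<comment> \<open>A cross-entropy dominates the entropy: the density of \<open>q\<close> relative
    to the true conditional law is (1 - \<open>e\<close>) + \<open>e\<close> * \<open>g\<close>,
    whose integral is at most 1.\<close>
  have upper: "cond_ent p U (Vs n) \<le> (\<integral>w. - log 2 (q (Vs n) w) \<partial>measure_pmf p)" for n
  proof -
    let ?V = "Vs n"
    define f where "f w = q ?V w * (mass p ?V w / mass p (\<lambda>w. (U w, ?V w)) w)" for w
    define g where "g w = mass p (\<lambda>w. (U w, ())) w * mass p (\<lambda>w. (?V w, ())) w /
        (mass p (\<lambda>w. (U w, ?V w, ())) w * mass p (\<lambda>w. ()) w)" for w
    have g: "g w = mass p U w * mass p ?V w / mass p (\<lambda>w. (U w, ?V w)) w" for w
      by (simp add: g_def mass_def)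
    have int_g: "integrable (measure_pmf p) g" and g1: "(\<integral>w. g w \<partial>measure_pmf p) \<le> 1"
      unfolding g_def by (rule integrable_mass_ratio integral_mass_ratio_le_1)+
    have f: "f w = (1 - e) + e * g w" if w: "w \<in> set_pmf p" for w
      using mass_neq_0[OF w, of ?V] mass_neq_0[OF w, of "\<lambda>w. (U w, ?V w)"]
      by (simp add: f_def g q_def field_simps)
    have int_f: "integrable (measure_pmf p) f"
    proof (rule integrable_cong_AE_imp[OF _ borel_measurable_pmf])
      show "integrable (measure_pmf p) (\<lambda>w. (1 - e) + e * g w)" using int_g by simp
    qed (rule AE_pmfI, simp only: f)
    have "(\<integral>w. f w \<partial>measure_pmf p) = (\<integral>w. (1 - e) + e * g w \<partial>measure_pmf p)"
      by (rule integral_cong_AE[OF borel_measurable_pmf borel_measurable_pmf], rule AE_pmfI, simp only: f)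
    also have "\<dots> = (1 - e) + e * (\<integral>w. g w \<partial>measure_pmf p)" using int_g by simp
    also have "\<dots> \<le> (1 - e) + e * 1" using g1 e by (intro add_left_mono mult_left_mono) auto
    finally have f1: "(\<integral>w. f w \<partial>measure_pmf p) \<le> 1" by simp
    have lf: "log 2 (1 / f w) = - log 2 (q ?V w) - log 2 (mass p ?V w / mass p (\<lambda>w. (U w, ?V w)) w)"
      if w: "w \<in> set_pmf p" for w
      using q(1)[OF w, of ?V] by (simp add: f_def log_divide log_mult mass_neq_0[OF w])
    have int_q: "integrable (measure_pmf p) (\<lambda>w. - log 2 (q ?V w))"
      using dom by (rule integrable_sandwich) (use q in auto)
    have int: "integrable (measure_pmf p) (\<lambda>w. - log 2 (q ?V w) - log 2 (mass p ?V w / mass p (\<lambda>w. (U w, ?V w)) w))"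
      by (intro Bochner_Integration.integrable_diff int_q cond_ent_integrable fin)
    have "0 \<le> (\<integral>w. log 2 (1 / f w) \<partial>measure_pmf p)"
    proof (rule gibbs_inequality[OF _ int_f f1])
      show "0 < f w" if "w \<in> set_pmf p" for w
        using q(1)[OF that, of ?V] by (simp add: f_def mass_pos[OF that])
      show "integrable (measure_pmf p) (\<lambda>w. log 2 (1 / f w))"
        using int by (rule integrable_cong_AE_imp[OF _ borel_measurable_pmf]) (rule AE_pmfI, simp only: lf)
    qed
    also have "\<dots> = (\<integral>w. - log 2 (q ?V w) - log 2 (mass p ?V w / mass p (\<lambda>w. (U w, ?V w)) w) \<partial>measure_pmf p)"
      by (rule integral_cong_AE[OF borel_measurable_pmf borel_measurable_pmf], rule AE_pmfI, simp only: lf)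
    also have "\<dots> = (\<integral>w. - log 2 (q ?V w) \<partial>measure_pmf p) - cond_ent p U ?V"
      unfolding cond_ent_def by (intro Bochner_Integration.integral_diff int_q cond_ent_integrable fin)
    finally show ?thesis by simp
  qed
  have "(\<integral>w. - log 2 (q' w) \<partial>measure_pmf p)
      \<le> (\<integral>w. d + log 2 (mass p V w / mass p (\<lambda>w. (U w, V w)) w) \<partial>measure_pmf p)"
  proof (rule integral_mono_AE)
    have lq: "- log 2 (q' w) \<le> d + log 2 (mass p V w / mass p (\<lambda>w. (U w, V w)) w)"
      if w: "w \<in> set_pmf p" for w
    proof -
      have pos: "0 < mass p (\<lambda>w. (U w, V w)) w / mass p V w" by (simp add: mass_pos[OF w])
      have "log 2 ((1 - e) * (mass p (\<lambda>w. (U w, V w)) w / mass p V w)) \<le> log 2 (q' w)"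
        using mult_pos_pos[OF _ pos, of "1 - e"] e q'[OF w] by (subst log_le_cancel_iff) (auto simp: q'_def)
      also have "log 2 ((1 - e) * (mass p (\<lambda>w. (U w, V w)) w / mass p V w)) =
          - d - log 2 (mass p V w / mass p (\<lambda>w. (U w, V w)) w)"
        using e log_e by (simp add: log_mult log_divide mass_neq_0[OF w])
      finally show ?thesis by simp
    qed
    show "AE w in measure_pmf p. - log 2 (q' w) \<le> d + log 2 (mass p V w / mass p (\<lambda>w. (U w, V w)) w)"
      by (rule AE_pmfI) (rule lq)
    show int_d: "integrable (measure_pmf p) (\<lambda>w. d + log 2 (mass p V w / mass p (\<lambda>w. (U w, V w)) w))"
      by (intro Bochner_Integration.integrable_add cond_ent_integrable fin) simp
    have "q' w \<le> 1" if w: "w \<in> set_pmf p" for w using bounds(2)[OF w, of V] by (simp add: q'_def)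
    hence "0 \<le> - log 2 (q' w)" if w: "w \<in> set_pmf p" for w using q'[OF that] that by simp
    thus "integrable (measure_pmf p) (\<lambda>w. - log 2 (q' w))"
      using lq by (intro integrable_sandwich[OF int_d] conjI)
  qed
  also have "\<dots> = d + cond_ent p U V"
    unfolding cond_ent_def using cond_ent_integrable[OF fin, of V]
    by (simp add: Bochner_Integration.integral_add)
  also have "\<dots> < a" using a by (simp add: d_def field_simps)
  finally have "(\<integral>w. - log 2 (q' w) \<partial>measure_pmf p) < a" .
  from order_tendstoD(2)[OF lim this]
  show "\<forall>\<^sub>F n in sequentially. cond_ent p U (Vs n) < a"
    by (rule eventually_mono) (rule le_less_trans[OF upper])
qed

text \<open>All three sequences move at once, so the four terms are not followed separately.
  Replacing \<open>Bs n\<close> by \<open>B\<close> costs at most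
  H(\<open>B\<close>|\<open>Bs n\<close>), which tends to 0, and then only conditional entropies of
  the fixed \<open>B\<close> remain.\<close>

lemma interaction_limit:
  assumes fin: "fin_ent p B"
    and A: "exhausts p As A" and B: "exhausts p Bs B" and C: "exhausts p Cs C"
    and pos: "\<And>n. 0 \<le> interaction p (As n) (Bs n) (Cs n)"
  shows "0 \<le> interaction p A B C"
proof -
  have unit: "det_by p (\<lambda>_. ()) V" for V :: "'a \<Rightarrow> 'x" by (rule det_byI) simp
  \<comment> \<open>Data processing gives I(As n;Bs n) \<le> I(A;B); moreover H(Bs n|Cs n) \<ge>
    H(B|C) - H(B|Bs n) and H(Bs n|As n,Cs n) \<le> H(B|As n,Cs n).\<close>
  have approx: "cond_ent p B C - cond_ent p B (Bs n) - cond_ent p B (\<lambda>w. (As n w, Cs n w))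
      \<le> cond_ent p B (\<lambda>_. ()) - cond_ent p B A" for n
  proof -
    note dB = exhausts_det[OF B, of n] and dA = exhausts_det[OF A, of n] and dC = exhausts_det[OF C, of n]
    have finn: "fin_ent p (Bs n)" by (rule fin_ent_det[OF fin dB])
    have le: "cond_ent p B V - cond_ent p B (Bs n) \<le> cond_ent p (Bs n) V" for V :: "'a \<Rightarrow> 'x"
    proof -
      have "cond_ent p B (\<lambda>w. (Bs n w, V w)) \<le> cond_ent p B (Bs n)"
        by (rule cond_ent_mono[OF fin]) (iprover intro: det_intros)
      thus ?thesis using cond_ent_chain[OF fin det_by_fst[OF dB], of V] by simp
    qed
    have "cond_ent p (Bs n) C \<le> cond_ent p (Bs n) (Cs n)" "cond_ent p (Bs n) A \<le> cond_ent p (Bs n) (As n)"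
      by (rule cond_ent_mono[OF finn dC] cond_ent_mono[OF finn dA])+
    moreover have "cond_ent p (Bs n) (\<lambda>w. (As n w, Cs n w)) \<le> cond_ent p B (\<lambda>w. (As n w, Cs n w))"
      by (rule cond_ent_le[OF fin det_by_fst[OF dB]])
    moreover have "cond_ent p B (\<lambda>_. ()) = cond_ent p (Bs n) (\<lambda>_. ()) + cond_ent p B (\<lambda>w. (Bs n w, ()))"
      by (rule cond_ent_chain[OF fin det_by_fst[OF dB]])
    moreover have "cond_ent p B A = cond_ent p (Bs n) A + cond_ent p B (\<lambda>w. (Bs n w, A w))"
      by (rule cond_ent_chain[OF fin det_by_fst[OF dB]])
    moreover have "cond_ent p B (\<lambda>w. (Bs n w, A w)) \<le> cond_ent p B (\<lambda>w. (Bs n w, ()))"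
      by (rule cond_ent_mono[OF fin]) (rule det_pair, iprover intro: det_intros, rule unit)
    ultimately show ?thesis
      using pos[of n] le[of C] unfolding interaction_def by linarith
  qed
  have "(\<lambda>n. cond_ent p B C - cond_ent p B (Bs n) - cond_ent p B (\<lambda>w. (As n w, Cs n w)))
      \<longlonglongrightarrow> cond_ent p B C - cond_ent p B B - cond_ent p B (\<lambda>w. (A w, C w))"
    by (intro tendsto_intros cond_ent_tendsto[OF fin] B exhausts_pair A C)
  from tendsto_upperbound[OF this, of "cond_ent p B (\<lambda>_. ()) - cond_ent p B A"] approx
  show ?thesis by (simp add: cond_ent_det[OF det_refl] interaction_def)
qed

section \<open>Information measures of finitely valued variables\<close>

text \<open>Total probability over a variable with possibly infinite range; the sum converges
  because a mass function is absolutely summable.\<close>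

lemma infsum_prob_fibres:
  fixes V :: "'w \<Rightarrow> 'a"
  shows "(\<Sum>\<^sub>\<infinity>c. measure_pmf.prob q {w. P w \<and> V w = c}) = measure_pmf.prob q {w. P w}"
proof -
  define r where "r = map_pmf (\<lambda>w. (P w, V w)) q"
  have inj: "inj (Pair True :: 'a \<Rightarrow> bool \<times> 'a)" by (auto intro: injI)
  have "measure_pmf.prob q {w. P w} = measure_pmf.prob r (range (Pair True))"
    by (auto simp: r_def vimage_def intro!: arg_cong[where f = "measure_pmf.prob q"])
  also have "\<dots> = infsetsum (pmf r) (range (Pair True))"
    by (rule measure_pmf_conv_infsetsum)
  also have "\<dots> = infsum (pmf r) (range (Pair True))"
    by (rule infsetsum_infsum) (rule pmf_abs_summable)
  also have "\<dots> = (\<Sum>\<^sub>\<infinity>c. pmf r (True, c))"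
    using infsum_reindex[OF inj, of "pmf r"] by (simp add: o_def)
  also have "\<dots> = (\<Sum>\<^sub>\<infinity>c. measure_pmf.prob q {w. P w \<and> V w = c})"
    by (intro infsum_cong) (auto simp: r_def pmf_map vimage_def intro!: arg_cong[where f = "measure_pmf.prob q"])
  finally show ?thesis by simp
qed

lemma sum_prob_fibres:
  fixes V :: "'w \<Rightarrow> 'a::finite"
  shows "(\<Sum>c\<in>UNIV. measure_pmf.prob q {w. P w \<and> V w = c}) = measure_pmf.prob q {w. P w}"
  using infsum_prob_fibres[of q P V] by simp

lemma prob_bind:
  fixes r :: "'a::finite pmf"
  shows "measure_pmf.prob (bind_pmf r k) E = (\<Sum>a\<in>UNIV. pmf r a * measure_pmf.prob (k a) E)"
proof -
  have *: "measure_pmf.prob p E = pmf (map_pmf (\<lambda>w. w \<in> E) p) True" for p :: "'b pmf"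
    by (simp add: pmf_map vimage_def)
  show ?thesis
    unfolding * map_bind_pmf pmf_bind by (subst integral_measure_pmf_real[of UNIV]) (auto simp: mult.commute)
qed

lemma prob_cong:
  assumes "\<And>w. w \<in> set_pmf q \<Longrightarrow> w \<in> E \<longleftrightarrow> w \<in> F"
  shows "measure_pmf.prob q E = measure_pmf.prob q F"
proof -
  have "E \<inter> set_pmf q = F \<inter> set_pmf q" using assms by auto
  thus ?thesis by (metis measure_Int_set_pmf)
qed

lemma fin_ent_finite:
  fixes U :: "'w \<Rightarrow> 'a::finite"
  shows "fin_ent p U"
proof -
  have "integrable (measure_pmf (map_pmf U p)) (\<lambda>u. log 2 (measure_pmf.prob p {w. U w = u}))"
    by (rule integrable_measure_pmf_finite) simp
  thus ?thesis by (simp add: fin_ent_def mass_def)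
qed

lemma integral_finite:
  fixes U :: "'w \<Rightarrow> 'a::finite"
  shows "(\<integral>w. F (U w) \<partial>measure_pmf p) = (\<Sum>u\<in>UNIV. measure_pmf.prob p {w. U w = u} * F u)"
proof -
  have "(\<integral>w. F (U w) \<partial>measure_pmf p) = (\<integral>u. F u \<partial>measure_pmf (map_pmf U p))" by simp
  also have "\<dots> = (\<Sum>u\<in>UNIV. F u * pmf (map_pmf U p) u)"
    by (rule integral_measure_pmf_real) auto
  also have "\<dots> = (\<Sum>u\<in>UNIV. measure_pmf.prob p {w. U w = u} * F u)"
    by (simp add: pmf_map vimage_def mult.commute)
  finally show ?thesis .
qed

lemma cond_ent_conv_cond_entropy:
  fixes U :: "'w \<Rightarrow> 'a::finite" and V :: "'w \<Rightarrow> 'b::finite"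
  assumes q: "\<And>u v. q (u, v) = measure_pmf.prob p {w. U w = u \<and> V w = v}"
  shows "cond_ent p U V = cond_entropy q"
proof -
  define pv where "pv v = measure_pmf.prob p {w. V w = v}" for v
  have pv: "(\<Sum>u\<in>UNIV. q (u, v)) = pv v" for v
    using sum_prob_fibres[of p "\<lambda>w. V w = v" U] by (simp add: q pv_def conj_commute)
  have q0: "0 \<le> q (u, v)" for u v by (simp add: q)
  have qle: "q (u, v) \<le> pv v" for u v
    unfolding pv[symmetric] by (rule member_le_sum) (auto simp: q0)
  have "cond_ent p U V = (\<integral>w. (\<lambda>(u, v). log 2 (pv v / q (u, v))) (U w, V w) \<partial>measure_pmf p)"
    unfolding cond_ent_def mass_def by (simp add: q pv_def)
  also have "\<dots> = (\<Sum>(u,v)\<in>UNIV. q (u, v) * log 2 (pv v / q (u, v)))"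
    by (subst integral_finite) (simp add: case_prod_unfold q prod_eq_iff)
  also have "\<dots> = (\<Sum>(u,v)\<in>UNIV. - (q (u, v) * log 2 (q (u, v) / pv v)))"
  proof (rule sum.cong[OF refl], unfold case_prod_unfold)
    fix z :: "'a \<times> 'b"
    have "log 2 (pv (snd z) / q z) = - log 2 (q z / pv (snd z))" if "q z \<noteq> 0"
      using that q0[of "fst z" "snd z"] qle[of "fst z" "snd z"] by (simp add: log_divide)
    thus "q (fst z, snd z) * log 2 (pv (snd z) / q (fst z, snd z)) =
        - (q (fst z, snd z) * log 2 (q (fst z, snd z) / pv (snd z)))"
      by (cases "q z = 0") auto
  qed
  finally show ?thesis
    by (simp add: cond_entropy_def pv case_prod_unfold sum_negf)
qed

lemma integral_neg_log_conv_entropy_img: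
  fixes U :: "'w \<Rightarrow> 'a::finite"
  assumes r: "\<And>u. r u = measure_pmf.prob p {w. U w = u}"
  shows "(\<integral>w. - log 2 (mass p (\<lambda>w. f (U w)) w) \<partial>measure_pmf p) = entropy_img r f"
proof -
  define m where "m k = measure_pmf.prob p {w. f (U w) = k}" for k
  have m: "(\<Sum>u\<in>{u. f u = k}. r u) = m k" for k
  proof -
    have "m k = (\<Sum>u\<in>UNIV. measure_pmf.prob p {w. f (U w) = k \<and> U w = u})"
      unfolding m_def by (rule sum_prob_fibres[symmetric])
    also have "\<dots> = (\<Sum>u\<in>UNIV. if f u = k then r u else 0)"
    proof (rule sum.cong[OF refl])
      fix u
      have "{w. f (U w) = k \<and> U w = u} = (if f u = k then {w. U w = u} else {})" by auto
      thus "measure_pmf.prob p {w. f (U w) = k \<and> U w = u} = (if f u = k then r u else 0)"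
        by (simp add: r)
    qed
    finally show ?thesis by (simp add: sum.If_cases)
  qed
  have "(\<integral>w. - log 2 (mass p (\<lambda>w. f (U w)) w) \<partial>measure_pmf p) = (\<Sum>u\<in>UNIV. r u * - log 2 (m (f u)))"
    unfolding mass_def m_def[symmetric] by (subst integral_finite) (simp add: r)
  also have "\<dots> = (\<Sum>k\<in>range f. \<Sum>u\<in>{u. f u = k}. r u * - log 2 (m (f u)))"
    using sum.group[of UNIV "range f" f "\<lambda>u. r u * - log 2 (m (f u))"] by simp
  also have "\<dots> = (\<Sum>k\<in>range f. - (m k * log 2 (m k)))"
    by (intro sum.cong refl) (simp add: m[symmetric] sum_distrib_right sum_negf)
  finally show ?thesis by (simp add: entropy_img_def m sum_negf)
qed

lemma mutual_info_conv_integral: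
  fixes U :: "'w \<Rightarrow> 'a::finite" and V :: "'w \<Rightarrow> 'b::finite"
  assumes q: "\<And>u v. q (u, v) = measure_pmf.prob p {w. U w = u \<and> V w = v}"
  shows "mutual_info q = (\<integral>w. log 2 (mass p (\<lambda>w. (U w, V w)) w / (mass p U w * mass p V w)) \<partial>measure_pmf p)"
proof -
  have 1: "(\<Sum>u\<in>UNIV. q (u, v)) = measure_pmf.prob p {w. V w = v}" for v
    using sum_prob_fibres[of p "\<lambda>w. V w = v" U] by (simp add: q conj_commute)
  have 2: "(\<Sum>v\<in>UNIV. q (u, v)) = measure_pmf.prob p {w. U w = u}" for u
    using sum_prob_fibres[of p "\<lambda>w. U w = u" V] by (simp add: q)
  have "(\<integral>w. log 2 (mass p (\<lambda>w. (U w, V w)) w / (mass p U w * mass p V w)) \<partial>measure_pmf p) =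
      (\<integral>w. (\<lambda>(u, v). log 2 (q (u, v) / (measure_pmf.prob p {w. U w = u} * measure_pmf.prob p {w. V w = v})))
        (U w, V w) \<partial>measure_pmf p)"
    by (simp add: mass_def q)
  also have "\<dots> = mutual_info q"
    by (subst integral_finite) (simp add: mutual_info_def 1 2 case_prod_unfold q[symmetric] prod_eq_iff)
  finally show ?thesis ..
qed

text \<open>A crude bound uniform in \<open>f\<close>: the number of cells is at most the
  cardinality of the type, and -x log x \<le> 1 / ln 2 for each. It makes the supremum in
  \<open>gk_common\<close> one of a bounded set.\<close>

lemma entropy_img_le:
  fixes r :: "'a::finite \<Rightarrow> real"
  assumes "\<And>u. 0 \<le> r u"
  shows "entropy_img r f \<le> card (UNIV :: 'a set) / ln 2"
proof -
  have le: "- (x * log 2 x) \<le> 1 / ln 2" if "0 \<le> x" for x :: real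
  proof (cases "x = 0")
    case False
    with that have x: "0 < x" by simp
    have "ln (1 / x) \<le> 1 / x - 1" using x by (intro ln_le_minus_one) simp
    hence "x * ln (1 / x) \<le> x * (1 / x - 1)" using x by (intro mult_left_mono) auto
    hence "- (x * ln x) \<le> 1" using x by (simp add: ln_div right_diff_distrib)
    hence "- (x * ln x) / ln 2 \<le> 1 / ln 2" by (intro divide_right_mono) auto
    thus ?thesis by (simp add: log_def)
  qed simp
  have "entropy_img r f = (\<Sum>k\<in>range f. - ((\<Sum>u\<in>{u. f u = k}. r u) * log 2 (\<Sum>u\<in>{u. f u = k}. r u)))"
    by (simp add: entropy_img_def sum_negf)
  also have "\<dots> \<le> (\<Sum>k\<in>range f. 1 / ln 2)"
    by (intro sum_mono le sum_nonneg assms)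
  also have "\<dots> = card (range f) / ln 2" by simp
  also have "\<dots> \<le> card (UNIV :: 'a set) / ln 2"
    by (intro divide_right_mono) (auto intro: card_image_le)
  finally show ?thesis .
qed

text \<open>Every common function is a candidate in the supremum \<open>gk_common\<close>, so a
  single one bounds the residual information from above.\<close>

lemma residual_info_le:
  fixes q :: "'a::finite \<times> 'b::finite \<Rightarrow> real"
  assumes "\<And>u v. 0 \<le> q (u, v)" and "\<And>u v. q (u, v) > 0 \<Longrightarrow> f u = g v"
  shows "residual_info q \<le> mutual_info q - entropy_img (\<lambda>u. \<Sum>v\<in>UNIV. q (u, v)) f"
proof -
  have "entropy_img (\<lambda>u. \<Sum>v\<in>UNIV. q (u, v)) f \<le> gk_common q"
    unfolding gk_common_def
  proof (rule cSup_upper)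
    show "bdd_above ((\<lambda>(f, g). entropy_img (\<lambda>u. \<Sum>v\<in>UNIV. q (u, v)) f) `
        {(f, g). \<forall>u v. q (u, v) > 0 \<longrightarrow> f u = g v})"
      by (rule bdd_aboveI[where M = "card (UNIV :: 'a set) / ln 2"])
        (auto intro!: entropy_img_le sum_nonneg assms(1))
  qed (use assms(2) in \<open>force intro!: image_eqI[of _ _ "(f, g)"]\<close>)
  thus ?thesis by (simp add: residual_info_def)
qed

text \<open>Passage from the extended reals to an expectation: nonnegative terms with a finite sum
  form an absolutely convergent real series, which is an integral against the law of
  \<open>V\<close>.\<close>

lemma disc_entropy_finite:
  fixes V :: "'w \<Rightarrow> 'a"
  assumes fin: "disc_entropy (pmf (map_pmf V p)) < \<top>"
  shows "fin_ent p V" "disc_entropy (pmf (map_pmf V p)) = ennreal (cond_ent p V (\<lambda>_. ()))"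
proof -
  define r where "r = map_pmf V p"
  define h where "h b = - pmf r b * log 2 (pmf r b)" for b
  have h0: "0 \<le> h b" for b
  proof (cases "pmf r b = 0")
    case False
    hence "log 2 (pmf r b) \<le> 0" using pmf_le_1[of r b] by (simp add: pmf_pos)
    thus ?thesis by (simp add: h_def mult_nonneg_nonpos)
  qed (simp add: h_def)
  have de: "disc_entropy (pmf r) = (\<Sum>\<^sub>\<infinity>b. ennreal (h b))"
    by (simp add: disc_entropy_def h_def)
  have bound: "sum h F \<le> enn2real (\<Sum>\<^sub>\<infinity>b. ennreal (h b))" if "finite F" for F
  proof -
    have "ennreal (sum h F) = (\<Sum>b\<in>F. ennreal (h b))" by (simp add: h0 sum_ennreal)
    also have "\<dots> \<le> (\<Sum>\<^sub>\<infinity>b. ennreal (h b))"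
      using infsum_mono_neutral[of "\<lambda>b. ennreal (h b)" F "\<lambda>b. ennreal (h b)" UNIV] that
      by (simp add: nonneg_summable_on_complete)
    finally have "enn2real (ennreal (sum h F)) \<le> enn2real (\<Sum>\<^sub>\<infinity>b. ennreal (h b))"
      using fin by (intro enn2real_mono) (simp_all add: de r_def[symmetric])
    thus ?thesis by (simp add: h0 sum_nonneg)
  qed
  have summ: "h summable_on UNIV"
    by (rule nonneg_bdd_above_summable_on) (auto intro!: bdd_aboveI bound h0)
  hence int: "integrable (count_space UNIV) h"
    using h0 by (simp add: abs_summable_equivalent[symmetric] Infinite_Set_Sum.abs_summable_on_def[symmetric])
  have int_r: "integrable (measure_pmf r) (\<lambda>b. - log 2 (pmf r b))"
    unfolding measure_pmf_eq_density by (subst integrable_density) (use int in \<open>simp_all add: h_def[abs_def]\<close>)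
  thus "fin_ent p V"
    by (simp add: fin_ent_def r_def mass_def pmf_map vimage_def)
  have "cond_ent p V (\<lambda>_. ()) = (\<integral>b. - log 2 (pmf r b) \<partial>measure_pmf r)"
    unfolding cond_ent_def
  proof (subst r_def, subst integral_map_pmf, rule integral_cong_AE[OF borel_measurable_pmf borel_measurable_pmf], rule AE_pmfI)
    fix w assume w: "w \<in> set_pmf p"
    have "pmf r (V w) = mass p (\<lambda>w. (V w, ())) w" "mass p (\<lambda>_. ()) w = 1"
      by (simp_all add: r_def mass_def pmf_map vimage_def)
    thus "log 2 (mass p (\<lambda>_. ()) w / mass p (\<lambda>w. (V w, ())) w) = - log 2 (pmf r (V w))"
      using mass_pos[OF w, of "\<lambda>w. (V w, ())"] by (simp add: log_divide)
  qed
  also have "\<dots> = (\<integral>b. h b \<partial>count_space UNIV)"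
    unfolding measure_pmf_eq_density by (subst integral_density) (simp_all add: h_def[abs_def])
  also have "\<dots> = infsum h UNIV"
    using infsetsum_infsum[of h UNIV] int by (simp add: infsetsum_def Infinite_Set_Sum.abs_summable_on_def)
  finally have cond_ent: "cond_ent p V (\<lambda>_. ()) = infsum h UNIV" .
  have "ennreal (infsum h UNIV) = (\<Sum>\<^sub>\<infinity>b. ennreal (h b))"
    using infsum_nonneg_is_SUPREMUM_ennreal[OF summ h0] nonneg_infsum_complete[of UNIV "\<lambda>b. ennreal (h b)"]
    by (simp add: h0 sum_ennreal)
  thus "disc_entropy (pmf (map_pmf V p)) = ennreal (cond_ent p V (\<lambda>_. ()))"
    by (simp add: cond_ent de r_def[symmetric])
qed

lemma cond_ent_eqI:
  assumes "\<And>w. w \<in> set_pmf p \<Longrightarrow>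
    mass p V w * mass p (\<lambda>w. (U w, V' w)) w = mass p V' w * mass p (\<lambda>w. (U w, V w)) w"
  shows "cond_ent p U V = cond_ent p U V'"
  unfolding cond_ent_def
proof (rule integral_cong_AE[OF borel_measurable_pmf borel_measurable_pmf], rule AE_pmfI)
  fix w assume w: "w \<in> set_pmf p"
  show "log 2 (mass p V w / mass p (\<lambda>w. (U w, V w)) w) = log 2 (mass p V' w / mass p (\<lambda>w. (U w, V' w)) w)"
    by (rule arg_cong[where f = "log 2"]) (simp add: frac_eq_eq mass_neq_0[OF w] assms[OF w])
qed

text \<open>Conditional entropies depend on the joint law only, which later allows the law of
  \<open>Y\<close> to be exchanged.\<close>

lemma cond_ent_map_pmf: "cond_ent (map_pmf F p) U V = cond_ent p (\<lambda>w. U (F w)) (\<lambda>w. V (F w))"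
  by (simp add: cond_ent_def mass_def vimage_def)

section \<open>The entropy bound for secure kernels\<close>

text \<open>A run on independent inputs, as in the product laws under the suprema.\<close>

definition mix :: "'x pmf \<Rightarrow> 'y pmf \<Rightarrow> ('x \<Rightarrow> 'y \<Rightarrow> 'w pmf) \<Rightarrow> 'w pmf" where
  "mix pX pY K = bind_pmf pX (\<lambda>x. bind_pmf pY (K x))"

lemma mix_commute: "mix pY pX (\<lambda>y x. K x y) = mix pX pY K"
  unfolding mix_def by (rule bind_commute_pmf)

lemma fs_dists_pmf:
  assumes "p \<in> fs_dists"
  shows "\<exists>r. pmf r = p"
proof -
  have "(\<integral>\<^sup>+a. ennreal (p a) \<partial>count_space UNIV) = ennreal (sum p UNIV)"
    using assms by (subst nn_integral_count_space_finite) (auto simp: fs_dists_def less_imp_le)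
  hence "pmf (embed_pmf p) a = p a" for a
    using assms by (intro pmf_embed_pmf) (auto simp: fs_dists_def less_imp_le)
  thus ?thesis by blast
qed

text \<open>\<open>A\<close>, \<open>B\<close> and \<open>C\<close> are the transcripts of the links Alice-Bob, Alice-Charlie and Bob-Charlie. The assumptions are
  invariant under exchanging Alice with Bob (and \<open>B\<close> with \<open>C\<close>), which reduces the second bound to the first.\<close>

locale secure_kernel =
  fixes W :: "'x::finite \<Rightarrow> 'y::finite \<Rightarrow> 'z::finite \<Rightarrow> real"
    and K :: "'x \<Rightarrow> 'y \<Rightarrow> 'w pmf"
    and X :: "'w \<Rightarrow> 'x" and Y :: "'w \<Rightarrow> 'y" and Z :: "'w \<Rightarrow> 'z"
    and A B C :: "'w \<Rightarrow> 'm"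
    and \<alpha> :: "'x \<Rightarrow> 'm \<Rightarrow> 'm \<Rightarrow> real" and \<beta> :: "'y \<Rightarrow> 'm \<Rightarrow> 'm \<Rightarrow> real" and \<gamma> :: "'z \<Rightarrow> 'm \<Rightarrow> 'm \<Rightarrow> real"
    and f :: "'x \<Rightarrow> 'm \<Rightarrow> 'm \<Rightarrow> real" and g :: "'y \<Rightarrow> 'm \<Rightarrow> 'm \<Rightarrow> real" and h :: "'z \<Rightarrow> 'm \<Rightarrow> 'm \<Rightarrow> real"
  assumes cond_dist: "cond_dist W" and normal_form: "normal_form W"
    and inputs: "\<And>x y w. w \<in> set_pmf (K x y) \<Longrightarrow> X w = x \<and> Y w = y"
    and correct: "\<And>x y z. measure_pmf.prob (K x y) {w. Z w = z} = W x y z"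
    and private1: "\<And>x y a b z. measure_pmf.prob (K x y) {w. A w = a \<and> B w = b \<and> Z w = z} = \<alpha> x a b * W x y z"
    and private2: "\<And>x y a c z. measure_pmf.prob (K x y) {w. A w = a \<and> C w = c \<and> Z w = z} = \<beta> y a c * W x y z"
    and private3: "\<And>x y b c z. measure_pmf.prob (K x y) {w. C w = c \<and> B w = b \<and> Z w = z} = \<gamma> z c b * W x y z"
    and rectangular: "\<And>x y a b c z. measure_pmf.prob (K x y) {w. A w = a \<and> B w = b \<and> C w = c \<and> Z w = z} =
        f x a b * g y a c * h z c b"
    and interactive: "\<And>pX pY. \<exists>As Bs Cs :: nat \<Rightarrow> 'w \<Rightarrow> lhist.
        exhausts (mix pX pY K) As A \<and> exhausts (mix pX pY K) Bs B \<and> exhausts (mix pX pY K) Cs C \<and>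
        (\<forall>n. evolves (mix pX pY K) (\<lambda>_. []) (\<lambda>_. []) (\<lambda>_. []) (As n) (Bs n) (Cs n))"
begin

lemma W_nonneg: "0 \<le> W x y z"
  using cond_dist by (simp add: cond_dist_def)

lemma W_sum: "(\<Sum>z\<in>UNIV. W x y z) = 1"
  using cond_dist by (simp add: cond_dist_def)

lemma mix_swap: "mix pY pX (\<lambda>y x. K x y) = mix pX pY K"
  by (rule mix_commute)

lemma nf_X: "(\<And>y z. W x y z = W x' y z) \<Longrightarrow> x = x'"
  by (rule normal_form[unfolded normal_form_def, THEN conjunct1, rule_format])

lemma nf_Y: "(\<And>x z. W x y z = W x y' z) \<Longrightarrow> y = y'"
  by (rule normal_form[unfolded normal_form_def, THEN conjunct2, THEN conjunct1, rule_format])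

lemma nf_Z: "(\<And>x y. W x y z = k * W x y z') \<Longrightarrow> z = z'"
  by (rule normal_form[unfolded normal_form_def, THEN conjunct2, THEN conjunct2, rule_format], rule exI[of _ k])
    (intro allI, assumption)

text \<open>Charlie's two links trade places, so the arguments of \<gamma> and \<open>h\<close> are
  transposed; the conversation itself is handled by \<open>evolves_commute\<close>.\<close>

lemma swap: "secure_kernel (\<lambda>y x. W x y) (\<lambda>y x. K x y) Y X Z A C B \<beta> \<alpha> (\<lambda>z b c. \<gamma> z c b)
    g f (\<lambda>z b c. h z c b)"
proof
  show "cond_dist (\<lambda>y x. W x y)" by (simp add: cond_dist_def W_nonneg W_sum)
  show "normal_form (\<lambda>y x. W x y)"
    unfolding normal_form_def
  proof (intro conjI allI impI)
    show "y = y'" if "\<forall>x z. W x y z = W x y' z" for y y' using that by (intro nf_Y) simp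
    show "x = x'" if "\<forall>y z. W x y z = W x' y z" for x x' using that by (intro nf_X) simp
    show "z = z'" if ex: "\<exists>c. \<forall>y x. W x y z = c * W x y z'" for z z'
    proof -
      from ex obtain c where c: "\<forall>y x. W x y z = c * W x y z'" ..
      show ?thesis by (rule nf_Z[of z c]) (simp only: c)
    qed
  qed
  show "Y w = y \<and> X w = x" if "w \<in> set_pmf (K x y)" for x y w using inputs[OF that] by simp
  show "measure_pmf.prob (K x y) {w. Z w = z} = W x y z" for x y z by (rule correct)
  show "measure_pmf.prob (K x y) {w. A w = a \<and> C w = c \<and> Z w = z} = \<beta> y a c * W x y z" for x y a c z
    by (rule private2)
  show "measure_pmf.prob (K x y) {w. A w = a \<and> B w = b \<and> Z w = z} = \<alpha> x a b * W x y z" for x y a b z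
    by (rule private1)
  show "measure_pmf.prob (K x y) {w. B w = b \<and> C w = c \<and> Z w = z} = \<gamma> z c b * W x y z" for x y b c z
    using private3[of x y c b z] by (simp add: conj_ac)
  show "measure_pmf.prob (K x y) {w. A w = a \<and> C w = c \<and> B w = b \<and> Z w = z} = g y a c * f x a b * h z c b"
    for x y a b c z
    using rectangular[of x y a b c z] by (simp add: conj_ac mult_ac)
  show "\<exists>As Bs Cs :: nat \<Rightarrow> 'w \<Rightarrow> lhist.
        exhausts (mix pY pX (\<lambda>y x. K x y)) As A \<and> exhausts (mix pY pX (\<lambda>y x. K x y)) Bs C \<and>
        exhausts (mix pY pX (\<lambda>y x. K x y)) Cs B \<and>
        (\<forall>n. evolves (mix pY pX (\<lambda>y x. K x y)) (\<lambda>_. []) (\<lambda>_. []) (\<lambda>_. []) (As n) (Bs n) (Cs n))" for pX pY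
    unfolding mix_swap
  proof -
    from interactive[of pX pY] obtain As Bs Cs :: "nat \<Rightarrow> 'w \<Rightarrow> lhist" where
      ex: "exhausts (mix pX pY K) As A \<and> exhausts (mix pX pY K) Bs B \<and> exhausts (mix pX pY K) Cs C \<and>
      (\<forall>n. evolves (mix pX pY K) (\<lambda>_. []) (\<lambda>_. []) (\<lambda>_. []) (As n) (Bs n) (Cs n))"
      by (elim exE) (rule that)
    have "evolves (mix pX pY K) (\<lambda>_. []) (\<lambda>_. []) (\<lambda>_. []) (As n) (Cs n) (Bs n)" for n
      by (rule evolves_commute) (simp only: ex)
    with ex show "\<exists>As Bs Cs :: nat \<Rightarrow> 'w \<Rightarrow> lhist.
        exhausts (mix pX pY K) As A \<and> exhausts (mix pX pY K) Bs C \<and> exhausts (mix pX pY K) Cs B \<and>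
        (\<forall>n. evolves (mix pX pY K) (\<lambda>_. []) (\<lambda>_. []) (\<lambda>_. []) (As n) (Bs n) (Cs n))"
      by (intro exI[of _ As] exI[of _ Cs] exI[of _ Bs]) (simp only: simp_thms)
  qed
qed

section \<open>Laws of the links and the three cuts\<close>

lemma K_AB: "measure_pmf.prob (K x y) {w. A w = a \<and> B w = b} = \<alpha> x a b"
  using sum_prob_fibres[of "K x y" "\<lambda>w. A w = a \<and> B w = b" Z] private1[of x y a b]
  by (simp add: conj_assoc sum_distrib_left[symmetric] W_sum)

lemma K_BZ: "measure_pmf.prob (K x y) {w. B w = b \<and> Z w = z} = (\<Sum>\<^sub>\<infinity>a. \<alpha> x a b) * W x y z"
  using infsum_prob_fibres[of "K x y" "\<lambda>w. B w = b \<and> Z w = z" A] private1[of x y _ b z]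
  by (simp add: conj_ac infsum_cmult_left')

text \<open>Link \<open>B\<close> belongs to the views of both Alice and Charlie, so the law of
  \<open>(B, Z)\<close> factors in two ways, through \<open>x\<close> and through \<open>z\<close>.
  Wherever \<open>W x y z\<close> is positive the two factors agree.\<close>

lemma K_BZ': "measure_pmf.prob (K x y) {w. B w = b \<and> Z w = z} = (\<Sum>\<^sub>\<infinity>c. \<gamma> z c b) * W x y z"
  using infsum_prob_fibres[of "K x y" "\<lambda>w. B w = b \<and> Z w = z" C] private3[of x y _ b z]
  by (simp add: conj_ac infsum_cmult_left')

lemma K_B: "measure_pmf.prob (K x y) {w. B w = b} = (\<Sum>\<^sub>\<infinity>a. \<alpha> x a b)"
  using sum_prob_fibres[of "K x y" "\<lambda>w. B w = b" Z] K_BZ[of x y b]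
  by (simp add: sum_distrib_left[symmetric] W_sum)

lemma set_mix:
  assumes "w \<in> set_pmf (mix pX pY K)"
  shows "w \<in> set_pmf (K (X w) (Y w))"
proof -
  from assms obtain x y where "w \<in> set_pmf (K x y)" by (auto simp: mix_def)
  with inputs[OF this] show ?thesis by simp
qed

text \<open>A cut isolating Alice must reveal her input: given \<open>A\<close> and \<open>B\<close> the conditional law of the output
  depends on the other side of the cut only.\<close>

lemma det_X: "det_by (mix pX pY K) X (\<lambda>w. (A w, B w))"
proof (rule det_byI)
  fix w w' assume w: "w \<in> set_pmf (mix pX pY K)" "w' \<in> set_pmf (mix pX pY K)"
    and eq: "(A w, B w) = (A w', B w')"
  define a b where "a = A w" and "b = B w"
  define G where "G y z = (\<Sum>\<^sub>\<infinity>c. g y a c * h z c b)" for y z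
  \<comment> \<open>Summing the rectangular law over \<open>c\<close> leaves Alice's factor times
    \<open>G\<close>, which does not contain \<open>x\<close>. Dividing by the sum over
    \<open>z\<close> then cancels her factor, since \<open>W\<close> sums to 1.\<close>
  have cut: "\<alpha> x a b * W x y z = f x a b * G y z" for x y z
    using infsum_prob_fibres[of "K x y" "\<lambda>w. A w = a \<and> B w = b \<and> Z w = z" C]
      rectangular[of x y a b _ z] private1[of x y a b z]
    by (simp add: conj_ac G_def infsum_cmult_right'[symmetric] mult.assoc)
  have ratio: "W x y z = G y z / (\<Sum>z\<in>UNIV. G y z)" if "\<alpha> x a b \<noteq> 0" for x y z
  proof -
    have "\<alpha> x a b = f x a b * (\<Sum>z\<in>UNIV. G y z)"
      using cut[of x y] by (simp add: sum_distrib_left cut[symmetric]) (simp add: sum_distrib_left[symmetric] W_sum)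
    with cut[of x y z] that show ?thesis by (auto simp: field_simps)
  qed
  have nz: "\<alpha> (X v) (A v) (B v) \<noteq> 0" if "v \<in> set_pmf (mix pX pY K)" for v
  proof -
    have "measure_pmf.prob (K (X v) (Y v)) {u. A u = A v \<and> B u = B v} > 0"
      by (rule measure_pmf_posI[OF set_mix[OF that]]) simp
    thus ?thesis by (simp add: K_AB)
  qed
  have "\<alpha> (X w) a b \<noteq> 0" "\<alpha> (X w') a b \<noteq> 0"
    using nz[OF w(1)] nz[OF w(2)] eq by (simp_all add: a_def b_def)
  hence "W (X w) y z = W (X w') y z" for y z by (simp add: ratio)
  thus "X w = X w'" by (rule nf_X)
qed

lemma det_Y: "det_by (mix pX pY K) Y (\<lambda>w. (A w, C w))"
proof -
  interpret sw: secure_kernel "\<lambda>y x. W x y" "\<lambda>y x. K x y" Y X Z A C B \<beta> \<alpha> "\<lambda>z b c. \<gamma> z c b"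
    g f "\<lambda>z b c. h z c b" by (rule swap)
  show ?thesis using sw.det_X[of pY pX] unfolding mix_swap .
qed

text \<open>The cut isolating Charlie: two outputs compatible with the same \<open>(b, c)\<close>
  have proportional probabilities as functions of \<open>(x, y)\<close>, which the third clause of
  the normal form rules out for distinct outputs.\<close>

lemma det_Z: "det_by (mix pX pY K) Z (\<lambda>w. (B w, C w))"
proof (rule det_byI)
  fix w w' assume w: "w \<in> set_pmf (mix pX pY K)" "w' \<in> set_pmf (mix pX pY K)"
    and eq: "(B w, C w) = (B w', C w')"
  define b c where "b = B w" and "c = C w"
  define G where "G x y = (\<Sum>\<^sub>\<infinity>a. f x a b * g y a c)" for x y
  have cut: "\<gamma> z c b * W x y z = h z c b * G x y" for x y z
    using infsum_prob_fibres[of "K x y" "\<lambda>w. B w = b \<and> C w = c \<and> Z w = z" A]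
      rectangular[of x y _ b c z] private3[of x y c b z]
    by (simp add: conj_ac G_def infsum_cmult_right' mult.commute)
  have nz: "\<gamma> (Z v) (C v) (B v) * W (X v) (Y v) (Z v) \<noteq> 0" if "v \<in> set_pmf (mix pX pY K)" for v
  proof -
    have "measure_pmf.prob (K (X v) (Y v)) {u. C u = C v \<and> B u = B v \<and> Z u = Z v} > 0"
      by (rule measure_pmf_posI[OF set_mix[OF that]]) simp
    thus ?thesis unfolding private3 by (rule less_imp_neq[THEN not_sym])
  qed
  have n1: "\<gamma> (Z w) c b \<noteq> 0" and n2: "\<gamma> (Z w') c b \<noteq> 0" "W (X w') (Y w') (Z w') \<noteq> 0"
    using nz[OF w(1)] nz[OF w(2)] eq by (simp_all add: b_def c_def)
  \<comment> \<open>The output at \<open>w'\<close> has positive probability there, so neither side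
    of its cut identity vanishes.\<close>
  from n2 have n3: "h (Z w') c b \<noteq> 0" using cut[of "Z w'" "X w'" "Y w'"] by auto
  have "W x y (Z w) = (h (Z w) c b / \<gamma> (Z w) c b * (\<gamma> (Z w') c b / h (Z w') c b)) * W x y (Z w')" for x y
  proof -
    have "W x y (Z w) = h (Z w) c b * G x y / \<gamma> (Z w) c b"
      using cut[of "Z w" x y] n1 by (simp add: field_simps)
    moreover have "G x y = \<gamma> (Z w') c b * W x y (Z w') / h (Z w') c b"
      using cut[of "Z w'" x y] n3 by (simp add: field_simps)
    ultimately show ?thesis by (simp add: mult_ac)
  qed
  thus "Z w = Z w'" by (rule nf_Z)
qed

section \<open>Independent inputs and Bob's view\<close>

lemma prob_mix_XY:
  "measure_pmf.prob (mix pX pY K) {w. R w \<and> Y w = y \<and> X w = x} =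
    pmf pX x * pmf pY y * measure_pmf.prob (K x y) {w. R w}"
proof -
  have "measure_pmf.prob (K x' y') {w. R w \<and> Y w = y \<and> X w = x} =
      (if y' = y then if x' = x then measure_pmf.prob (K x y) {w. R w} else 0 else 0)" for x' y'
  proof (cases "y' = y \<and> x' = x")
    case True
    hence "measure_pmf.prob (K x' y') {w. R w \<and> Y w = y \<and> X w = x} = measure_pmf.prob (K x' y') {w. R w}"
      by (intro prob_cong) (auto dest: inputs)
    with True show ?thesis by simp
  next
    case False
    hence "measure_pmf.prob (K x' y') {w. R w \<and> Y w = y \<and> X w = x} = measure_pmf.prob (K x' y') {}"
      by (intro prob_cong) (auto dest: inputs)
    with False show ?thesis by auto
  qed
  thus ?thesis
    by (simp add: mix_def prob_bind if_distrib[of "\<lambda>t. _ * t"] sum.delta cong: if_cong)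
qed

lemma prob_mix_Y:
  "measure_pmf.prob (mix pX pY K) {w. R w \<and> Y w = y} =
    (\<Sum>x\<in>UNIV. pmf pX x * pmf pY y * measure_pmf.prob (K x y) {w. R w})"
  using sum_prob_fibres[of "mix pX pY K" "\<lambda>w. R w \<and> Y w = y" X]
  by (simp add: conj_assoc prob_mix_XY)

lemma prob_mix:
  "measure_pmf.prob (mix pX pY K) {w. R w} =
    (\<Sum>y\<in>UNIV. \<Sum>x\<in>UNIV. pmf pX x * pmf pY y * measure_pmf.prob (K x y) {w. R w})"
  using sum_prob_fibres[of "mix pX pY K" "\<lambda>w. R w" Y] by (simp add: prob_mix_Y)

text \<open>\<open>(A, C)\<close> is Bob's view: it determines \<open>Y\<close>, and by privacy it
  is independent of \<open>(X, Z)\<close> given \<open>Y\<close>. Both masses that involve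
  \<open>(A, C)\<close> carry the same factor \<beta>, which cancels.\<close>

lemma cond_ent_input_output:
  "cond_ent (mix pX pY K) (\<lambda>w. (X w, Z w)) (\<lambda>w. (A w, C w)) = cond_ent (mix pX pY K) (\<lambda>w. (X w, Z w)) Y"
proof (rule cond_ent_eqI)
  fix w assume w: "w \<in> set_pmf (mix pX pY K)"
  let ?p = "mix pX pY K"
  note dY = det_Y[of pX pY]
  have "mass ?p (\<lambda>w. (A w, C w)) w = mass ?p (\<lambda>w. ((A w, C w), Y w)) w"
    using w dY by (intro mass_cong) (iprover intro: det_intros)+
  also have "\<dots> = (\<Sum>x\<in>UNIV. pmf pX x * pmf pY (Y w) * \<beta> (Y w) (A w) (C w))"
    by (simp add: mass_def prob_mix_Y[where R = "\<lambda>w'. A w' = A w \<and> C w' = C w", simplified conj_assoc]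
        secure_kernel.K_AB[OF swap])
  also have "\<dots> = \<beta> (Y w) (A w) (C w) * pmf pY (Y w)"
    by (simp add: sum_distrib_right[symmetric] sum_pmf_eq_1)
  finally have 1: "mass ?p (\<lambda>w. (A w, C w)) w = \<beta> (Y w) (A w) (C w) * pmf pY (Y w)" .
  have "mass ?p (\<lambda>w. ((X w, Z w), (A w, C w))) w = mass ?p (\<lambda>w. ((A w, C w, Z w), Y w, X w)) w"
    using w dY by (intro mass_cong) (iprover intro: det_intros)+
  also have "\<dots> = pmf pX (X w) * pmf pY (Y w) * (\<beta> (Y w) (A w) (C w) * W (X w) (Y w) (Z w))"
    by (simp add: mass_def prob_mix_XY[where R = "\<lambda>w'. A w' = A w \<and> C w' = C w \<and> Z w' = Z w", simplified conj_assoc] private2)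
  finally have 2: "mass ?p (\<lambda>w. ((X w, Z w), (A w, C w))) w = 
      pmf pX (X w) * pmf pY (Y w) * (\<beta> (Y w) (A w) (C w) * W (X w) (Y w) (Z w))" .
  have "mass ?p Y w = measure_pmf.prob ?p {w'. True \<and> Y w' = Y w}" by (simp add: mass_def)
  also have "\<dots> = pmf pY (Y w)"
    by (subst prob_mix_Y) (simp add: sum_distrib_right[symmetric] sum_pmf_eq_1)
  finally have 3: "mass ?p Y w = pmf pY (Y w)" .
  have "mass ?p (\<lambda>w. ((X w, Z w), Y w)) w = measure_pmf.prob ?p {w'. Z w' = Z w \<and> Y w' = Y w \<and> X w' = X w}"
    by (simp add: mass_def conj_ac)
  also have "\<dots> = pmf pX (X w) * pmf pY (Y w) * W (X w) (Y w) (Z w)"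
    by (simp add: prob_mix_XY correct)
  finally have 4: "mass ?p (\<lambda>w. ((X w, Z w), Y w)) w = pmf pX (X w) * pmf pY (Y w) * W (X w) (Y w) (Z w)" .
  show "mass ?p (\<lambda>w. (A w, C w)) w * mass ?p (\<lambda>w. ((X w, Z w), Y w)) w =
      mass ?p Y w * mass ?p (\<lambda>w. ((X w, Z w), (A w, C w))) w"
    unfolding 1 2 3 4 by simp
qed

lemma cond_ent_output:
  "cond_ent (mix pX pY K) Z (\<lambda>w. (A w, C w)) = cond_ent (mix pX pY K) Z Y"
proof (rule cond_ent_eqI)
  fix w assume w: "w \<in> set_pmf (mix pX pY K)"
  let ?p = "mix pX pY K"
  note dY = det_Y[of pX pY]
  have "mass ?p (\<lambda>w. (A w, C w)) w = mass ?p (\<lambda>w. ((A w, C w), Y w)) w"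
    using w dY by (intro mass_cong) (iprover intro: det_intros)+
  also have "\<dots> = (\<Sum>x\<in>UNIV. pmf pX x * pmf pY (Y w) * \<beta> (Y w) (A w) (C w))"
    by (simp add: mass_def prob_mix_Y[where R = "\<lambda>w'. A w' = A w \<and> C w' = C w", simplified conj_assoc]
        secure_kernel.K_AB[OF swap])
  also have "\<dots> = \<beta> (Y w) (A w) (C w) * pmf pY (Y w)"
    by (simp add: sum_distrib_right[symmetric] sum_pmf_eq_1)
  finally have 1: "mass ?p (\<lambda>w. (A w, C w)) w = \<beta> (Y w) (A w) (C w) * pmf pY (Y w)" .
  have "mass ?p (\<lambda>w. (Z w, (A w, C w))) w = mass ?p (\<lambda>w. ((A w, C w, Z w), Y w)) w"
    using w dY by (intro mass_cong) (iprover intro: det_intros)+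
  also have "\<dots> = (\<Sum>x\<in>UNIV. pmf pX x * pmf pY (Y w) * (\<beta> (Y w) (A w) (C w) * W x (Y w) (Z w)))"
    by (simp add: mass_def prob_mix_Y[where R = "\<lambda>w'. A w' = A w \<and> C w' = C w \<and> Z w' = Z w", simplified conj_assoc] private2)
  also have "\<dots> = \<beta> (Y w) (A w) (C w) * (\<Sum>x\<in>UNIV. pmf pX x * pmf pY (Y w) * W x (Y w) (Z w))"
    by (simp add: sum_distrib_left mult_ac)
  finally have 2: "mass ?p (\<lambda>w. (Z w, (A w, C w))) w =
      \<beta> (Y w) (A w) (C w) * (\<Sum>x\<in>UNIV. pmf pX x * pmf pY (Y w) * W x (Y w) (Z w))" .
  have "mass ?p Y w = measure_pmf.prob ?p {w'. True \<and> Y w' = Y w}" by (simp add: mass_def)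
  also have "\<dots> = pmf pY (Y w)"
    by (subst prob_mix_Y) (simp add: sum_distrib_right[symmetric] sum_pmf_eq_1)
  finally have 3: "mass ?p Y w = pmf pY (Y w)" .
  have 4: "mass ?p (\<lambda>w. (Z w, Y w)) w = (\<Sum>x\<in>UNIV. pmf pX x * pmf pY (Y w) * W x (Y w) (Z w))"
    by (simp add: mass_def prob_mix_Y correct)
  show "mass ?p (\<lambda>w. (A w, C w)) w * mass ?p (\<lambda>w. (Z w, Y w)) w =
      mass ?p Y w * mass ?p (\<lambda>w. (Z w, (A w, C w))) w"
    unfolding 1 2 3 4 by simp
qed

text \<open>Given \<open>(A, C)\<close>, link \<open>B\<close> supplies what is missing to both
  cuts, to \<open>(A, B)\<close> for \<open>X\<close> and to \<open>(B, C)\<close> for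
  \<open>Z\<close>.\<close>

lemma cond_entropy_le:
  assumes fin: "fin_ent (mix pX pY K) B"
  shows "cond_entropy (\<lambda>((x, z), y). pmf pX x * pmf pY y * W x y z) \<le> cond_ent (mix pX pY K) B A"
proof -
  let ?p = "mix pX pY K"
  have "cond_entropy (\<lambda>((x, z), y). pmf pX x * pmf pY y * W x y z) = cond_ent ?p (\<lambda>w. (X w, Z w)) Y"
  proof (rule cond_ent_conv_cond_entropy[symmetric], clarsimp)
    fix x y z
    have "measure_pmf.prob ?p {w. X w = x \<and> Z w = z \<and> Y w = y} =
        measure_pmf.prob ?p {w. Z w = z \<and> Y w = y \<and> X w = x}" by (simp add: conj_ac)
    thus "pmf pX x * pmf pY y * W x y z = measure_pmf.prob ?p {w. X w = x \<and> Z w = z \<and> Y w = y}"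
      by (simp add: prob_mix_XY correct)
  qed
  also have "\<dots> = cond_ent ?p (\<lambda>w. (X w, Z w)) (\<lambda>w. (A w, C w))"
    by (rule cond_ent_input_output[symmetric])
  also have "\<dots> \<le> cond_ent ?p B (\<lambda>w. (A w, C w))"
  proof (rule cond_ent_le[OF fin], rule det_pair)
    show "det_by ?p X (\<lambda>w. (B w, A w, C w))"
      by (rule det_trans[OF det_X]) (iprover intro: det_intros)
    show "det_by ?p Z (\<lambda>w. (B w, A w, C w))"
      by (rule det_trans[OF det_Z]) (iprover intro: det_intros)
  qed
  also have "\<dots> \<le> cond_ent ?p B A"
    by (rule cond_ent_mono[OF fin]) (iprover intro: det_intros)
  finally show ?thesis .
qed

lemma residual_info_bound:
  assumes fin: "fin_ent (mix pX pY K) B"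
  shows "residual_info (\<lambda>(y, z). \<Sum>x\<in>UNIV. pmf pX x * pmf pY y * W x y z)
    \<le> cond_ent (mix pX pY K) B (\<lambda>_. ()) - cond_ent (mix pX pY K) B A"
proof -
  let ?p = "mix pX pY K"
  define q where "q = (\<lambda>(y, z). \<Sum>x\<in>UNIV. pmf pX x * pmf pY y * W x y z)"
  have q: "q (y, z) = measure_pmf.prob ?p {w. Y w = y \<and> Z w = z}" for y z
    using prob_mix_Y[of pX pY "\<lambda>w. Z w = z" y] by (simp add: q_def correct conj_commute)
  \<comment> \<open>The law of link \<open>C\<close> given \<open>y\<close>, from Bob's view, and
    below given \<open>z\<close>, from Charlie's.\<close>
  define k1 where "k1 y = (\<lambda>c. \<Sum>\<^sub>\<infinity>a. \<beta> y a c)" for y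
  define k2 where "k2 z = (\<lambda>c. \<Sum>\<^sub>\<infinity>b. \<gamma> z c b)" for z
  have K_CZ: "measure_pmf.prob (K x y) {w. C w = c \<and> Z w = z} = k1 y c * W x y z" for x y c z
    using secure_kernel.K_BZ[OF swap] by (simp add: k1_def)
  have K_CZ': "measure_pmf.prob (K x y) {w. C w = c \<and> Z w = z} = k2 z c * W x y z" for x y c z
    using secure_kernel.K_BZ'[OF swap] by (simp add: k2_def)
  \<comment> \<open>\<open>gk_common\<close> ranges over functions into nat, so the laws are
    numbered, by one injective labelling for both families.\<close>
  have "countable (range k1 \<union> range k2)" by simp
  hence inj: "inj_on (to_nat_on (range k1 \<union> range k2)) (range k1 \<union> range k2)"
    by (rule inj_on_to_nat_on)
  define l1 where "l1 y = to_nat_on (range k1 \<union> range k2) (k1 y)" for y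
  define l2 where "l2 z = to_nat_on (range k1 \<union> range k2) (k2 z)" for z
  have l2: "l2 z = l2 z' \<longleftrightarrow> k2 z = k2 z'" for z z'
    unfolding l2_def by (rule inj_on_eq_iff[OF inj]) auto
  have l12: "l1 y = l2 z" if "q (y, z) > 0" for y z
  proof -
    from that have "(\<Sum>x\<in>UNIV. pmf pX x * pmf pY y * W x y z) \<noteq> 0" by (simp add: q_def)
    then obtain x where "pmf pX x * pmf pY y * W x y z \<noteq> 0" by (rule sum.not_neutral_contains_not_neutral)
    hence "W x y z \<noteq> 0" by simp
    hence "k1 y c = k2 z c" for c using K_CZ[of x y c z] K_CZ'[of x y c z] by simp
    hence "k1 y = k2 z" by (rule ext)
    thus ?thesis by (simp add: l1_def l2_def)
  qed
  \<comment> \<open>\<open>Q\<close> labels the conditional law of \<open>C\<close>, which given \<open>Y\<close> and given \<open>Z\<close> is the same; hence it is a common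
    part of \<open>Y\<close> and \<open>Z\<close> given which \<open>C\<close> and \<open>Z\<close> are independent.\<close>
  define Q where "Q w = l2 (Z w)" for w
  have lY: "l1 (Y w) = Q w" if "w \<in> set_pmf ?p" for w
  proof -
    have "measure_pmf.prob ?p {w'. Y w' = Y w \<and> Z w' = Z w} > 0"
      by (rule measure_pmf_posI[OF that]) simp
    thus ?thesis unfolding Q_def by (intro l12) (simp add: q)
  qed
  have detQ: "det_by ?p Q Z" unfolding Q_def by (rule det_byI) simp
  have finZ: "fin_ent ?p Z" by (rule fin_ent_finite)
  have finQ: "fin_ent ?p Q" by (rule fin_ent_det[OF finZ detQ])

  have "cond_ent ?p Z C \<ge> cond_ent ?p Z (\<lambda>w. (Q w, C w))"
    by (rule cond_ent_mono[OF finZ]) (iprover intro: det_intros)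
  moreover have "cond_ent ?p Z (\<lambda>w. (Q w, C w)) = cond_ent ?p Z Q"
  proof (rule cond_ent_eqI)
    fix w assume w: "w \<in> set_pmf ?p"
    define c where "c = C w"
    define pz where "pz z = measure_pmf.prob ?p {w. Z w = z}" for z
    have CZ: "measure_pmf.prob ?p {w. C w = c \<and> Z w = z} = k2 z c * pz z" for z
      by (simp add: prob_mix[of pX pY "\<lambda>w. C w = c \<and> Z w = z"] prob_mix[of pX pY "\<lambda>w. Z w = z"]
          pz_def K_CZ' correct sum_distrib_left mult_ac)
    have split: "measure_pmf.prob ?p {w'. R w' \<and> Q w' = Q w} =
        (\<Sum>z\<in>{z. l2 z = Q w}. measure_pmf.prob ?p {w'. R w' \<and> Z w' = z})" for R
    proof -
      have "measure_pmf.prob ?p {w'. R w' \<and> Q w' = Q w} =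
          (\<Sum>z\<in>UNIV. measure_pmf.prob ?p {w'. (R w' \<and> Q w' = Q w) \<and> Z w' = z})"
        by (rule sum_prob_fibres[symmetric])
      also have "\<dots> = (\<Sum>z\<in>UNIV. if l2 z = Q w then measure_pmf.prob ?p {w'. R w' \<and> Z w' = z} else 0)"
      proof (rule sum.cong[OF refl])
        fix z
        have "{w'. (R w' \<and> Q w' = Q w) \<and> Z w' = z} = (if l2 z = Q w then {w'. R w' \<and> Z w' = z} else {})"
          by (auto simp: Q_def)
        thus "measure_pmf.prob ?p {w'. (R w' \<and> Q w' = Q w) \<and> Z w' = z} =
            (if l2 z = Q w then measure_pmf.prob ?p {w'. R w' \<and> Z w' = z} else 0)" by simp
      qed
      finally show ?thesis by (simp add: sum.If_cases)
    qed
    have "mass ?p (\<lambda>w. (Q w, C w)) w = (\<Sum>z\<in>{z. l2 z = Q w}. k2 z c * pz z)"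
      using split[of "\<lambda>w'. C w' = c"] by (simp add: mass_def c_def[symmetric] CZ conj_commute)
    also have "\<dots> = (\<Sum>z\<in>{z. l2 z = Q w}. k2 (Z w) c * pz z)"
      by (rule sum.cong[OF refl]) (simp add: Q_def l2)
    also have "\<dots> = k2 (Z w) c * mass ?p Q w"
      using split[of "\<lambda>_. True"] by (simp add: mass_def pz_def sum_distrib_left)
    finally have 1: "mass ?p (\<lambda>w. (Q w, C w)) w = k2 (Z w) c * mass ?p Q w" .
    have "mass ?p (\<lambda>w. (Z w, Q w, C w)) w = mass ?p (\<lambda>w. (C w, Z w)) w"
      using w detQ by (intro mass_cong) (iprover intro: det_intros)+
    also have "\<dots> = k2 (Z w) c * mass ?p Z w"
      using CZ[of "Z w"] by (simp add: mass_def c_def pz_def)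
    finally have 2: "mass ?p (\<lambda>w. (Z w, Q w, C w)) w = k2 (Z w) c * mass ?p Z w" .
    have 3: "mass ?p (\<lambda>w. (Z w, Q w)) w = mass ?p Z w"
      using w detQ by (intro mass_cong) (iprover intro: det_intros)+
    show "mass ?p (\<lambda>w. (Q w, C w)) w * mass ?p (\<lambda>w. (Z w, Q w)) w =
        mass ?p Q w * mass ?p (\<lambda>w. (Z w, Q w, C w)) w"
      unfolding 1 2 3 by simp
  qed
  ultimately have ZC: "cond_ent ?p Z Q \<le> cond_ent ?p Z C" by simp

  \<comment> \<open>I(Y;Z) = H(Z) - H(Z|Y), and H(Z) = H(Q) + H(Z|Q) because \<open>Q\<close> is a
    function of \<open>Z\<close>.\<close>
  have "mutual_info q - entropy_img (\<lambda>y. \<Sum>z\<in>UNIV. q (y, z)) l1 = cond_ent ?p Z Q - cond_ent ?p Z Y"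
  proof -
    have "entropy_img (\<lambda>y. \<Sum>z\<in>UNIV. q (y, z)) l1 = (\<integral>w. - log 2 (mass ?p (\<lambda>w. l1 (Y w)) w) \<partial>measure_pmf ?p)"
      by (rule integral_neg_log_conv_entropy_img[symmetric])
        (use sum_prob_fibres[of ?p "\<lambda>w. Y w = y" Z for y] in \<open>simp add: q\<close>)
    also have "\<dots> = (\<integral>w. - log 2 (mass ?p Q w) \<partial>measure_pmf ?p)"
    proof (rule integral_cong_AE[OF borel_measurable_pmf borel_measurable_pmf], rule AE_pmfI)
      fix w assume w: "w \<in> set_pmf ?p"
      have "mass ?p (\<lambda>w. l1 (Y w)) w = mass ?p Q w"
        unfolding mass_def by (rule prob_cong) (simp add: lY w)
      thus "- log 2 (mass ?p (\<lambda>w. l1 (Y w)) w) = - log 2 (mass ?p Q w)" by simp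
    qed
    finally have HQ: "entropy_img (\<lambda>y. \<Sum>z\<in>UNIV. q (y, z)) l1 = (\<integral>w. - log 2 (mass ?p Q w) \<partial>measure_pmf ?p)" .
    have MI: "mutual_info q = (\<integral>w. log 2 (mass ?p (\<lambda>w. (Y w, Z w)) w / (mass ?p Y w * mass ?p Z w)) \<partial>measure_pmf ?p)"
      by (rule mutual_info_conv_integral) (rule q)
    have int1: "integrable (measure_pmf ?p) (\<lambda>w. - log 2 (mass ?p Q w))"
      using finQ by (simp add: fin_ent_def)
    have eq: "log 2 (mass ?p (\<lambda>w. (Y w, Z w)) w / (mass ?p Y w * mass ?p Z w)) =
        (log 2 (mass ?p Q w / mass ?p (\<lambda>w. (Z w, Q w)) w) - log 2 (mass ?p Y w / mass ?p (\<lambda>w. (Z w, Y w)) w))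
        + - log 2 (mass ?p Q w)" if w: "w \<in> set_pmf ?p" for w
    proof -
      have "mass ?p (\<lambda>w. (Z w, Q w)) w = mass ?p Z w" "mass ?p (\<lambda>w. (Z w, Y w)) w = mass ?p (\<lambda>w. (Y w, Z w)) w"
        using w detQ by (intro mass_cong; iprover intro: det_intros)+
      thus ?thesis by (simp add: log_divide log_mult mass_neq_0[OF w])
    qed
    have "mutual_info q = (\<integral>w. (log 2 (mass ?p Q w / mass ?p (\<lambda>w. (Z w, Q w)) w)
        - log 2 (mass ?p Y w / mass ?p (\<lambda>w. (Z w, Y w)) w)) + - log 2 (mass ?p Q w) \<partial>measure_pmf ?p)"
      unfolding MI by (rule integral_cong_AE[OF borel_measurable_pmf borel_measurable_pmf], rule AE_pmfI, rule eq)
    also have "\<dots> = (cond_ent ?p Z Q - cond_ent ?p Z Y) + (\<integral>w. - log 2 (mass ?p Q w) \<partial>measure_pmf ?p)"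
      unfolding cond_ent_def
      by (subst Bochner_Integration.integral_add[OF Bochner_Integration.integrable_diff[OF
              cond_ent_integrable[OF finZ] cond_ent_integrable[OF finZ]] int1],
          subst Bochner_Integration.integral_diff[OF cond_ent_integrable[OF finZ] cond_ent_integrable[OF finZ]]) (rule refl)
    finally show ?thesis by (simp add: HQ)
  qed
  moreover have "residual_info q \<le> mutual_info q - entropy_img (\<lambda>y. \<Sum>z\<in>UNIV. q (y, z)) l1"
    by (rule residual_info_le) (auto simp: q l12[unfolded q])
  \<comment> \<open>The right-hand side is I(A;Z|C): \<open>ZC\<close> replaces the condition
    \<open>Q\<close> by \<open>C\<close>, and \<open>cond_ent_output\<close> replaces
    \<open>Y\<close> by \<open>(A, C)\<close>.\<close>
  ultimately have "residual_info q \<le> cond_ent ?p Z C - cond_ent ?p Z (\<lambda>w. (A w, C w))"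
    using ZC cond_ent_output[of pX pY] by linarith
  \<comment> \<open>Data processing, I(A;Z|C) \<le> I(A;B|C), as \<open>Z\<close> is a function of
    \<open>B\<close> once \<open>C\<close> is known.\<close>
  also have "\<dots> \<le> cond_ent ?p B C - cond_ent ?p B (\<lambda>w. (A w, C w))"
  proof -
    have "cond_ent ?p B C = cond_ent ?p Z C + cond_ent ?p B (\<lambda>w. (Z w, C w))"
      by (rule cond_ent_chain[OF fin det_Z])
    moreover have "cond_ent ?p B (\<lambda>w. (A w, C w)) =
        cond_ent ?p Z (\<lambda>w. (A w, C w)) + cond_ent ?p B (\<lambda>w. (Z w, A w, C w))"
      by (rule cond_ent_chain[OF fin], rule det_trans[OF det_Z]) (iprover intro: det_intros)
    moreover have "cond_ent ?p B (\<lambda>w. (Z w, A w, C w)) \<le> cond_ent ?p B (\<lambda>w. (Z w, C w))"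
      by (rule cond_ent_mono[OF fin]) (iprover intro: det_intros)
    ultimately show ?thesis by linarith
  qed
  also have "\<dots> \<le> cond_ent ?p B (\<lambda>_. ()) - cond_ent ?p B A"
  proof -
    from interactive[of pX pY] obtain As Bs Cs :: "nat \<Rightarrow> 'w \<Rightarrow> lhist" where
      ex: "exhausts ?p As A" "exhausts ?p Bs B" "exhausts ?p Cs C"
      and ev: "\<And>n. evolves ?p (\<lambda>_. []) (\<lambda>_. []) (\<lambda>_. []) (As n) (Bs n) (Cs n)" by blast
    have "0 \<le> interaction ?p (As n) (Bs n) (Cs n)" for n
    proof -
      have "interaction ?p (\<lambda>_. [] :: lhist) (\<lambda>_. [] :: lhist) (\<lambda>_. [] :: lhist) \<le> interaction ?p (As n) (Bs n) (Cs n)"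
        by (rule interaction_evolves[OF ev fin_ent_det[OF fin exhausts_det[OF ex(2)]]])
      moreover have const: "cond_ent ?p (\<lambda>_. [] :: lhist) V = 0" for V :: "'w \<Rightarrow> 'v"
        by (rule cond_ent_det) (rule det_byI, simp)
      have "interaction ?p (\<lambda>_. [] :: lhist) (\<lambda>_. [] :: lhist) (\<lambda>_. [] :: lhist) = 0"
        unfolding interaction_def by (simp add: const)
      ultimately show ?thesis by simp
    qed
    from interaction_limit[OF fin ex this] show ?thesis by (simp add: interaction_def)
  qed
  finally show ?thesis by (simp add: q_def)
qed

text \<open>If the two probabilities of \<open>b\<close> differed, inputs could be split by the
  probability they give to \<open>b\<close>. An output reachable from both blocks would equate these
  probabilities, each being also a function of \<open>z\<close>; so the blocks would have disjoint
  output sets.\<close>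

lemma law_B_const:
  assumes "\<not> X_splits W"
  shows "(\<Sum>\<^sub>\<infinity>a. \<alpha> x a b) = (\<Sum>\<^sub>\<infinity>a. \<alpha> x' a b)"
proof (rule ccontr)
  assume neq: "(\<Sum>\<^sub>\<infinity>a. \<alpha> x a b) \<noteq> (\<Sum>\<^sub>\<infinity>a. \<alpha> x' a b)"
  define X1 where "X1 = {v. (\<Sum>\<^sub>\<infinity>a. \<alpha> v a b) = (\<Sum>\<^sub>\<infinity>a. \<alpha> x a b)}"
  have eq: "(\<Sum>\<^sub>\<infinity>a. \<alpha> v a b) = (\<Sum>\<^sub>\<infinity>c. \<gamma> z c b)" if "W v y z > 0" for v y z
    using K_BZ[of v y b z] K_BZ'[of v y b z] that by simp
  have "Zset_X W X1 \<inter> Zset_X W (- X1) = {}"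
    using eq by (fastforce simp: Zset_X_def X1_def)
  moreover have "x \<in> X1" "x' \<in> - X1" using neq by (auto simp: X1_def)
  ultimately have "X_splits W" unfolding X_splits_def by (intro exI[of _ X1] exI[of _ "- X1"]) auto
  thus False using assms by simp
qed

lemma entropy_bound:
  assumes "\<not> X_splits W"
  shows "(SUP pX\<in>fs_dists.
      (SUP pY\<in>fs_dists. ennreal (residual_info (\<lambda>(y, z). \<Sum>x\<in>UNIV. pX x * pY y * W x y z)))
    + (SUP pY\<in>fs_dists. ennreal (cond_entropy (\<lambda>((x, z), y). pX x * pY y * W x y z))))
    \<le> disc_entropy (\<lambda>b. measure_pmf.prob (K x0 y0) {w. B w = b})" (is "_ \<le> ?H")
\<comment> \<open>An infinite entropy makes the bound trivial; a finite one supplies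
  \<open>fin_ent\<close> for link \<open>B\<close> under every product law.\<close>
proof (cases "?H = \<top>")
  case False
  hence H: "?H < \<top>" by (simp add: less_top)
  have law: "pmf (map_pmf B (mix r s K)) = (\<lambda>b. measure_pmf.prob (K x0 y0) {w. B w = b})" for r s
  proof
    fix b
    have "pmf (map_pmf B (mix r s K)) b = (\<Sum>y\<in>UNIV. \<Sum>x\<in>UNIV. pmf r x * pmf s y * (\<Sum>\<^sub>\<infinity>a. \<alpha> x a b))"
      by (simp add: pmf_map vimage_def prob_mix K_B)
    also have "\<dots> = (\<Sum>y\<in>UNIV. \<Sum>x\<in>UNIV. pmf r x * pmf s y * (\<Sum>\<^sub>\<infinity>a. \<alpha> x0 a b))"
      by (intro sum.cong refl arg_cong2[where f = times] law_B_const[OF assms])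
    also have "\<dots> = (\<Sum>\<^sub>\<infinity>a. \<alpha> x0 a b)"
      by (simp add: sum_distrib_right[symmetric] sum_pmf_eq_1)
    finally show "pmf (map_pmf B (mix r s K)) b = measure_pmf.prob (K x0 y0) {w. B w = b}"
      by (simp add: K_B)
  qed
  have fin: "fin_ent (mix r s K) B" and Hc: "?H = ennreal (cond_ent (mix r s K) B (\<lambda>_. ()))" for r s
    using disc_entropy_finite[of B "mix r s K"] H unfolding law by auto
  \<comment> \<open>A reference law for \<open>Y\<close>. The two inner suprema may pull
    \<open>Y\<close> towards different laws, and \<open>(A, B)\<close> has the same law under all of
    them.\<close>
  define s0 where "s0 = return_pmf y0"
  have AB: "map_pmf (\<lambda>w. (A w, B w)) (mix r s K) = map_pmf (\<lambda>w. (A w, B w)) (mix r s0 K)" for r s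
  proof (rule pmf_eqI)
    fix i :: "'m \<times> 'm"
    have "pmf (map_pmf (\<lambda>w. (A w, B w)) (mix r s K)) i = (\<Sum>x\<in>UNIV. pmf r x * \<alpha> x (fst i) (snd i))" for s
    proof -
      have "pmf (map_pmf (\<lambda>w. (A w, B w)) (mix r s K)) i =
          (\<Sum>y\<in>UNIV. \<Sum>x\<in>UNIV. pmf r x * pmf s y * \<alpha> x (fst i) (snd i))"
        by (simp add: pmf_map vimage_def prod_eq_iff prob_mix K_AB)
      also have "\<dots> = (\<Sum>y\<in>UNIV. pmf s y * (\<Sum>x\<in>UNIV. pmf r x * \<alpha> x (fst i) (snd i)))"
        by (simp add: sum_distrib_left mult_ac)
      finally show ?thesis by (simp add: sum_distrib_right[symmetric] sum_pmf_eq_1)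
    qed
    thus "pmf (map_pmf (\<lambda>w. (A w, B w)) (mix r s K)) i = pmf (map_pmf (\<lambda>w. (A w, B w)) (mix r s0 K)) i"
      by simp
  qed
  have cent_BA: "cond_ent (mix r s K) B A = cond_ent (mix r s0 K) B A" for r s
    using cond_ent_map_pmf[of "\<lambda>w. (A w, B w)" "mix r s K" snd fst]
      cond_ent_map_pmf[of "\<lambda>w. (A w, B w)" "mix r s0 K" snd fst] AB[of r s] by simp
  have cent_B: "cond_ent (mix r s K) B (\<lambda>_. ()) = cond_ent (mix r s0 K) B (\<lambda>_. ())" for r s
    using cond_ent_map_pmf[of "\<lambda>w. (A w, B w)" "mix r s K" snd "\<lambda>_. ()"]
      cond_ent_map_pmf[of "\<lambda>w. (A w, B w)" "mix r s0 K" snd "\<lambda>_. ()"] AB[of r s] by simp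
  show ?thesis
  proof (rule SUP_least)
    fix pX :: "'x \<Rightarrow> real" assume "pX \<in> fs_dists"
    then obtain r where r: "pX = pmf r" using fs_dists_pmf by metis
    let ?p = "mix r s0 K"
    have "(SUP pY\<in>fs_dists. ennreal (residual_info (\<lambda>(y, z). \<Sum>x\<in>UNIV. pX x * pY y * W x y z)))
        \<le> ennreal (cond_ent ?p B (\<lambda>_. ()) - cond_ent ?p B A)"
    proof (rule SUP_least)
      fix pY :: "'y \<Rightarrow> real" assume "pY \<in> fs_dists"
      then obtain s where s: "pY = pmf s" using fs_dists_pmf by metis
      show "ennreal (residual_info (\<lambda>(y, z). \<Sum>x\<in>UNIV. pX x * pY y * W x y z))
          \<le> ennreal (cond_ent ?p B (\<lambda>_. ()) - cond_ent ?p B A)"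
        using residual_info_bound[OF fin, of r s] unfolding r s cent_BA[of r s] cent_B[of r s] by (rule ennreal_leI)
    qed
    moreover have "(SUP pY\<in>fs_dists. ennreal (cond_entropy (\<lambda>((x, z), y). pX x * pY y * W x y z)))
        \<le> ennreal (cond_ent ?p B A)"
    proof (rule SUP_least)
      fix pY :: "'y \<Rightarrow> real" assume "pY \<in> fs_dists"
      then obtain s where s: "pY = pmf s" using fs_dists_pmf by metis
      show "ennreal (cond_entropy (\<lambda>((x, z), y). pX x * pY y * W x y z)) \<le> ennreal (cond_ent ?p B A)"
        using cond_entropy_le[OF fin, of r s] unfolding r s cent_BA[of r s] by (rule ennreal_leI)
    qed
    ultimately have "(SUP pY\<in>fs_dists. ennreal (residual_info (\<lambda>(y, z). \<Sum>x\<in>UNIV. pX x * pY y * W x y z)))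
        + (SUP pY\<in>fs_dists. ennreal (cond_entropy (\<lambda>((x, z), y). pX x * pY y * W x y z)))
        \<le> ennreal (cond_ent ?p B (\<lambda>_. ()) - cond_ent ?p B A) + ennreal (cond_ent ?p B A)"
      by (rule add_mono)
    also have "\<dots> = ennreal (cond_ent ?p B (\<lambda>_. ()))"
    proof -
      have "cond_ent ?p B A \<le> cond_ent ?p B (\<lambda>_. ())"
        by (rule cond_ent_mono[OF fin]) (rule det_byI, simp)
      thus ?thesis by (subst ennreal_plus[symmetric]) (auto simp: cond_ent_nonneg)
    qed
    finally show "(SUP pY\<in>fs_dists. ennreal (residual_info (\<lambda>(y, z). \<Sum>x\<in>UNIV. pX x * pY y * W x y z)))
        + (SUP pY\<in>fs_dists. ennreal (cond_entropy (\<lambda>((x, z), y). pX x * pY y * W x y z))) \<le> ?H"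
      by (simp add: Hc[of r s0])
  qed
qed simp

end

section \<open>Runs of a protocol\<close>

definition valid_hist :: "(lhist \<Rightarrow> msg set) \<Rightarrow> (lhist \<Rightarrow> msg set) \<Rightarrow> lhist \<Rightarrow> bool" where
  "valid_hist c d h \<longleftrightarrow> (\<forall>i<length h. fst (h ! i) \<in> c (take i h) \<and> snd (h ! i) \<in> d (take i h))"

lemma valid_hist_snoc:
  "valid_hist c d (h @ [e]) \<longleftrightarrow> valid_hist c d h \<and> fst e \<in> c h \<and> snd e \<in> d h"
  unfolding valid_hist_def by (auto simp: nth_append less_Suc_eq)

lemma flat_snoc: "flat (h @ [e]) = flat h @ fst e @ snd e"
  by (simp add: flat_def case_prod_unfold)

lemma flat_Nil [simp]: "flat [] = []"
  by (simp add: flat_def)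

text \<open>The two messages of a round have codebooks fixed by the past of the link, so the first
  can be split off and then the second.\<close>

lemma prefix_free_parse:
  assumes "prefix_free c" "prefix_free d" "u \<in> c" "u' \<in> c" "v \<in> d" "v' \<in> d"
    and "prefix (u @ v) r" "prefix (u' @ v') r"
  shows "u = u' \<and> v = v'"
proof -
  have "prefix u r" "prefix u' r" using assms(7,8) append_prefixD by blast+
  hence "prefix u u' \<or> prefix u' u" by (rule prefix_same_cases)
  hence u: "u = u'" using assms unfolding prefix_free_def by blast
  obtain s where r: "r = u @ s" using \<open>prefix u r\<close> by (auto simp: prefix_def)
  have "prefix v s" "prefix v' s" using assms(7,8) u r by auto
  hence "prefix v v' \<or> prefix v' v" by (rule prefix_same_cases)
  hence "v = v'" using assms unfolding prefix_free_def by blast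
  with u show ?thesis by simp
qed

text \<open>The lengths are compared because a prefix-free code may consist of the empty word alone,
  and rounds of empty messages leave no trace in the flattened string. Once the earlier rounds
  agree, the codebooks of the last round coincide and it can be parsed.\<close>

lemma valid_hist_unique:
  assumes "\<And>h. prefix_free (c h)" "\<And>h. prefix_free (d h)"
  shows "valid_hist c d h \<Longrightarrow> valid_hist c d h' \<Longrightarrow> length h = length h' \<Longrightarrow>
    prefix (flat h) m \<Longrightarrow> prefix (flat h') m \<Longrightarrow> h = h'"
proof (induction h arbitrary: h' rule: rev_induct)
  case Nil
  thus ?case by simp
next
  case (snoc e h)
  from snoc.prems(3) obtain k e' where h': "h' = k @ [e']" and len: "length h = length k"
    by (cases h' rule: rev_cases) auto
  have "prefix (flat h) m" "prefix (flat k) m"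
    using snoc.prems(4,5) append_prefixD unfolding h' flat_snoc by blast+
  hence hk: "h = k"
    using snoc.IH[of k] snoc.prems(1,2) len by (simp add: h' valid_hist_snoc)
  from \<open>prefix (flat h) m\<close> obtain s where m: "m = flat h @ s" by (auto simp: prefix_def)
  have "prefix (fst e @ snd e) s" "prefix (fst e' @ snd e') s"
    using snoc.prems(4,5) by (simp_all add: h' hk[symmetric] m flat_snoc)
  hence "fst e = fst e' \<and> snd e = snd e'"
    using snoc.prems(1,2) by (intro prefix_free_parse[OF assms(1)[of k] assms(2)[of k]]) (simp_all add: h' hk valid_hist_snoc)
  thus ?case by (simp add: h' hk prod_eq_iff)
qed

text \<open>Prefix-freeness lets the first \<open>n\<close> rounds of a link be read off from its final transcript alone.\<close>

definition parse :: "(lhist \<Rightarrow> msg set) \<Rightarrow> (lhist \<Rightarrow> msg set) \<Rightarrow> nat \<Rightarrow> msg \<Rightarrow> lhist" where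
  "parse c d n m = (THE h. valid_hist c d h \<and> length h = n \<and> prefix (flat h) m)"

lemma parse_eq:
  assumes "\<And>h. prefix_free (c h)" "\<And>h. prefix_free (d h)"
    and "valid_hist c d h" "length h = n" "prefix (flat h) m"
  shows "parse c d n m = h"
  unfolding parse_def
proof (rule the_equality)
  show "valid_hist c d h \<and> length h = n \<and> prefix (flat h) m" using assms by simp
  show "h' = h" if "valid_hist c d h' \<and> length h' = n \<and> prefix (flat h') m" for h'
    using valid_hist_unique[where c = c and d = d and h = h' and h' = h and m = m, OF assms(1,2)] that assms(3-5) by simp
qed

lemma parse_0: "parse c d 0 m = []"
  unfolding parse_def by (rule the_equality) (auto simp: valid_hist_def)

text \<open>A history whose last round is only partially performed; an empty message stands for one not yet sent.\<close>

definition partial_round :: "bool \<Rightarrow> bool \<Rightarrow> lhist \<Rightarrow> lhist" where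
  "partial_round s t h = butlast h @ [(if s then fst (last h) else [], if t then snd (last h) else [])]"

lemma butlast_partial_round [simp]: "butlast (partial_round s t h) = butlast h"
  by (simp add: partial_round_def)

lemma last_partial_round [simp]:
  "last (partial_round s t h) = (if s then fst (last h) else [], if t then snd (last h) else [])"
  by (simp add: partial_round_def)

lemma partial_round_partial_round: "partial_round s t (partial_round s' t' h) = partial_round (s \<and> s') (t \<and> t') h"
  by (simp add: partial_round_def)

definition is_partial_round :: "nat \<Rightarrow> bool \<Rightarrow> bool \<Rightarrow> lhist \<Rightarrow> bool" where
  "is_partial_round n s t h \<longleftrightarrow> length h = Suc n \<and> (\<not> s \<longrightarrow> fst (last h) = []) \<and> (\<not> t \<longrightarrow> snd (last h) = [])"

lemma partial_round_snoc_eq_iff: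
  "partial_round s t (k @ [e]) = h \<longleftrightarrow> h \<noteq> [] \<and> butlast h = k \<and>
    (s \<longrightarrow> fst (last h) = fst e) \<and> (\<not> s \<longrightarrow> fst (last h) = []) \<and>
    (t \<longrightarrow> snd (last h) = snd e) \<and> (\<not> t \<longrightarrow> snd (last h) = [])"
  by (cases h rule: rev_cases) (auto simp: partial_round_def prod_eq_iff)

section \<open>Runs as conditions on the randomness of each party\<close>

context
  fixes P :: "('x, 'y, 'z, 'ra, 'rb, 'rc) protocol"
begin

definition consA :: "'x \<Rightarrow> 'ra \<Rightarrow> lhist \<Rightarrow> lhist \<Rightarrow> bool" where
  "consA x ra h12 h31 \<longleftrightarrow> (\<forall>i<length h12.
     sendA P x ra (take i h12) (take i h31) = (fst (h12 ! i), snd (h31 ! i)))"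

definition consB :: "'y \<Rightarrow> 'rb \<Rightarrow> lhist \<Rightarrow> lhist \<Rightarrow> bool" where
  "consB y rb h12 h23 \<longleftrightarrow> (\<forall>i<length h12.
     sendB P y rb (take i h12) (take i h23) = (snd (h12 ! i), fst (h23 ! i)))"

definition consC :: "'rc \<Rightarrow> lhist \<Rightarrow> lhist \<Rightarrow> bool" where
  "consC rc h23 h31 \<longleftrightarrow> (\<forall>i<length h23.
     sendC P rc (take i h23) (take i h31) = (snd (h23 ! i), fst (h31 ! i)))"

lemma consA_snoc: "length h12 = length h31 \<Longrightarrow> consA x ra (h12 @ [e]) (h31 @ [e']) \<longleftrightarrow>
    consA x ra h12 h31 \<and> sendA P x ra h12 h31 = (fst e, snd e')"
  unfolding consA_def by (auto simp: nth_append less_Suc_eq)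

lemma consB_snoc: "length h12 = length h23 \<Longrightarrow> consB y rb (h12 @ [e]) (h23 @ [e']) \<longleftrightarrow>
    consB y rb h12 h23 \<and> sendB P y rb h12 h23 = (snd e, fst e')"
  unfolding consB_def by (auto simp: nth_append less_Suc_eq)

lemma consC_snoc: "length h23 = length h31 \<Longrightarrow> consC rc (h23 @ [e]) (h31 @ [e']) \<longleftrightarrow>
    consC rc h23 h31 \<and> sendC P rc h23 h31 = (snd e, fst e')"
  unfolding consC_def by (auto simp: nth_append less_Suc_eq)

text \<open>The rectangle property: the event splits into three conditions, each on the randomness
  of a single party. It is the source of all product formulas for laws of runs.\<close>

lemma hist_eq_iff:
  "hist P x y (ra, rb, rc) n = (h12, h23, h31) \<longleftrightarrow>
     length h12 = n \<and> length h23 = n \<and> length h31 = n \<and>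
     consA x ra h12 h31 \<and> consB y rb h12 h23 \<and> consC rc h23 h31"
proof (induction n arbitrary: h12 h23 h31)
  case 0
  show ?case by (auto simp: consA_def consB_def consC_def)
next
  case (Suc n)
  show ?case
  proof (cases "length h12 = Suc n \<and> length h23 = Suc n \<and> length h31 = Suc n")
    case True
    then obtain k12 e12 k23 e23 k31 e31 where h: "h12 = k12 @ [e12]" "h23 = k23 @ [e23]" "h31 = k31 @ [e31]"
      by (metis length_Suc_conv_rev)
    with True have len: "length k12 = n" "length k23 = n" "length k31 = n" by auto
    show ?thesis
      using Suc.IH[of k12 k23 k31] len
      by (auto simp: h consA_snoc consB_snoc consC_snoc split: prod.splits)
  next
    case False
    obtain g12 g23 g31 where g: "hist P x y (ra, rb, rc) n = (g12, g23, g31)" by (cases "hist P x y (ra, rb, rc) n")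
    with Suc.IH[of g12 g23 g31] have "length g12 = n" "length g23 = n" "length g31 = n" by auto
    with False g show ?thesis by (auto split: prod.splits)
  qed
qed

abbreviation "H12 x y r n \<equiv> fst (hist P x y r n)"
abbreviation "H23 x y r n \<equiv> fst (snd (hist P x y r n))"
abbreviation "H31 x y r n \<equiv> snd (snd (hist P x y r n))"

lemma hist_Suc:
  "\<exists>e12 e23 e31. hist P x y r (Suc n) = (H12 x y r n @ [e12], H23 x y r n @ [e23], H31 x y r n @ [e31])"
  by (auto split: prod.splits)

lemma length_hist: "length (H12 x y r n) = n \<and> length (H23 x y r n) = n \<and> length (H31 x y r n) = n"
proof -
  obtain ra rb rc where r: "r = (ra, rb, rc)" by (cases r)
  show ?thesis
    using hist_eq_iff[of x y ra rb rc n "H12 x y r n" "H23 x y r n" "H31 x y r n"] by (simp add: r)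
qed

lemma butlast_hist: "butlast (H12 x y r (Suc n)) = H12 x y r n \<and>
    butlast (H23 x y r (Suc n)) = H23 x y r n \<and> butlast (H31 x y r (Suc n)) = H31 x y r n"
  using hist_Suc[of x y r n] by auto

lemma flat_hist_mono:
  assumes "n \<le> k"
  shows "prefix (flat (H12 x y r n)) (flat (H12 x y r k)) \<and> prefix (flat (H23 x y r n)) (flat (H23 x y r k)) \<and>
    prefix (flat (H31 x y r n)) (flat (H31 x y r k))"
  using assms
proof (induction k rule: dec_induct)
  case (step k)
  obtain e12 e23 e31 where "hist P x y r (Suc k) = (H12 x y r k @ [e12], H23 x y r k @ [e23], H31 x y r k @ [e31])"
    using hist_Suc by blast
  with step.IH show ?case by (simp add: flat_snoc prefix_append)
qed simp

lemma terminates_eventually: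
  assumes "terminates P x y r"
  obtains N where "\<And>n. n \<ge> N \<Longrightarrow> flat (H12 x y r n) = M12 P x y r"
    "\<And>n. n \<ge> N \<Longrightarrow> flat (H23 x y r n) = M23 P x y r"
    "\<And>n. n \<ge> N \<Longrightarrow> flat (H31 x y r n) = M31 P x y r"
proof -
  define N where "N = (LEAST N. \<forall>n\<ge>N. transcripts P x y r n = transcripts P x y r N)"
  from assms have "\<forall>n\<ge>N. transcripts P x y r n = transcripts P x y r N"
    unfolding terminates_def N_def by (rule LeastI_ex)
  hence "transcripts P x y r n = transcripts P x y r N" if "n \<ge> N" for n
    using that by blast
  hence eq: "transcripts P x y r n = final_transcripts P x y r" if "n \<ge> N" for n
    unfolding final_transcripts_def N_def[symmetric] using that by blast
  have tr: "transcripts P x y r n = (flat (H12 x y r n), flat (H23 x y r n), flat (H31 x y r n))" for n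
    by (simp add: transcripts_def case_prod_unfold)
  show thesis
    by (rule that[of N]) (simp_all add: M12_def M23_def M31_def eq[symmetric] tr)
qed

lemma flat_hist_prefix:
  assumes "terminates P x y r"
  shows "prefix (flat (H12 x y r n)) (M12 P x y r) \<and> prefix (flat (H23 x y r n)) (M23 P x y r) \<and>
    prefix (flat (H31 x y r n)) (M31 P x y r)"
proof -
  obtain N where N: "\<And>n. n \<ge> N \<Longrightarrow> flat (H12 x y r n) = M12 P x y r"
    "\<And>n. n \<ge> N \<Longrightarrow> flat (H23 x y r n) = M23 P x y r"
    "\<And>n. n \<ge> N \<Longrightarrow> flat (H31 x y r n) = M31 P x y r"
    using terminates_eventually[OF assms] by metis
  show ?thesis
    using flat_hist_mono[of n "max n N" x y r] N[of "max n N"] by simp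
qed

text \<open>The flags \<open>s\<close> and \<open>t\<close> tell which components of the message
  pair of the last round have been sent already.\<close>

definition partA :: "bool \<Rightarrow> bool \<Rightarrow> 'x \<Rightarrow> 'ra \<Rightarrow> lhist \<Rightarrow> lhist \<Rightarrow> bool" where
  "partA s t x ra h12 h31 \<longleftrightarrow> consA x ra (butlast h12) (butlast h31) \<and>
     (s \<longrightarrow> fst (sendA P x ra (butlast h12) (butlast h31)) = fst (last h12)) \<and>
     (t \<longrightarrow> snd (sendA P x ra (butlast h12) (butlast h31)) = snd (last h31))"

definition partB :: "bool \<Rightarrow> bool \<Rightarrow> 'y \<Rightarrow> 'rb \<Rightarrow> lhist \<Rightarrow> lhist \<Rightarrow> bool" where
  "partB s t y rb h12 h23 \<longleftrightarrow> consB y rb (butlast h12) (butlast h23) \<and>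
     (s \<longrightarrow> fst (sendB P y rb (butlast h12) (butlast h23)) = snd (last h12)) \<and>
     (t \<longrightarrow> snd (sendB P y rb (butlast h12) (butlast h23)) = fst (last h23))"

definition partC :: "bool \<Rightarrow> bool \<Rightarrow> 'rc \<Rightarrow> lhist \<Rightarrow> lhist \<Rightarrow> bool" where
  "partC s t rc h23 h31 \<longleftrightarrow> consC rc (butlast h23) (butlast h31) \<and>
     (s \<longrightarrow> fst (sendC P rc (butlast h23) (butlast h31)) = snd (last h23)) \<and>
     (t \<longrightarrow> snd (sendC P rc (butlast h23) (butlast h31)) = fst (last h31))"

text \<open>Messages of a round depend on completed rounds only, so the six of them may be revealed
  in any order; whichever have been revealed, the event remains a rectangle.\<close>

lemma partial_round_hist_eq_iff:
  "partial_round a1 b1 (H12 x y (ra, rb, rc) (Suc n)) = h12 \<and> partial_round b2 c1 (H23 x y (ra, rb, rc) (Suc n)) = h23 \<and>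
     partial_round c2 a2 (H31 x y (ra, rb, rc) (Suc n)) = h31 \<longleftrightarrow>
   (is_partial_round n a1 b1 h12 \<and> is_partial_round n b2 c1 h23 \<and> is_partial_round n c2 a2 h31) \<and>
     partA a1 a2 x ra h12 h31 \<and> partB b1 b2 y rb h12 h23 \<and> partC c1 c2 rc h23 h31"
proof -
  obtain g12 g23 g31 where g: "hist P x y (ra, rb, rc) n = (g12, g23, g31)" by (cases "hist P x y (ra, rb, rc) n")
  have h: "hist P x y (ra, rb, rc) (Suc n) =
    (g12 @ [(fst (sendA P x ra g12 g31), fst (sendB P y rb g12 g23))],
     g23 @ [(snd (sendB P y rb g12 g23), fst (sendC P rc g23 g31))],
     g31 @ [(snd (sendC P rc g23 g31), snd (sendA P x ra g12 g31))])"
    by (simp add: g case_prod_unfold)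
  have len: "length g12 = n" "length g23 = n" "length g31 = n"
    using length_hist[of x y "(ra, rb, rc)" n] by (simp_all add: g)
  have eq: "(g12, g23, g31) = (butlast h12, butlast h23, butlast h31) \<longleftrightarrow>
      length h12 - 1 = n \<and> length h23 - 1 = n \<and> length h31 - 1 = n \<and> consA x ra (butlast h12) (butlast h31) \<and>
      consB y rb (butlast h12) (butlast h23) \<and> consC rc (butlast h23) (butlast h31)"
    using hist_eq_iff[of x y ra rb rc n "butlast h12" "butlast h23" "butlast h31"] by (simp add: g)
  \<comment> \<open>With \<open>n\<close> = 0 the empty list also satisfies the equation in
    truncated subtraction, so nonemptiness is kept as a separate conjunct.\<close>
  have lenSuc: "length h = Suc n \<longleftrightarrow> h \<noteq> [] \<and> length h - 1 = n" for h :: lhist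
    by (cases h) auto
  show ?thesis
  proof (cases "(g12, g23, g31) = (butlast h12, butlast h23, butlast h31)")
    case True
    hence g12: "g12 = butlast h12" "g23 = butlast h23" "g31 = butlast h31" by simp_all
    show ?thesis
      using eq[THEN iffD1, OF True]
      unfolding h fst_conv snd_conv partial_round_snoc_eq_iff is_partial_round_def partA_def partB_def partC_def lenSuc g12
      by argo
  next
    case False
    with eq show ?thesis
      unfolding h fst_conv snd_conv partial_round_snoc_eq_iff is_partial_round_def partA_def partB_def partC_def lenSuc prod.inject
      by argo
  qed
qed

end

text \<open>Both laws contain the same factor \<open>R\<close>, the only place where
  \<open>t\<close> occurs, and \<open>R\<close> sees \<open>U'\<close> only through \<pi>. Refining
  \<open>U\<close> to \<open>U'\<close> therefore leaves the conditional law of \<open>T\<close>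
  unchanged.\<close>

lemma cond_indepI:
  fixes U' :: "'w \<Rightarrow> 'a" and U :: "'w \<Rightarrow> 'b" and V :: "'w \<Rightarrow> 'c" and T :: "'w \<Rightarrow> 'd"
  assumes U: "\<And>w. U w = \<pi> (U' w)"
    and law': "\<And>u v t. measure_pmf.prob p {w. U' w = u \<and> V w = v \<and> T w = t} = F' u v * R (\<pi> u) v t"
    and law: "\<And>u v t. measure_pmf.prob p {w. U w = u \<and> V w = v \<and> T w = t} = F u v * R u v t"
  shows "cond_indep p U' T (\<lambda>w. (U w, V w))"
  unfolding cond_indep_def
proof
  fix w assume w: "w \<in> set_pmf p"
  define u v t where "u = U' w" and "v = V w" and "t = T w"
  define S where "S = (\<Sum>\<^sub>\<infinity>t. R (\<pi> u) v t)"
  have "mass p (\<lambda>w. (U' w, T w, U w, V w)) w = F' u v * R (\<pi> u) v t"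
    unfolding mass_def law'[symmetric] by (rule prob_cong) (auto simp: U u_def v_def t_def)
  moreover have "mass p (\<lambda>w. (U w, V w)) w = F (\<pi> u) v * S"
    using infsum_prob_fibres[of p "\<lambda>w'. U w' = \<pi> u \<and> V w' = v" T] law[of "\<pi> u" v]
    by (simp add: mass_def U u_def v_def S_def infsum_cmult_right' conj_assoc)
  moreover have "mass p (\<lambda>w. (U' w, U w, V w)) w = F' u v * S"
  proof -
    have "mass p (\<lambda>w. (U' w, U w, V w)) w = measure_pmf.prob p {w'. U' w' = u \<and> V w' = v}"
      unfolding mass_def by (rule prob_cong) (auto simp: U u_def v_def)
    also have "\<dots> = F' u v * S"
      using infsum_prob_fibres[of p "\<lambda>w'. U' w' = u \<and> V w' = v" T] law'[of u v]
      by (simp add: S_def infsum_cmult_right' conj_assoc)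
    finally show ?thesis .
  qed
  moreover have "mass p (\<lambda>w. (T w, U w, V w)) w = F (\<pi> u) v * R (\<pi> u) v t"
    unfolding mass_def law[symmetric] by (rule prob_cong) (auto simp: U u_def v_def t_def)
  ultimately show "mass p (\<lambda>w. (U' w, T w, U w, V w)) w * mass p (\<lambda>w. (U w, V w)) w =
      mass p (\<lambda>w. (U' w, U w, V w)) w * mass p (\<lambda>w. (T w, U w, V w)) w"
    by simp
qed

text \<open>A change of representation counts as a trivial message, which lets a chain of
  \<open>evolves\<close> steps pass between encodings of a history.\<close>

lemma refined_relabel:
  assumes "det_by p A A'" "det_by p A' A"
  shows "refined p A A' B C"
proof -
  have "cond_indep p A' C (\<lambda>w. (A w, B w))"
    unfolding cond_indep_def
  proof
    fix w assume w: "w \<in> set_pmf p"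
    have "mass p (\<lambda>w. (A' w, C w, A w, B w)) w = mass p (\<lambda>w. (C w, A w, B w)) w"
      "mass p (\<lambda>w. (A' w, A w, B w)) w = mass p (\<lambda>w. (A w, B w)) w"
      using assms w by (intro mass_cong; iprover intro: det_intros)+
    thus "mass p (\<lambda>w. (A' w, C w, A w, B w)) w * mass p (\<lambda>w. (A w, B w)) w =
        mass p (\<lambda>w. (A' w, A w, B w)) w * mass p (\<lambda>w. (C w, A w, B w)) w"
      by simp
  qed
  thus ?thesis using assms(1) by (simp add: refined_def)
qed

lemma evolves_relabel:
  assumes "evolves p A0 B0 C0 A B C"
    and "det_by p A A'" "det_by p A' A" "det_by p B B'" "det_by p B' B" "det_by p C C'" "det_by p C' C"
  shows "evolves p A0 B0 C0 A' B' C'"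
  by (rule evolves_right[OF evolves_mid[OF evolves_left[OF assms(1)]]]) (rule refined_relabel assms)+

text \<open>Bridge from arbitrary randomness spaces to mass functions: the image measure on a
  countable type is determined by its points.\<close>

lemma law_pmf_exists:
  fixes F :: "'r \<Rightarrow> 'c::countable"
  assumes "prob_space M" and F: "F \<in> M \<rightarrow>\<^sub>M count_space UNIV"
  shows "\<exists>q. \<forall>E. measure_pmf.prob q E = measure M {r \<in> space M. F r \<in> E}"
proof -
  interpret M: prob_space M by fact
  define D where "D = distr M (count_space UNIV) F"
  interpret D: prob_space D unfolding D_def by (rule M.prob_space_distr[OF F])
  have sets: "sets D = UNIV" by (simp add: D_def)
  have single: "emeasure D E = (\<integral>\<^sup>+a. ennreal (measure D {a}) \<partial>count_space E)" for E
    using emeasure_countable_singleton[of E D] by (simp add: sets D.emeasure_eq_measure)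
  have "space D = UNIV" by (simp add: D_def)
  hence pmf: "pmf (embed_pmf (\<lambda>a. measure D {a})) a = measure D {a}" for a
    using single[of UNIV] D.emeasure_space_1 by (intro pmf_embed_pmf) auto
  have "emeasure (measure_pmf (embed_pmf (\<lambda>a. measure D {a}))) E = emeasure D E" for E
    unfolding single by (simp add: nn_integral_pmf[symmetric] pmf)
  hence "measure_pmf.prob (embed_pmf (\<lambda>a. measure D {a})) E = measure D E" for E
    by (simp add: measure_def)
  moreover have "measure D E = measure M {r \<in> space M. F r \<in> E}" for E
    unfolding D_def by (subst measure_distr[OF F]) (auto intro!: arg_cong[where f = "measure M"])
  ultimately show ?thesis by metis
qed

section \<open>Measurability and the law of a terminating run\<close>

locale run_protocol =
  fixes P :: "('x::finite, 'y::finite, 'z::finite, 'ra, 'rb, 'rc) protocol"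
    and pXY :: "'x \<Rightarrow> 'y \<Rightarrow> real"
  assumes valid: "valid_protocol pXY P" and pos: "\<And>x y. pXY x y > 0"
begin

lemma prob_spaces: "prob_space (rndA P)" "prob_space (rndB P)" "prob_space (rndC P)"
  using valid by (simp_all add: valid_protocol_def)

lemma prob_space_rnd: "prob_space (rnd P)"
  unfolding rnd_def by (intro prob_space_pair prob_spaces)

lemma send_measurable [measurable]:
  "(\<lambda>ra. sendA P x ra h h') \<in> rndA P \<rightarrow>\<^sub>M count_space UNIV"
  "(\<lambda>rb. sendB P y rb h h') \<in> rndB P \<rightarrow>\<^sub>M count_space UNIV"
  "(\<lambda>rc. sendC P rc h h') \<in> rndC P \<rightarrow>\<^sub>M count_space UNIV"
  "(\<lambda>rc. outC P rc m m') \<in> rndC P \<rightarrow>\<^sub>M count_space UNIV"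
  using valid by (simp_all add: valid_protocol_def)

lemma send_component_measurable [measurable]:
  "(\<lambda>ra. fst (sendA P x ra h h')) \<in> rndA P \<rightarrow>\<^sub>M count_space UNIV"
  "(\<lambda>ra. snd (sendA P x ra h h')) \<in> rndA P \<rightarrow>\<^sub>M count_space UNIV"
  "(\<lambda>rb. fst (sendB P y rb h h')) \<in> rndB P \<rightarrow>\<^sub>M count_space UNIV"
  "(\<lambda>rb. snd (sendB P y rb h h')) \<in> rndB P \<rightarrow>\<^sub>M count_space UNIV"
  "(\<lambda>rc. fst (sendC P rc h h')) \<in> rndC P \<rightarrow>\<^sub>M count_space UNIV"
  "(\<lambda>rc. snd (sendC P rc h h')) \<in> rndC P \<rightarrow>\<^sub>M count_space UNIV"
  by (rule measurable_compose[OF send_measurable(1)] measurable_compose[OF send_measurable(2)]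
      measurable_compose[OF send_measurable(3)], simp)+

lemma cons_measurable [measurable]:
  "Measurable.pred (rndA P) (\<lambda>ra. consA P x ra h h')"
  "Measurable.pred (rndB P) (\<lambda>rb. consB P y rb h h')"
  "Measurable.pred (rndC P) (\<lambda>rc. consC P rc h h')"
  unfolding consA_def consB_def consC_def by measurable

lemma part_measurable [measurable]:
  "Measurable.pred (rndA P) (\<lambda>ra. partA P s t x ra h h')"
  "Measurable.pred (rndB P) (\<lambda>rb. partB P s t y rb h h')"
  "Measurable.pred (rndC P) (\<lambda>rc. partC P s t rc h h')"
  unfolding partA_def partB_def partC_def by measurable

lemma component_measurable [measurable]:
  "fst \<in> rnd P \<rightarrow>\<^sub>M rndA P" "(\<lambda>r. fst (snd r)) \<in> rnd P \<rightarrow>\<^sub>M rndB P" "(\<lambda>r. snd (snd r)) \<in> rnd P \<rightarrow>\<^sub>M rndC P"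
  unfolding rnd_def by measurable

lemma measure_rectangle:
  assumes [measurable]: "Measurable.pred (rndA P) a" "Measurable.pred (rndB P) b" "Measurable.pred (rndC P) c"
  shows "measure (rnd P) {r \<in> space (rnd P). a (fst r) \<and> b (fst (snd r)) \<and> c (snd (snd r))} =
    measure (rndA P) {r \<in> space (rndA P). a r} * measure (rndB P) {r \<in> space (rndB P). b r} *
    measure (rndC P) {r \<in> space (rndC P). c r}"
proof -
  interpret C: prob_space "rndC P" by (rule prob_spaces)
  interpret BC: prob_space "rndB P \<Otimes>\<^sub>M rndC P" by (intro prob_space_pair prob_spaces)
  define EA EB EC where "EA = {r \<in> space (rndA P). a r}" and "EB = {r \<in> space (rndB P). b r}"
    and "EC = {r \<in> space (rndC P). c r}"
  have [measurable]: "EA \<in> sets (rndA P)" "EB \<in> sets (rndB P)" "EC \<in> sets (rndC P)"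
    unfolding EA_def EB_def EC_def by measurable
  have "{r \<in> space (rnd P). a (fst r) \<and> b (fst (snd r)) \<and> c (snd (snd r))} = EA \<times> (EB \<times> EC)"
    by (auto simp: rnd_def space_pair_measure EA_def EB_def EC_def)
  moreover have "emeasure (rnd P) (EA \<times> (EB \<times> EC)) = emeasure (rndA P) EA * (emeasure (rndB P) EB * emeasure (rndC P) EC)"
    unfolding rnd_def by (subst BC.emeasure_pair_measure_Times) (auto simp: C.emeasure_pair_measure_Times)
  ultimately show ?thesis
    by (simp add: measure_def enn2real_mult EA_def EB_def EC_def mult.assoc)
qed

lemma hist_measurable [measurable]: "(\<lambda>r. hist P x y r n) \<in> rnd P \<rightarrow>\<^sub>M count_space UNIV"
proof (rule measurable_count_space_eq2_countable[THEN iffD2], intro conjI ballI)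
  fix h :: "lhist \<times> lhist \<times> lhist"
  obtain h12 h23 h31 where h: "h = (h12, h23, h31)" by (cases h)
  have "(\<lambda>r. hist P x y r n) -` {h} \<inter> space (rnd P) =
      {r \<in> space (rnd P). (length h12 = n \<and> length h23 = n \<and> length h31 = n) \<and>
     consA P x (fst r) h12 h31 \<and> consB P y (fst (snd r)) h12 h23 \<and> consC P (snd (snd r)) h23 h31}"
    by (auto simp: h hist_eq_iff simp del: hist.simps)
  also have "\<dots> \<in> sets (rnd P)" by measurable
  finally show "(\<lambda>r. hist P x y r n) -` {h} \<inter> space (rnd P) \<in> sets (rnd P)" .
qed auto

lemma transcripts_measurable [measurable]: "(\<lambda>r. transcripts P x y r n) \<in> rnd P \<rightarrow>\<^sub>M count_space UNIV"
  unfolding transcripts_def by (rule measurable_compose[OF hist_measurable]) simp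

lemma final_measurable: "(\<lambda>r. final_transcripts P x y r) \<in> rnd P \<rightarrow>\<^sub>M count_space UNIV"
proof -
  have [measurable]: "Measurable.pred (rnd P) (\<lambda>r. \<forall>n\<ge>N. transcripts P x y r n = transcripts P x y r N)" for N
    by measurable
  have "(\<lambda>r. LEAST N. \<forall>n\<ge>N. transcripts P x y r n = transcripts P x y r N) \<in> rnd P \<rightarrow>\<^sub>M count_space UNIV"
    by measurable
  thus ?thesis
    unfolding final_transcripts_def by (rule measurable_compose_countable[rotated]) measurable
qed

lemma Zout_measurable: "(\<lambda>r. Zout P x y r) \<in> rnd P \<rightarrow>\<^sub>M count_space UNIV"
proof -
  have "(\<lambda>r. (M23 P x y r, M31 P x y r)) \<in> rnd P \<rightarrow>\<^sub>M count_space UNIV"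
    unfolding M23_def M31_def by (rule measurable_compose[OF final_measurable]) simp
  moreover have "(\<lambda>r. outC P (snd (snd r)) (fst m) (snd m)) \<in> rnd P \<rightarrow>\<^sub>M count_space UNIV" for m
    by measurable
  ultimately have "(\<lambda>r. outC P (snd (snd r)) (fst (M23 P x y r, M31 P x y r)) (snd (M23 P x y r, M31 P x y r)))
      \<in> rnd P \<rightarrow>\<^sub>M count_space UNIV"
    by (rule measurable_compose_countable[rotated])
  thus ?thesis by (simp add: Zout_def)
qed

definition outcome :: "'x \<Rightarrow> 'y \<Rightarrow> 'ra \<times> 'rb \<times> 'rc \<Rightarrow> 'x \<times> 'y \<times> 'z \<times> msg \<times> msg \<times> msg" where
  "outcome x y r = (x, y, Zout P x y r, M12 P x y r, M23 P x y r, M31 P x y r)"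

lemma outcome_measurable: "(\<lambda>r. outcome x y r) \<in> rnd P \<rightarrow>\<^sub>M count_space UNIV"
proof -
  have "(\<lambda>r. (x, y, z, fst (final_transcripts P x y r), fst (snd (final_transcripts P x y r)),
      snd (snd (final_transcripts P x y r)))) \<in> rnd P \<rightarrow>\<^sub>M count_space UNIV" for z :: 'z
    by (rule measurable_compose[OF final_measurable]) simp
  from measurable_compose_countable[OF this Zout_measurable[of x y]]
  show ?thesis by (simp add: outcome_def M12_def M23_def M31_def)
qed

definition law :: "'x \<Rightarrow> 'y \<Rightarrow> ('x \<times> 'y \<times> 'z \<times> msg \<times> msg \<times> msg) pmf" where
  "law x y = (SOME q. \<forall>E. measure_pmf.prob q E = measure (rnd P) {r \<in> space (rnd P). outcome x y r \<in> E})"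

lemma prob_law: "measure_pmf.prob (law x y) E = measure (rnd P) {r \<in> space (rnd P). outcome x y r \<in> E}"
  using someI_ex[OF law_pmf_exists[OF prob_space_rnd outcome_measurable[of x y]]] unfolding law_def by blast

lemma AE_terminates: "AE r in rnd P. terminates P x y r"
  using valid pos by (simp add: valid_protocol_def)

text \<open>On a nonterminating run the final transcripts rest on an unspecified
  \<open>LEAST\<close>; such runs have probability 0, so events are compared on terminating
  runs.\<close>

lemma prob_law_terminating:
  assumes [measurable]: "Measurable.pred (rnd P) \<Psi>"
    and eq: "\<And>r. terminates P x y r \<Longrightarrow> \<Phi> (outcome x y r) \<longleftrightarrow> \<Psi> r"
  shows "measure_pmf.prob (law x y) {w. \<Phi> w} = measure (rnd P) {r \<in> space (rnd P). \<Psi> r}"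
  unfolding prob_law
proof (rule measure_eq_AE)
  show "AE r in rnd P. (r \<in> {r \<in> space (rnd P). outcome x y r \<in> {w. \<Phi> w}}) = (r \<in> {r \<in> space (rnd P). \<Psi> r})"
    using AE_terminates[of x y] by eventually_elim (simp add: eq)
  have "(\<lambda>r. outcome x y r) -` {w. \<Phi> w} \<inter> space (rnd P) \<in> sets (rnd P)"
    by (rule measurable_sets[OF outcome_measurable]) simp
  thus "{r \<in> space (rnd P). outcome x y r \<in> {w. \<Phi> w}} \<in> sets (rnd P)"
    by (simp add: vimage_def Int_def conj_commute)
qed measurable

text \<open>A point reached by no terminating run would have probability 0, against its membership
  in the support.\<close>

lemma set_law:
  assumes "w \<in> set_pmf (law x y)"
  shows "\<exists>r. terminates P x y r \<and> outcome x y r = w"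
proof (rule ccontr)
  assume no: "\<not> ?thesis"
  have "measure_pmf.prob (law x y) {v. v = w} = measure (rnd P) {r \<in> space (rnd P). False}"
    by (rule prob_law_terminating) (use no in auto)
  moreover have "measure_pmf.prob (law x y) {v. v = w} > 0"
    by (rule measure_pmf_posI[OF assms]) simp
  ultimately show False by simp
qed

abbreviation "parse12 \<equiv> parse (codebook P AtoB) (codebook P BtoA)"
abbreviation "parse23 \<equiv> parse (codebook P BtoC) (codebook P CtoB)"
abbreviation "parse31 \<equiv> parse (codebook P CtoA) (codebook P AtoC)"

lemma valid_hist_run:
  "valid_hist (codebook P AtoB) (codebook P BtoA) (H12 P x y r n) \<and>
   valid_hist (codebook P BtoC) (codebook P CtoB) (H23 P x y r n) \<and>
   valid_hist (codebook P CtoA) (codebook P AtoC) (H31 P x y r n)"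
proof (induction n)
  case 0
  show ?case by (simp add: valid_hist_def)
next
  case (Suc n)
  obtain ra rb rc where r: "r = (ra, rb, rc)" by (cases r)
  have cb: "fst (sendA P x ra h h') \<in> codebook P AtoB h" "snd (sendA P x ra h h') \<in> codebook P AtoC h'"
    "fst (sendB P y rb h h') \<in> codebook P BtoA h" "snd (sendB P y rb h h') \<in> codebook P BtoC h'"
    "fst (sendC P rc h h') \<in> codebook P CtoB h" "snd (sendC P rc h h') \<in> codebook P CtoA h'" for h h'
    using valid unfolding valid_protocol_def by blast+
  obtain h12 h23 h31 where h: "hist P x y (ra, rb, rc) n = (h12, h23, h31)" by (cases "hist P x y (ra, rb, rc) n")
  show ?case using Suc by (simp add: r h case_prod_unfold valid_hist_snoc cb)
qed

lemma codebook_prefix_free: "prefix_free (codebook P d h)"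
  using valid by (simp add: valid_protocol_def)

lemma parse_run:
  assumes "terminates P x y r"
  shows "parse12 n (M12 P x y r) = H12 P x y r n" "parse23 n (M23 P x y r) = H23 P x y r n"
    "parse31 n (M31 P x y r) = H31 P x y r n"
  using valid_hist_run[of x y r n] flat_hist_prefix[OF assms, of n] length_hist[of P x y r n]
  by (auto intro!: parse_eq codebook_prefix_free)

end

type_synonym ('x, 'y, 'z) outcome = "'x \<times> 'y \<times> 'z \<times> msg \<times> msg \<times> msg"

definition inX :: "('x, 'y, 'z) outcome \<Rightarrow> 'x" where "inX w = fst w"
definition inY :: "('x, 'y, 'z) outcome \<Rightarrow> 'y" where "inY w = fst (snd w)"
definition outZ :: "('x, 'y, 'z) outcome \<Rightarrow> 'z" where "outZ w = fst (snd (snd w))"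
definition tr12 :: "('x, 'y, 'z) outcome \<Rightarrow> msg" where "tr12 w = fst (snd (snd (snd w)))"
definition tr23 :: "('x, 'y, 'z) outcome \<Rightarrow> msg" where "tr23 w = fst (snd (snd (snd (snd w))))"
definition tr31 :: "('x, 'y, 'z) outcome \<Rightarrow> msg" where "tr31 w = snd (snd (snd (snd (snd w))))"

text \<open>\<open>parse\<close> is unspecified on strings that no history fits, so possible final
  transcripts have to be singled out.\<close>

definition complete :: "(nat \<Rightarrow> msg \<Rightarrow> lhist) \<Rightarrow> msg \<Rightarrow> bool" where
  "complete h m \<longleftrightarrow> (\<forall>n. length (h n m) = n) \<and> (\<exists>N. \<forall>n\<ge>N. flat (h n m) = m)"

context run_protocol
begin

lemma outcome_simps [simp]:
  "inX (outcome x y r) = x" "inY (outcome x y r) = y" "outZ (outcome x y r) = Zout P x y r"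
  "tr12 (outcome x y r) = M12 P x y r" "tr23 (outcome x y r) = M23 P x y r" "tr31 (outcome x y r) = M31 P x y r"
  by (simp_all add: inX_def inY_def outZ_def tr12_def tr23_def tr31_def outcome_def)

lemma law_inputs: "w \<in> set_pmf (law x y) \<Longrightarrow> inX w = x \<and> inY w = y"
  using set_law[of w x y] by auto

definition probA :: "('ra \<Rightarrow> bool) \<Rightarrow> real" where "probA Q = measure (rndA P) {r \<in> space (rndA P). Q r}"
definition probB :: "('rb \<Rightarrow> bool) \<Rightarrow> real" where "probB Q = measure (rndB P) {r \<in> space (rndB P). Q r}"
definition probC :: "('rc \<Rightarrow> bool) \<Rightarrow> real" where "probC Q = measure (rndC P) {r \<in> space (rndC P). Q r}"

lemma measure_rectangle_of_bool:
  assumes "Measurable.pred (rndA P) a" "Measurable.pred (rndB P) b" "Measurable.pred (rndC P) c"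
  shows "measure (rnd P) {r \<in> space (rnd P). D \<and> a (fst r) \<and> b (fst (snd r)) \<and> c (snd (snd r))} =
    of_bool D * (probA a * probB b * probC c)"
  using measure_rectangle[OF assms] by (cases D) (simp_all add: probA_def probB_def probC_def)

text \<open>On a terminating run the final strings are \<open>a\<close>, \<open>b\<close>,
  \<open>c\<close> exactly when these are complete and every finite history is the one parsed from
  them. This is a countable intersection of rectangles, hence a rectangle.\<close>

lemma law_transcripts:
  "measure_pmf.prob (law x y) {w. tr12 w = a \<and> tr31 w = b \<and> tr23 w = c \<and> outZ w = z} =
    of_bool (complete parse12 a \<and> complete parse31 b \<and> complete parse23 c) *
    (probA (\<lambda>ra. \<forall>n. consA P x ra (parse12 n a) (parse31 n b)) *
     probB (\<lambda>rb. \<forall>n. consB P y rb (parse12 n a) (parse23 n c)) *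
     probC (\<lambda>rc. outC P rc c b = z \<and> (\<forall>n. consC P rc (parse23 n c) (parse31 n b))))" (is "_ = of_bool ?D * _")
proof (subst measure_rectangle_of_bool[symmetric])
  show "Measurable.pred (rndA P) (\<lambda>ra. \<forall>n. consA P x ra (parse12 n a) (parse31 n b))"
    "Measurable.pred (rndB P) (\<lambda>rb. \<forall>n. consB P y rb (parse12 n a) (parse23 n c))"
    "Measurable.pred (rndC P) (\<lambda>rc. outC P rc c b = z \<and> (\<forall>n. consC P rc (parse23 n c) (parse31 n b)))"
    by measurable
  let ?Q = "\<lambda>r. ?D \<and> (\<forall>n. consA P x (fst r) (parse12 n a) (parse31 n b)) \<and>
      (\<forall>n. consB P y (fst (snd r)) (parse12 n a) (parse23 n c)) \<and>
      (outC P (snd (snd r)) c b = z \<and> (\<forall>n. consC P (snd (snd r)) (parse23 n c) (parse31 n b)))"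
  show "measure_pmf.prob (law x y) {w. tr12 w = a \<and> tr31 w = b \<and> tr23 w = c \<and> outZ w = z} =
      measure (rnd P) {r \<in> space (rnd P). ?Q r}"
  proof (rule prob_law_terminating)
    show "Measurable.pred (rnd P) ?Q" by measurable
    fix r assume fin: "terminates P x y r"
    obtain ra rb rc where r: "r = (ra, rb, rc)" by (cases r)
    obtain N where N: "\<And>n. n \<ge> N \<Longrightarrow> flat (H12 P x y r n) = M12 P x y r"
      "\<And>n. n \<ge> N \<Longrightarrow> flat (H23 P x y r n) = M23 P x y r"
      "\<And>n. n \<ge> N \<Longrightarrow> flat (H31 P x y r n) = M31 P x y r"
      using terminates_eventually[OF fin] by metis
    note run = parse_run[OF fin]
    have "tr12 (outcome x y r) = a \<and> tr31 (outcome x y r) = b \<and> tr23 (outcome x y r) = c \<and> outZ (outcome x y r) = z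
        \<longleftrightarrow> (M12 P x y r = a \<and> M31 P x y r = b \<and> M23 P x y r = c) \<and> outC P rc c b = z"
      by (auto simp: Zout_def r)
    also have "M12 P x y r = a \<and> M31 P x y r = b \<and> M23 P x y r = c \<longleftrightarrow>
        ?D \<and> (\<forall>n. hist P x y (ra, rb, rc) n = (parse12 n a, parse23 n c, parse31 n b))"
    proof
      assume M: "M12 P x y r = a \<and> M31 P x y r = b \<and> M23 P x y r = c"
      have h: "parse12 n a = H12 P x y r n" "parse23 n c = H23 P x y r n" "parse31 n b = H31 P x y r n" for n
        using run[of n] M by auto
      have "complete parse12 a" "complete parse31 b" "complete parse23 c"
        unfolding complete_def h using N M length_hist[of P x y r] by auto
      thus "?D \<and> (\<forall>n. hist P x y (ra, rb, rc) n = (parse12 n a, parse23 n c, parse31 n b))"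
        by (simp add: h r)
    next
      assume h: "?D \<and> (\<forall>n. hist P x y (ra, rb, rc) n = (parse12 n a, parse23 n c, parse31 n b))"
      then obtain N1 N2 N3 where N': "\<And>n. n \<ge> N1 \<Longrightarrow> flat (parse12 n a) = a"
        "\<And>n. n \<ge> N2 \<Longrightarrow> flat (parse31 n b) = b" "\<And>n. n \<ge> N3 \<Longrightarrow> flat (parse23 n c) = c"
        unfolding complete_def by blast
      \<comment> \<open>Beyond all four thresholds both the run and the parsed histories have
        reached their final strings.\<close>
      define k where "k = max N (max N1 (max N2 N3))"
      have k: "k \<ge> N" "k \<ge> N1" "k \<ge> N2" "k \<ge> N3" by (auto simp: k_def)
      have "hist P x y r k = (parse12 k a, parse23 k c, parse31 k b)" using h by (simp add: r)
      thus "M12 P x y r = a \<and> M31 P x y r = b \<and> M23 P x y r = c"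
        using N(1)[OF k(1)] N(2)[OF k(1)] N(3)[OF k(1)] N'(1)[OF k(2)] N'(2)[OF k(3)] N'(3)[OF k(4)] by simp
    qed
    also have "(?D \<and> (\<forall>n. hist P x y (ra, rb, rc) n = (parse12 n a, parse23 n c, parse31 n b))) \<and> outC P rc c b = z
        \<longleftrightarrow> ?Q r"
      unfolding hist_eq_iff r fst_conv snd_conv complete_def by blast
    finally show "(tr12 (outcome x y r) = a \<and> tr31 (outcome x y r) = b \<and> tr23 (outcome x y r) = c \<and>
        outZ (outcome x y r) = z) \<longleftrightarrow> ?Q r" .
  qed
qed

section \<open>Sending the six messages of a round one at a time\<close>

definition stage12 :: "nat \<Rightarrow> bool \<Rightarrow> bool \<Rightarrow> ('x, 'y, 'z) outcome \<Rightarrow> lhist" where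
  "stage12 n s t w = partial_round s t (parse12 (Suc n) (tr12 w))"
definition stage23 :: "nat \<Rightarrow> bool \<Rightarrow> bool \<Rightarrow> ('x, 'y, 'z) outcome \<Rightarrow> lhist" where
  "stage23 n s t w = partial_round s t (parse23 (Suc n) (tr23 w))"
definition stage31 :: "nat \<Rightarrow> bool \<Rightarrow> bool \<Rightarrow> ('x, 'y, 'z) outcome \<Rightarrow> lhist" where
  "stage31 n s t w = partial_round s t (parse31 (Suc n) (tr31 w))"

lemma law_stage:
  "measure_pmf.prob (law x y) {w. stage12 n a1 b1 w = h12 \<and> stage23 n b2 c1 w = h23 \<and> stage31 n c2 a2 w = h31} =
    of_bool (is_partial_round n a1 b1 h12 \<and> is_partial_round n b2 c1 h23 \<and> is_partial_round n c2 a2 h31) *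
    (probA (\<lambda>ra. partA P a1 a2 x ra h12 h31) * probB (\<lambda>rb. partB P b1 b2 y rb h12 h23) *
     probC (\<lambda>rc. partC P c1 c2 rc h23 h31))"
proof (subst measure_rectangle_of_bool[symmetric, OF part_measurable], rule prob_law_terminating)
  fix r assume fin: "terminates P x y r"
  obtain ra rb rc where r: "r = (ra, rb, rc)" by (cases r)
  show "(stage12 n a1 b1 (outcome x y r) = h12 \<and> stage23 n b2 c1 (outcome x y r) = h23 \<and>
      stage31 n c2 a2 (outcome x y r) = h31) \<longleftrightarrow>
    (is_partial_round n a1 b1 h12 \<and> is_partial_round n b2 c1 h23 \<and> is_partial_round n c2 a2 h31) \<and> partA P a1 a2 x (fst r) h12 h31 \<and>
      partB P b1 b2 y (fst (snd r)) h12 h23 \<and> partC P c1 c2 (snd (snd r)) h23 h31"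
    unfolding stage12_def stage23_def stage31_def outcome_simps parse_run[OF fin]
    unfolding r fst_conv snd_conv
    by (rule partial_round_hist_eq_iff)
qed measurable

text \<open>Independence of the inputs enters here: the sum over \<open>x\<close> is absorbed into
  Alice's factor and the sum over \<open>y\<close> into Bob's, so averaging preserves the product
  form.\<close>

lemma mix_stage:
  fixes r :: "'x pmf" and s :: "'y pmf"
  defines "QA \<equiv> \<lambda>a1 a2 h12 h31. \<Sum>x\<in>UNIV. pmf r x * probA (\<lambda>ra. partA P a1 a2 x ra h12 h31)"
    and "QB \<equiv> \<lambda>b1 b2 h12 h23. \<Sum>y\<in>UNIV. pmf s y * probB (\<lambda>rb. partB P b1 b2 y rb h12 h23)"
    and "QC \<equiv> \<lambda>c1 c2 h23 h31. probC (\<lambda>rc. partC P c1 c2 rc h23 h31)"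
  shows "measure_pmf.prob (mix r s law)
      {w. stage12 n a1 b1 w = h12 \<and> stage23 n b2 c1 w = h23 \<and> stage31 n c2 a2 w = h31} =
    of_bool (is_partial_round n a1 b1 h12) * of_bool (is_partial_round n b2 c1 h23) * of_bool (is_partial_round n c2 a2 h31) *
    QA a1 a2 h12 h31 * QB b1 b2 h12 h23 * QC c1 c2 h23 h31"
proof -
  define k where "k = (of_bool (is_partial_round n a1 b1 h12 \<and> is_partial_round n b2 c1 h23 \<and> is_partial_round n c2 a2 h31) :: real)"
  have "measure_pmf.prob (mix r s law)
      {w. stage12 n a1 b1 w = h12 \<and> stage23 n b2 c1 w = h23 \<and> stage31 n c2 a2 w = h31} =
    (\<Sum>x\<in>UNIV. pmf r x * (\<Sum>y\<in>UNIV. pmf s y * (k *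
      (probA (\<lambda>ra. partA P a1 a2 x ra h12 h31) * probB (\<lambda>rb. partB P b1 b2 y rb h12 h23) *
      probC (\<lambda>rc. partC P c1 c2 rc h23 h31)))))"
    by (simp add: mix_def prob_bind law_stage k_def)
  also have "\<dots> = k * (QA a1 a2 h12 h31 * QB b1 b2 h12 h23 * QC c1 c2 h23 h31)"
    unfolding QA_def QB_def QC_def sum_product sum_distrib_left sum_distrib_right
    by (subst sum.swap) (simp add: mult_ac)
  finally show ?thesis by (simp add: k_def of_bool_conj mult_ac)
qed

lemma parse_eventually:
  assumes "w \<in> set_pmf (law x y)"
  shows "\<exists>N. \<forall>n\<ge>N. flat (parse12 n (tr12 w)) = tr12 w \<and> flat (parse23 n (tr23 w)) = tr23 w \<and>
      flat (parse31 n (tr31 w)) = tr31 w"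
    and "parse12 n (tr12 w) = butlast (parse12 (Suc n) (tr12 w)) \<and>
      parse23 n (tr23 w) = butlast (parse23 (Suc n) (tr23 w)) \<and>
      parse31 n (tr31 w) = butlast (parse31 (Suc n) (tr31 w))"
    and "length (parse12 n (tr12 w)) = n \<and> length (parse23 n (tr23 w)) = n \<and> length (parse31 n (tr31 w)) = n"
proof -
  obtain r where r: "terminates P x y r" "outcome x y r = w" using set_law[OF assms] by blast
  have t: "tr12 w = M12 P x y r" "tr23 w = M23 P x y r" "tr31 w = M31 P x y r"
    by (simp_all add: r(2)[symmetric])
  obtain N where "\<And>n. n \<ge> N \<Longrightarrow> flat (H12 P x y r n) = M12 P x y r"
      "\<And>n. n \<ge> N \<Longrightarrow> flat (H23 P x y r n) = M23 P x y r"
      "\<And>n. n \<ge> N \<Longrightarrow> flat (H31 P x y r n) = M31 P x y r"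
    using terminates_eventually[OF r(1)] by metis
  thus "\<exists>N. \<forall>n\<ge>N. flat (parse12 n (tr12 w)) = tr12 w \<and> flat (parse23 n (tr23 w)) = tr23 w \<and>
      flat (parse31 n (tr31 w)) = tr31 w"
    unfolding t parse_run[OF r(1)] by blast
  show "parse12 n (tr12 w) = butlast (parse12 (Suc n) (tr12 w)) \<and>
      parse23 n (tr23 w) = butlast (parse23 (Suc n) (tr23 w)) \<and>
      parse31 n (tr31 w) = butlast (parse31 (Suc n) (tr31 w))"
    unfolding t parse_run[OF r(1)] using butlast_hist[of P x y r n] by simp
  show "length (parse12 n (tr12 w)) = n \<and> length (parse23 n (tr23 w)) = n \<and> length (parse31 n (tr31 w)) = n"
    unfolding t parse_run[OF r(1)] by (rule length_hist)
qed

lemma set_mix_law: "w \<in> set_pmf (mix r s law) \<Longrightarrow> \<exists>x y. w \<in> set_pmf (law x y)"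
  by (auto simp: mix_def)

lemma exhausts_parse:
  "exhausts (mix r s law) (\<lambda>n w. parse12 n (tr12 w)) tr12"
  "exhausts (mix r s law) (\<lambda>n w. parse23 n (tr23 w)) tr23"
  "exhausts (mix r s law) (\<lambda>n w. parse31 n (tr31 w)) tr31"
proof -
  have main: "exhausts (mix r s law) (\<lambda>n w. h n (tr w)) tr"
    if ev: "\<And>w x y. w \<in> set_pmf (law x y) \<Longrightarrow> \<exists>N. \<forall>n\<ge>N. flat (h n (tr w)) = tr w"
      and bl: "\<And>w x y n. w \<in> set_pmf (law x y) \<Longrightarrow> h n (tr w) = butlast (h (Suc n) (tr w))"
    for h :: "nat \<Rightarrow> msg \<Rightarrow> lhist" and tr :: "('x, 'y, 'z) outcome \<Rightarrow> msg"
    unfolding exhausts_def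
  proof (intro conjI allI ballI impI)
    fix n
    show "det_by (mix r s law) (\<lambda>w. h n (tr w)) (\<lambda>w. h (Suc n) (tr w))"
    proof (rule det_byI)
      fix w w' assume w: "w \<in> set_pmf (mix r s law)" "w' \<in> set_pmf (mix r s law)"
        and eq: "h (Suc n) (tr w) = h (Suc n) (tr w')"
      obtain x y x' y' where "w \<in> set_pmf (law x y)" "w' \<in> set_pmf (law x' y')"
        using set_mix_law[OF w(1)] set_mix_law[OF w(2)] by blast
      from bl[OF this(1)] bl[OF this(2)] eq show "h n (tr w) = h n (tr w')" by metis
    qed
    show "det_by (mix r s law) (\<lambda>w. h n (tr w)) tr" by (rule det_byI) simp
  next
    fix w w' assume w: "w \<in> set_pmf (mix r s law)" "w' \<in> set_pmf (mix r s law)"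
      and eq: "\<forall>n. h n (tr w) = h n (tr w')"
    obtain x y x' y' where w': "w \<in> set_pmf (law x y)" "w' \<in> set_pmf (law x' y')"
      using set_mix_law[OF w(1)] set_mix_law[OF w(2)] by blast
    obtain N N' where "\<forall>n\<ge>N. flat (h n (tr w)) = tr w" "\<forall>n\<ge>N'. flat (h n (tr w')) = tr w'"
      using ev[OF w'(1)] ev[OF w'(2)] by blast
    \<comment> \<open>The stabilisation thresholds depend on the outcome, so the two outcomes are
      compared at the larger one.\<close>
    hence "flat (h (max N N') (tr w)) = tr w" "flat (h (max N N') (tr w')) = tr w'" by simp_all
    with eq show "tr w = tr w'" by metis
  qed
  show "exhausts (mix r s law) (\<lambda>n w. parse12 n (tr12 w)) tr12"
    by (rule main) (use parse_eventually in blast)+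
  show "exhausts (mix r s law) (\<lambda>n w. parse23 n (tr23 w)) tr23"
    by (rule main) (use parse_eventually in blast)+
  show "exhausts (mix r s law) (\<lambda>n w. parse31 n (tr31 w)) tr31"
    by (rule main) (use parse_eventually in blast)+
qed

lemma stage_partial_round:
  "stage12 n False t w = partial_round False True (stage12 n True t w)" "stage12 n s False w = partial_round True False (stage12 n s True w)"
  "stage23 n False t w = partial_round False True (stage23 n True t w)" "stage23 n s False w = partial_round True False (stage23 n s True w)"
  "stage31 n False t w = partial_round False True (stage31 n True t w)" "stage31 n s False w = partial_round True False (stage31 n s True w)"
  by (simp_all add: stage12_def stage23_def stage31_def partial_round_partial_round)

text \<open>In the round in progress a party reads just the slots it fills itself. This places the
  factors of the other two parties into the common \<open>R\<close> of
  \<open>cond_indepI\<close>.\<close>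

lemma part_partial_round:
  "partA P s t x ra (partial_round True u h12) h31 = partA P s t x ra h12 h31"
  "partA P s t x ra h12 (partial_round u True h31) = partA P s t x ra h12 h31"
  "partB P s t y rb (partial_round u True h12) h23 = partB P s t y rb h12 h23"
  "partB P s t y rb h12 (partial_round True u h23) = partB P s t y rb h12 h23"
  "partC P s t rc (partial_round u True h23) h31 = partC P s t rc h23 h31"
  "partC P s t rc h23 (partial_round True u h31) = partC P s t rc h23 h31"
  by (simp_all add: partA_def partB_def partC_def)

lemma det_partial_round:
  assumes "\<And>w. U w = partial_round s t (U' w)"
  shows "det_by p U U'"
  by (rule det_byI) (simp add: assms)

text \<open>Alice sends on both her links, then Bob, then Charlie. When a party writes on a link,
  the factors of the other two ignore the new slot, so \<open>cond_indepI\<close> applies with the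
  sender's two links as the condition.\<close>

lemma evolves_round:
  fixes r :: "'x pmf" and s :: "'y pmf"
  defines "p \<equiv> mix r s law"
  assumes "evolves p A0 B0 C0 (stage12 n False False) (stage31 n False False) (stage23 n False False)"
  shows "evolves p A0 B0 C0 (stage12 n True True) (stage31 n True True) (stage23 n True True)"
proof -
  define QA where "QA = (\<lambda>a1 a2 h12 h31. \<Sum>x\<in>UNIV. pmf r x * probA (\<lambda>ra. partA P a1 a2 x ra h12 h31))"
  define QB where "QB = (\<lambda>b1 b2 h12 h23. \<Sum>y\<in>UNIV. pmf s y * probB (\<lambda>rb. partB P b1 b2 y rb h12 h23))"
  define QC where "QC = (\<lambda>c1 c2 h23 h31. probC (\<lambda>rc. partC P c1 c2 rc h23 h31))"
  define m :: "bool \<Rightarrow> bool \<Rightarrow> lhist \<Rightarrow> real" where "m s t h = of_bool (is_partial_round n s t h)" for s t h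
  have law: "measure_pmf.prob p {w. stage12 n a1 b1 w = h12 \<and> stage23 n b2 c1 w = h23 \<and> stage31 n c2 a2 w = h31} =
      m a1 b1 h12 * m b2 c1 h23 * m c2 a2 h31 * QA a1 a2 h12 h31 * QB b1 b2 h12 h23 * QC c1 c2 h23 h31"
    for a1 a2 b1 b2 c1 c2 h12 h23 h31
    unfolding p_def QA_def QB_def QC_def m_def by (rule mix_stage)
  have Q: "QA a1 a2 (partial_round True u h12) h31 = QA a1 a2 h12 h31" "QA a1 a2 h12 (partial_round u True h31) = QA a1 a2 h12 h31"
    "QB b1 b2 (partial_round u True h12) h23 = QB b1 b2 h12 h23" "QB b1 b2 h12 (partial_round True u h23) = QB b1 b2 h12 h23"
    "QC c1 c2 (partial_round u True h23) h31 = QC c1 c2 h23 h31" "QC c1 c2 h23 (partial_round True u h31) = QC c1 c2 h23 h31"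
    for a1 a2 b1 b2 c1 c2 u h12 h23 h31
    by (simp_all add: QA_def QB_def QC_def part_partial_round)

  \<comment> \<open>The same law with its conjuncts permuted, to match the order in
    \<open>cond_indepI\<close>: refined link, other link of the sender, remaining link.\<close>
  have law1231: "measure_pmf.prob p {w. stage12 n a1 b1 w = h12 \<and> stage31 n c2 a2 w = h31 \<and> stage23 n b2 c1 w = h23} =
      m a1 b1 h12 * m b2 c1 h23 * m c2 a2 h31 * QA a1 a2 h12 h31 * QB b1 b2 h12 h23 * QC c1 c2 h23 h31"
    for a1 a2 b1 b2 c1 c2 h12 h23 h31 unfolding law[symmetric] by (rule prob_cong) auto
  have law3112: "measure_pmf.prob p {w. stage31 n c2 a2 w = h31 \<and> stage12 n a1 b1 w = h12 \<and> stage23 n b2 c1 w = h23} =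
      m a1 b1 h12 * m b2 c1 h23 * m c2 a2 h31 * QA a1 a2 h12 h31 * QB b1 b2 h12 h23 * QC c1 c2 h23 h31"
    for a1 a2 b1 b2 c1 c2 h12 h23 h31 unfolding law[symmetric] by (rule prob_cong) auto
  have law2312: "measure_pmf.prob p {w. stage23 n b2 c1 w = h23 \<and> stage12 n a1 b1 w = h12 \<and> stage31 n c2 a2 w = h31} =
      m a1 b1 h12 * m b2 c1 h23 * m c2 a2 h31 * QA a1 a2 h12 h31 * QB b1 b2 h12 h23 * QC c1 c2 h23 h31"
    for a1 a2 b1 b2 c1 c2 h12 h23 h31 unfolding law[symmetric] by (rule prob_cong) auto
  have law2331: "measure_pmf.prob p {w. stage23 n b2 c1 w = h23 \<and> stage31 n c2 a2 w = h31 \<and> stage12 n a1 b1 w = h12} =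
      m a1 b1 h12 * m b2 c1 h23 * m c2 a2 h31 * QA a1 a2 h12 h31 * QB b1 b2 h12 h23 * QC c1 c2 h23 h31"
    for a1 a2 b1 b2 c1 c2 h12 h23 h31 unfolding law[symmetric] by (rule prob_cong) auto
  have law3123: "measure_pmf.prob p {w. stage31 n c2 a2 w = h31 \<and> stage23 n b2 c1 w = h23 \<and> stage12 n a1 b1 w = h12} =
      m a1 b1 h12 * m b2 c1 h23 * m c2 a2 h31 * QA a1 a2 h12 h31 * QB b1 b2 h12 h23 * QC c1 c2 h23 h31"
    for a1 a2 b1 b2 c1 c2 h12 h23 h31 unfolding law[symmetric] by (rule prob_cong) auto

  have A12: "refined p (stage12 n False b1) (stage12 n True b1) (stage31 n c2 a2) (stage23 n b2 c1)" for b1 c2 a2 b2 c1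
    unfolding refined_def
  proof (intro conjI disjI1)
    show "det_by p (stage12 n False b1) (stage12 n True b1)" by (rule det_partial_round) (rule stage_partial_round)
    show "cond_indep p (stage12 n True b1) (stage23 n b2 c1) (\<lambda>w. (stage12 n False b1 w, stage31 n c2 a2 w))"
      by (rule cond_indepI[where \<pi> = "partial_round False True"
            and R = "\<lambda>u v t. m b2 c1 t * QB b1 b2 u t * QC c1 c2 t v"
            and F' = "\<lambda>u v. m True b1 u * m c2 a2 v * QA True a2 u v"
            and F = "\<lambda>u v. m False b1 u * m c2 a2 v * QA False a2 u v"])
        (rule stage_partial_round, simp_all only: law1231 Q mult_ac)
  qed
  have A31: "refined p (stage31 n c2 False) (stage31 n c2 True) (stage12 n a1 b1) (stage23 n b2 c1)" for a1 b1 c2 b2 c1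
    unfolding refined_def
  proof (intro conjI disjI1)
    show "det_by p (stage31 n c2 False) (stage31 n c2 True)" by (rule det_partial_round) (rule stage_partial_round)
    show "cond_indep p (stage31 n c2 True) (stage23 n b2 c1) (\<lambda>w. (stage31 n c2 False w, stage12 n a1 b1 w))"
      by (rule cond_indepI[where \<pi> = "partial_round True False"
            and R = "\<lambda>u v t. m b2 c1 t * QB b1 b2 v t * QC c1 c2 t u"
            and F' = "\<lambda>u v. m a1 b1 v * m c2 True u * QA a1 True v u"
            and F = "\<lambda>u v. m a1 b1 v * m c2 False u * QA a1 False v u"])
        (rule stage_partial_round, simp_all only: law3112 Q mult_ac)
  qed
  \<comment> \<open>Bob does not see the Charlie-Alice link, which is the first companion here,
    hence the second alternative of \<open>refined\<close>.\<close>
  have B12: "refined p (stage12 n a1 False) (stage12 n a1 True) (stage31 n c2 a2) (stage23 n b2 c1)" for a1 c2 a2 b2 c1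
    unfolding refined_def
  proof (intro conjI disjI2)
    show "det_by p (stage12 n a1 False) (stage12 n a1 True)" by (rule det_partial_round) (rule stage_partial_round)
    show "cond_indep p (stage12 n a1 True) (stage31 n c2 a2) (\<lambda>w. (stage12 n a1 False w, stage23 n b2 c1 w))"
      by (rule cond_indepI[where \<pi> = "partial_round True False"
            and R = "\<lambda>u v t. m c2 a2 t * QA a1 a2 u t * QC c1 c2 v t"
            and F' = "\<lambda>u v. m a1 True u * m b2 c1 v * QB True b2 u v"
            and F = "\<lambda>u v. m a1 False u * m b2 c1 v * QB False b2 u v"])
        (rule stage_partial_round, simp_all only: law Q mult_ac)
  qed
  have B23: "refined p (stage23 n False c1) (stage23 n True c1) (stage12 n a1 b1) (stage31 n c2 a2)" for a1 b1 c2 a2 c1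
    unfolding refined_def
  proof (intro conjI disjI1)
    show "det_by p (stage23 n False c1) (stage23 n True c1)" by (rule det_partial_round) (rule stage_partial_round)
    show "cond_indep p (stage23 n True c1) (stage31 n c2 a2) (\<lambda>w. (stage23 n False c1 w, stage12 n a1 b1 w))"
      by (rule cond_indepI[where \<pi> = "partial_round False True"
            and R = "\<lambda>u v t. m c2 a2 t * QA a1 a2 v t * QC c1 c2 u t"
            and F' = "\<lambda>u v. m a1 b1 v * m True c1 u * QB b1 True v u"
            and F = "\<lambda>u v. m a1 b1 v * m False c1 u * QB b1 False v u"])
        (rule stage_partial_round, simp_all only: law2312 Q mult_ac)
  qed
  have C23: "refined p (stage23 n b2 False) (stage23 n b2 True) (stage12 n a1 b1) (stage31 n c2 a2)" for a1 b1 c2 a2 b2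
    unfolding refined_def
  proof (intro conjI disjI2)
    show "det_by p (stage23 n b2 False) (stage23 n b2 True)" by (rule det_partial_round) (rule stage_partial_round)
    show "cond_indep p (stage23 n b2 True) (stage12 n a1 b1) (\<lambda>w. (stage23 n b2 False w, stage31 n c2 a2 w))"
      by (rule cond_indepI[where \<pi> = "partial_round True False"
            and R = "\<lambda>u v t. m a1 b1 t * QA a1 a2 t v * QB b1 b2 t u"
            and F' = "\<lambda>u v. m c2 a2 v * m b2 True u * QC True c2 u v"
            and F = "\<lambda>u v. m c2 a2 v * m b2 False u * QC False c2 u v"])
        (rule stage_partial_round, simp_all only: law2331 Q mult_ac)
  qed
  have C31: "refined p (stage31 n False a2) (stage31 n True a2) (stage12 n a1 b1) (stage23 n b2 c1)" for a1 b1 a2 b2 c1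
    unfolding refined_def
  proof (intro conjI disjI2)
    show "det_by p (stage31 n False a2) (stage31 n True a2)" by (rule det_partial_round) (rule stage_partial_round)
    show "cond_indep p (stage31 n True a2) (stage12 n a1 b1) (\<lambda>w. (stage31 n False a2 w, stage23 n b2 c1 w))"
      by (rule cond_indepI[where \<pi> = "partial_round False True"
            and R = "\<lambda>u v t. m a1 b1 t * QA a1 a2 t u * QB b1 b2 t v"
            and F' = "\<lambda>u v. m True a2 u * m b2 c1 v * QC c1 True v u"
            and F = "\<lambda>u v. m False a2 u * m b2 c1 v * QC c1 False v u"])
        (rule stage_partial_round, simp_all only: law3123 Q mult_ac)
  qed
  show ?thesis
    by (rule evolves_mid[OF evolves_right[OF evolves_right[OF evolves_left[OF evolves_mid[OF evolves_left[OF assms(2) A12] A31] B12] B23] C23] C31])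
qed

end

context run_protocol
begin

lemma stage_FF:
  assumes "w \<in> set_pmf (mix r s law)"
  shows "stage12 n False False w = parse12 n (tr12 w) @ [([], [])]"
    "stage23 n False False w = parse23 n (tr23 w) @ [([], [])]"
    "stage31 n False False w = parse31 n (tr31 w) @ [([], [])]"
proof -
  obtain x y where "w \<in> set_pmf (law x y)" using set_mix_law[OF assms] by blast
  from parse_eventually(2)[OF this, of n]
  show "stage12 n False False w = parse12 n (tr12 w) @ [([], [])]"
    "stage23 n False False w = parse23 n (tr23 w) @ [([], [])]"
    "stage31 n False False w = parse31 n (tr31 w) @ [([], [])]"
    by (simp_all add: stage12_def stage23_def stage31_def partial_round_def)
qed

lemma stage_TT:
  assumes "w \<in> set_pmf (mix r s law)"
  shows "stage12 n True True w = parse12 (Suc n) (tr12 w)"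
    "stage23 n True True w = parse23 (Suc n) (tr23 w)"
    "stage31 n True True w = parse31 (Suc n) (tr31 w)"
proof -
  obtain x y where "w \<in> set_pmf (law x y)" using set_mix_law[OF assms] by blast
  from parse_eventually(3)[OF this, of "Suc n"]
  have "parse12 (Suc n) (tr12 w) \<noteq> []" "parse23 (Suc n) (tr23 w) \<noteq> []" "parse31 (Suc n) (tr31 w) \<noteq> []"
    by (metis length_0_conv nat.distinct(1))+
  thus "stage12 n True True w = parse12 (Suc n) (tr12 w)"
    "stage23 n True True w = parse23 (Suc n) (tr23 w)"
    "stage31 n True True w = parse31 (Suc n) (tr31 w)"
    by (simp_all add: stage12_def stage23_def stage31_def partial_round_def)
qed

text \<open>A round opens by appending an entry of empty messages, a mere relabelling, and closes
  with the parsed history of one more round.\<close>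

lemma evolves_run:
  "evolves (mix r s law) (\<lambda>_. []) (\<lambda>_. []) (\<lambda>_. [])
    (\<lambda>w. parse12 n (tr12 w)) (\<lambda>w. parse31 n (tr31 w)) (\<lambda>w. parse23 n (tr23 w))"
proof (induction n)
  case 0
  show ?case by (simp add: parse_0 evolves_refl)
next
  case (Suc n)
  have "evolves (mix r s law) (\<lambda>_. []) (\<lambda>_. []) (\<lambda>_. [])
      (stage12 n False False) (stage31 n False False) (stage23 n False False)"
    by (rule evolves_relabel[OF Suc]) (rule det_byI, simp add: stage_FF)+
  hence "evolves (mix r s law) (\<lambda>_. []) (\<lambda>_. []) (\<lambda>_. [])
      (stage12 n True True) (stage31 n True True) (stage23 n True True)"
    by (rule evolves_round)
  thus ?case
    by (rule evolves_relabel) (rule det_byI, simp add: stage_TT)+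
qed

section \<open>From Markov chains under \<open>pXY\<close> to identities at each input pair\<close>

definition joint :: "(('x, 'y, 'z) outcome \<Rightarrow> bool) \<Rightarrow> real" where
  "joint \<Phi> = (\<Sum>x\<in>UNIV. \<Sum>y\<in>UNIV. pXY x y * measure_pmf.prob (law x y) {w. \<Phi> w})"

lemma Pr_outcome: "Pr pXY P (\<lambda>x y r. \<Phi> (outcome x y r)) = joint \<Phi>"
  by (simp add: Pr_def joint_def prob_law)

lemma joint_mono:
  assumes "\<And>w. \<Phi> w \<Longrightarrow> \<Psi> w"
  shows "joint \<Phi> \<le> joint \<Psi>"
  unfolding joint_def
  by (intro sum_mono mult_left_mono measure_pmf.finite_measure_mono)
    (use assms pos in \<open>auto simp: less_imp_le\<close>)

lemma joint_nonneg: "0 \<le> joint \<Phi>"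
  unfolding joint_def by (intro sum_nonneg mult_nonneg_nonneg) (use pos in \<open>auto simp: less_imp_le\<close>)

lemma joint_inputs:
  "joint (\<lambda>w. \<Phi> w \<and> inY w = y \<and> inX w = x) = pXY x y * measure_pmf.prob (law x y) {w. \<Phi> w}"
proof -
  have "measure_pmf.prob (law x' y') {w. \<Phi> w \<and> inY w = y \<and> inX w = x} =
      (if y' = y then if x' = x then measure_pmf.prob (law x y) {w. \<Phi> w} else 0 else 0)" for x' y'
  proof (cases "y' = y \<and> x' = x")
    case True
    hence "measure_pmf.prob (law x' y') {w. \<Phi> w \<and> inY w = y \<and> inX w = x} = measure_pmf.prob (law x' y') {w. \<Phi> w}"
      by (intro prob_cong) (auto dest: law_inputs)
    with True show ?thesis by simp
  next
    case False
    hence "measure_pmf.prob (law x' y') {w. \<Phi> w \<and> inY w = y \<and> inX w = x} = measure_pmf.prob (law x' y') {}"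
      by (intro prob_cong) (auto dest: law_inputs)
    with False show ?thesis by auto
  qed
  thus ?thesis
    by (simp add: joint_def if_distrib[of "\<lambda>t. _ * t"] sum.delta cong: if_cong)
qed

text \<open>Cancelling \<open>pXY x y\<close> > 0 turns the Markov identity into a statement about
  one input pair. If the conditioning event has probability 0, then \<open>e\<close> and
  \<open>v\<close> are 0 and the quotient by 0 does no harm.\<close>

lemma private_factor:
  assumes markov: "joint E * joint D = joint N * joint V"
    and E: "joint E = pXY x y * e" and V: "joint V = pXY x y * v"
    and le: "joint E \<le> joint V" "joint V \<le> joint D"
  shows "e = joint N / joint D * v"
proof (cases "joint D = 0")
  case True
  with le joint_nonneg[of E] joint_nonneg[of V] have "joint E = 0" "joint V = 0" by linarith+
  with E V pos[of x y] show ?thesis by simp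
next
  case False
  from markov have "pXY x y * (e * joint D) = pXY x y * (joint N * v)" by (simp add: E V mult_ac)
  with pos[of x y] have "e * joint D = joint N * v" by simp
  with False show ?thesis by (simp add: field_simps)
qed

lemma secure_kernel_law:
  fixes W :: "'x \<Rightarrow> 'y \<Rightarrow> 'z \<Rightarrow> real"
  assumes "cond_dist W" "normal_form W" and secure: "secure_protocol pXY W P"
  shows "\<exists>\<alpha> \<beta> \<gamma> f g h. secure_kernel W law inX inY outZ tr12 tr31 tr23 \<alpha> \<beta> \<gamma> f g h"
proof -
  \<comment> \<open>\<alpha>, \<beta> and \<gamma> are the conditional laws under \<open>pXY\<close>
    of the views of Alice, Bob and Charlie given \<open>x\<close>, \<open>y\<close> and
    \<open>z\<close>.\<close>
  define \<alpha> where "\<alpha> x a b = joint (\<lambda>w. (tr12 w, tr31 w) = (a, b) \<and> inX w = x) / joint (\<lambda>w. inX w = x)" for x a b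
  define \<beta> where "\<beta> y a c = joint (\<lambda>w. (tr12 w, tr23 w) = (a, c) \<and> inY w = y) / joint (\<lambda>w. inY w = y)" for y a c
  define \<gamma> where "\<gamma> z c b = joint (\<lambda>w. (tr23 w, tr31 w) = (c, b) \<and> outZ w = z) / joint (\<lambda>w. outZ w = z)" for z c b
  \<comment> \<open>\<open>law_transcripts\<close> carries one \<open>complete\<close> condition per
    link; those of \<open>a\<close> and \<open>b\<close> go to Alice's factor, that of
    \<open>c\<close> to Bob's.\<close>
  define f where "f x a b = of_bool (complete parse12 a \<and> complete parse31 b) *
      probA (\<lambda>ra. \<forall>n. consA P x ra (parse12 n a) (parse31 n b))" for x a b
  define g where "g y a c = of_bool (complete parse23 c) *
      probB (\<lambda>rb. \<forall>n. consB P y rb (parse12 n a) (parse23 n c))" for y a c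
  define h where "h z c b = probC (\<lambda>rc. outC P rc c b = z \<and> (\<forall>n. consC P rc (parse23 n c) (parse31 n b)))" for z c b
  have correct: "measure_pmf.prob (law x y) {w. outZ w = z} = W x y z" for x y z
    using secure pos unfolding secure_protocol_def prob_law by simp
  have m1: "joint (\<lambda>w. (tr12 w, tr31 w) = m \<and> inX w = x \<and> (inY w, outZ w) = v) * joint (\<lambda>w. inX w = x) =
      joint (\<lambda>w. (tr12 w, tr31 w) = m \<and> inX w = x) * joint (\<lambda>w. inX w = x \<and> (inY w, outZ w) = v)" for m x v
    using secure unfolding secure_protocol_def markov_chain_def Pr_outcome[symmetric] outcome_simps by blast
  have m2: "joint (\<lambda>w. (tr12 w, tr23 w) = m \<and> inY w = y \<and> (inX w, outZ w) = v) * joint (\<lambda>w. inY w = y) =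
      joint (\<lambda>w. (tr12 w, tr23 w) = m \<and> inY w = y) * joint (\<lambda>w. inY w = y \<and> (inX w, outZ w) = v)" for m y v
    using secure unfolding secure_protocol_def markov_chain_def Pr_outcome[symmetric] outcome_simps by blast
  have m3: "joint (\<lambda>w. (tr23 w, tr31 w) = m \<and> outZ w = z \<and> (inX w, inY w) = v) * joint (\<lambda>w. outZ w = z) =
      joint (\<lambda>w. (tr23 w, tr31 w) = m \<and> outZ w = z) * joint (\<lambda>w. outZ w = z \<and> (inX w, inY w) = v)" for m z v
    using secure unfolding secure_protocol_def markov_chain_def Pr_outcome[symmetric] outcome_simps by blast
  have "secure_kernel W law inX inY outZ tr12 tr31 tr23 \<alpha> \<beta> \<gamma> f g h"
  proof
    show "cond_dist W" "normal_form W" by fact+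
    show "inX w = x \<and> inY w = y" if "w \<in> set_pmf (law x y)" for x y w by (rule law_inputs[OF that])
    show "measure_pmf.prob (law x y) {w. outZ w = z} = W x y z" for x y z by (rule correct)
    show "measure_pmf.prob (law x y) {w. tr12 w = a \<and> tr31 w = b \<and> outZ w = z} = \<alpha> x a b * W x y z" for x y a b z
      unfolding \<alpha>_def
    proof (rule private_factor[OF m1[of "(a, b)" x "(y, z)"], where x = x and y = y])
      show "joint (\<lambda>w. (tr12 w, tr31 w) = (a, b) \<and> inX w = x \<and> (inY w, outZ w) = (y, z)) =
          pXY x y * measure_pmf.prob (law x y) {w. tr12 w = a \<and> tr31 w = b \<and> outZ w = z}"
        unfolding joint_inputs[symmetric] by (rule arg_cong[where f = joint]) auto
      show "joint (\<lambda>w. inX w = x \<and> (inY w, outZ w) = (y, z)) = pXY x y * W x y z"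
        unfolding correct[symmetric] joint_inputs[symmetric] by (rule arg_cong[where f = joint]) auto
    qed (rule joint_mono, simp)+
    show "measure_pmf.prob (law x y) {w. tr12 w = a \<and> tr23 w = c \<and> outZ w = z} = \<beta> y a c * W x y z" for x y a c z
      unfolding \<beta>_def
    proof (rule private_factor[OF m2[of "(a, c)" y "(x, z)"], where x = x and y = y])
      show "joint (\<lambda>w. (tr12 w, tr23 w) = (a, c) \<and> inY w = y \<and> (inX w, outZ w) = (x, z)) =
          pXY x y * measure_pmf.prob (law x y) {w. tr12 w = a \<and> tr23 w = c \<and> outZ w = z}"
        unfolding joint_inputs[symmetric] by (rule arg_cong[where f = joint]) auto
      show "joint (\<lambda>w. inY w = y \<and> (inX w, outZ w) = (x, z)) = pXY x y * W x y z"
        unfolding correct[symmetric] joint_inputs[symmetric] by (rule arg_cong[where f = joint]) auto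
    qed (rule joint_mono, simp)+
    show "measure_pmf.prob (law x y) {w. tr23 w = c \<and> tr31 w = b \<and> outZ w = z} = \<gamma> z c b * W x y z" for x y b c z
      unfolding \<gamma>_def
    proof (rule private_factor[OF m3[of "(c, b)" z "(x, y)"], where x = x and y = y])
      show "joint (\<lambda>w. (tr23 w, tr31 w) = (c, b) \<and> outZ w = z \<and> (inX w, inY w) = (x, y)) =
          pXY x y * measure_pmf.prob (law x y) {w. tr23 w = c \<and> tr31 w = b \<and> outZ w = z}"
        unfolding joint_inputs[symmetric] by (rule arg_cong[where f = joint]) auto
      show "joint (\<lambda>w. outZ w = z \<and> (inX w, inY w) = (x, y)) = pXY x y * W x y z"
        unfolding correct[symmetric] joint_inputs[symmetric] by (rule arg_cong[where f = joint]) auto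
    qed (rule joint_mono, simp)+
    show "measure_pmf.prob (law x y) {w. tr12 w = a \<and> tr31 w = b \<and> tr23 w = c \<and> outZ w = z} =
        f x a b * g y a c * h z c b" for x y a b c z
      unfolding law_transcripts f_def g_def h_def by (simp add: of_bool_conj mult_ac)
    show "\<exists>As Bs Cs :: nat \<Rightarrow> ('x, 'y, 'z) outcome \<Rightarrow> lhist.
        exhausts (mix pX pY law) As tr12 \<and> exhausts (mix pX pY law) Bs tr31 \<and> exhausts (mix pX pY law) Cs tr23 \<and>
        (\<forall>n. evolves (mix pX pY law) (\<lambda>_. []) (\<lambda>_. []) (\<lambda>_. []) (As n) (Bs n) (Cs n))" for pX pY
      by (intro exI[of _ "\<lambda>n w. parse12 n (tr12 w)"] exI[of _ "\<lambda>n w. parse31 n (tr31 w)"]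
          exI[of _ "\<lambda>n w. parse23 n (tr23 w)"] conjI allI exhausts_parse evolves_run)
  qed
  thus ?thesis by blast
qed

end

text \<open>Averaging a law that is the same at all input pairs returns it for any weights of total
  1, in particular for the possibly dependent original inputs.\<close>

lemma (in secure_kernel) joint_law_B:
  assumes "\<not> X_splits W" "(\<Sum>x\<in>UNIV. \<Sum>y\<in>UNIV. p x y) = 1"
  shows "(\<Sum>x\<in>UNIV. \<Sum>y\<in>UNIV. p x y * measure_pmf.prob (K x y) {w. B w = b}) =
    measure_pmf.prob (K x0 y0) {w. B w = b}"
proof -
  have "measure_pmf.prob (K x y) {w. B w = b} = measure_pmf.prob (K x0 y0) {w. B w = b}" for x y
    unfolding K_B by (rule law_B_const[OF assms(1)])
  hence "(\<Sum>x\<in>UNIV. \<Sum>y\<in>UNIV. p x y * measure_pmf.prob (K x y) {w. B w = b}) =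
      (\<Sum>x\<in>UNIV. \<Sum>y\<in>UNIV. p x y * measure_pmf.prob (K x0 y0) {w. B w = b})"
    by (intro sum.cong refl) simp
  thus ?thesis by (simp add: sum_distrib_right[symmetric] assms(2))
qed

section \<open>The two bounds under the original input distribution\<close>

theorem theorem5:
  fixes pXY :: "'x::finite \<Rightarrow> 'y::finite \<Rightarrow> real"
    and W :: "'x \<Rightarrow> 'y \<Rightarrow> 'z::finite \<Rightarrow> real"
    and P :: "('x, 'y, 'z, 'ra, 'rb, 'rc) protocol"
  assumes pXY_pos: "\<forall>x y. pXY x y > 0"
    and pXY_sum: "(\<Sum>x\<in>UNIV. \<Sum>y\<in>UNIV. pXY x y) = 1"
    and W_dist: "cond_dist W"
    and W_nf: "normal_form W"
    and secure: "secure_protocol pXY W P"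
  shows
    "(\<not> X_splits W \<longrightarrow>
        H_M31 pXY P \<ge>
          (SUP pX\<in>fs_dists.
             (SUP pY\<in>fs_dists. ennreal (residual_info (\<lambda>(y, z). \<Sum>x\<in>UNIV. pX x * pY y * W x y z)))
           + (SUP pY\<in>fs_dists. ennreal (cond_entropy (\<lambda>((x, z), y). pX x * pY y * W x y z)))))
     \<and>
     (\<not> Y_splits W \<longrightarrow>
        H_M23 pXY P \<ge>
          (SUP pY\<in>fs_dists.
             (SUP pX\<in>fs_dists. ennreal (residual_info (\<lambda>(x, z). \<Sum>y\<in>UNIV. pX x * pY y * W x y z)))
           + (SUP pX\<in>fs_dists. ennreal (cond_entropy (\<lambda>((y, z), x). pX x * pY y * W x y z)))))"
proof -
  interpret run_protocol P pXY
    using pXY_pos secure by unfold_locales (auto simp: secure_protocol_def)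
  obtain \<alpha> \<beta> \<gamma> f g h where "secure_kernel W law inX inY outZ tr12 tr31 tr23 \<alpha> \<beta> \<gamma> f g h"
    using secure_kernel_law[OF W_dist W_nf secure] by blast
  then interpret k: secure_kernel W law inX inY outZ tr12 tr31 tr23 \<alpha> \<beta> \<gamma> f g h .
  interpret sw: secure_kernel "\<lambda>y x. W x y" "\<lambda>y x. law x y" inY inX outZ tr12 tr23 tr31 \<beta> \<alpha> "\<lambda>z b c. \<gamma> z c b"
    g f "\<lambda>z b c. h z c b" by (rule k.swap)
  have Pr31: "Pr pXY P (\<lambda>x y r. M31 P x y r = m) = joint (\<lambda>w. tr31 w = m)" for m
    unfolding Pr_outcome[symmetric] by simp
  have Pr23: "Pr pXY P (\<lambda>x y r. M23 P x y r = m) = joint (\<lambda>w. tr23 w = m)" for m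
    unfolding Pr_outcome[symmetric] by simp
  have sum': "(\<Sum>y\<in>UNIV. \<Sum>x\<in>UNIV. pXY x y) = 1" using pXY_sum by (subst sum.swap)
  show ?thesis
  proof (intro conjI impI)
    assume ns: "\<not> X_splits W"
    \<comment> \<open>\<open>undefined\<close> serves as an arbitrary fixed input pair, since the
      law of the link is the same at all of them.\<close>
    have "H_M31 pXY P = disc_entropy (\<lambda>m. measure_pmf.prob (law undefined undefined) {w. tr31 w = m})"
      unfolding H_M31_def Pr31 joint_def by (simp only: k.joint_law_B[OF ns pXY_sum, of _ undefined undefined])
    thus "H_M31 pXY P \<ge>
          (SUP pX\<in>fs_dists.
             (SUP pY\<in>fs_dists. ennreal (residual_info (\<lambda>(y, z). \<Sum>x\<in>UNIV. pX x * pY y * W x y z)))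
           + (SUP pY\<in>fs_dists. ennreal (cond_entropy (\<lambda>((x, z), y). pX x * pY y * W x y z))))"
      using k.entropy_bound[OF ns] by simp
  next
    assume ns: "\<not> Y_splits W"
    have "X_splits (\<lambda>y x. W x y) \<longleftrightarrow> Y_splits W"
    proof -
      have "Zset_X (\<lambda>y x. W x y) S = Zset_Y W S" for S by (auto simp: Zset_X_def Zset_Y_def)
      thus ?thesis by (simp add: X_splits_def Y_splits_def)
    qed
    with ns have ns': "\<not> X_splits (\<lambda>y x. W x y)" by simp
    have "joint (\<lambda>w. tr23 w = m) = measure_pmf.prob (law undefined undefined) {w. tr23 w = m}" for m
      unfolding joint_def
      by (subst sum.swap) (rule sw.joint_law_B[OF ns' sum'])
    hence "H_M23 pXY P = disc_entropy (\<lambda>m. measure_pmf.prob (law undefined undefined) {w. tr23 w = m})"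
      unfolding H_M23_def Pr23 by simp
    thus "H_M23 pXY P \<ge>
          (SUP pY\<in>fs_dists.
             (SUP pX\<in>fs_dists. ennreal (residual_info (\<lambda>(x, z). \<Sum>y\<in>UNIV. pX x * pY y * W x y z)))
           + (SUP pX\<in>fs_dists. ennreal (cond_entropy (\<lambda>((y, z), x). pX x * pY y * W x y z))))"
      using sw.entropy_bound[OF ns', of undefined undefined] by (simp add: mult.commute)
  qed
qed

end
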